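(* Let $k>0$, $a>0$. Let $f_I\in L^\infty(\mathbb{R})\cap L^1(\mathbb{R})$ with $xf_I\in L^1(\mathbb{R})$, $f_I\ge 0$ on $(-\infty,0)$, $f_I(0)=0$, $f_I\le 0$ on $(0,\infty)$, and with $M^l:=\int_{\mathbb{R}} f_I^+\,dx>0$, $M^r:=\int_{\mathbb{R}} f_I^-\,dx>0$. Define $F_I(x)=\sum_{n=0}^\infty f_I^+(x+na)$ for $x<0$ and $F_I(x)=-\sum_{n=0}^\infty f_I^-(x-na)$ for $x>0$, and assume $F_I\in W^{1,\infty}(\mathbb{R})$. Let $b_l,b_r\in C^{0,1}[0,\infty)$ with $b_l(0)=b_r(0)=0$ be such that: (i) $b:=\frac12(b_l-b_r)\in W^{1,\infty}(0,\infty)\cap W^{1,1}(0,\infty)$; (ii) the limits $\lim_{t\to\infty}b_l(t)=b_l^\infty$ and $\lim_{t\to\infty}b_r(t)=b_r^\infty$ exist; (iii) $|b_l(t)-b_l^\infty|+|b_r(t)-b_r^\infty|=\mathcal{O}((1+t)^{-w})$ for all $t>0$, with some $w>\frac32$. Put $l^\infty=e^{b_l^\infty}$, $r^\infty=e^{b_r^\infty}$, $\alpha^l=\frac{l^\infty}{a}M^l$, $\alpha^r=\frac{r^\infty}{a}M^r$, and suppose $\alpha^l=\alpha^r=:\alpha$. Let $p=p(t)$ be the free boundary and $\lambda=\lambda(t)$ the transaction rate defined in the context. Then $$p(t)=\beta_2+o(1)\quad\text{as }t\to\infty,$$ with $$\beta_2=\frac{1}{2\alpha a}\left[l^\infty\int_{-\infty}^0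 z f_I^+(z)\,dz+r^\infty\int_0^\infty z f_I^-(z)\,dz-a\int_0^\infty \zeta(\infty,s)\lambda(s)\,ds\right],$$ where $\zeta(\infty,s)=e^{b_l^\infty-b_l(s)}-e^{b_r^\infty-b_r(s)}$.
   Context: For a real-valued function $g$, $g^+=\max(g,0)$ and $g^-=-\min(g,0)$. $C^{0,1}[0,\infty)$ denotes Lipschitz continuous functions on $[0,\infty)$, and dots denote (a.e.) time derivatives. Free boundary: $F=F(x,t)$ is the unique global solution of $$F_t=kF_{xx}+\dot b_l(t)F^+-\dot b_r(t)F^-\ \text{ in }\mathbb{R}\times(0,\infty),\qquad F(\cdot,0)=F_I\ \text{ in }\mathbb{R},$$ and $p(t)$ is the unique zero of $F(\cdot,t)$, i.e. $F(p(t),t)=0$, with $p(0)=0$; $F(\cdot,t)$ is positive to the left of $p(t)$ and negative to the right. Transaction rate: $\lambda(t)=-kF_x(p(t),t)$. (Equivalently $\lambda(t)=-kf_x(p(t),t)$, where $f(x,t)=F(x,t)-F^+(x+a,t)+F^-(x-a,t)$ is the signed buyer-vendor density.) *)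

theory Defs
  imports "HOL-Analysis.Analysis" "HOL-Library.Landau_Symbols"
begin

definition pos_part :: "real \<Rightarrow> real" where
  "pos_part y = max y 0"

definition neg_part :: "real \<Rightarrow> real" where
  "neg_part y = - min y 0"

definition L1_on :: "real set \<Rightarrow> (real \<Rightarrow> real) \<Rightarrow> bool" where
  "L1_on S f \<longleftrightarrow> set_integrable lebesgue S f"

definition Linf_on :: "real set \<Rightarrow> (real \<Rightarrow> real) \<Rightarrow> bool" where
  "Linf_on S f \<longleftrightarrow> set_borel_measurable lebesgue S f \<and> (\<exists>C. AE x\<in>S in lebesgue. \<bar>f x\<bar> \<le> C)"

definition test_function :: "real set \<Rightarrow> (real \<Rightarrow> real) \<Rightarrow> bool" where
  "test_function S \<phi> \<longleftrightarrow>
     (\<forall>n. (deriv ^^ n) \<phi> differentiable_on UNIV) \<and>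
     compact (closure {x. \<phi> x \<noteq> 0}) \<and> closure {x. \<phi> x \<noteq> 0} \<subseteq> S"

definition weak_deriv_on :: "real set \<Rightarrow> (real \<Rightarrow> real) \<Rightarrow> (real \<Rightarrow> real) \<Rightarrow> bool" where
  "weak_deriv_on S f g \<longleftrightarrow>
     (\<forall>\<phi>. test_function S \<phi> \<longrightarrow>
        (LINT x:S|lebesgue. f x * deriv \<phi> x) = - (LINT x:S|lebesgue. g x * \<phi> x))"

definition W11_on :: "real set \<Rightarrow> (real \<Rightarrow> real) \<Rightarrow> bool" where
  "W11_on S f \<longleftrightarrow> L1_on S f \<and> (\<exists>g. L1_on S g \<and> weak_deriv_on S f g)"

definition W1inf_on :: "real set \<Rightarrow> (real \<Rightarrow> real) \<Rightarrow> bool" where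
  "W1inf_on S f \<longleftrightarrow> Linf_on S f \<and> (\<exists>g. Linf_on S g \<and> weak_deriv_on S f g)"

text \<open>For each \<open>x\<close> only finitely many terms of either series are nonzero when
  \<open>a > 0\<close>, \<open>f \<ge> 0\<close> on the left and \<open>f \<le> 0\<close> on the right of 0.
  At \<open>x = 0\<close>, where the two formulas both give 0, the value is set to 0.\<close>

definition initial_F :: "real \<Rightarrow> (real \<Rightarrow> real) \<Rightarrow> real \<Rightarrow> real" where
  "initial_F a f x =
     (if x < 0 then (\<Sum>n. pos_part (f (x + real n * a)))
      else if x > 0 then - (\<Sum>n. neg_part (f (x - real n * a)))
      else 0)"

text \<open>Global strong solutions of
  \<open>F\<^sub>t = k F\<^sub>x\<^sub>x + b\<^sub>l' F\<^sup>+ - b\<^sub>r' F\<^sup>-\<close> with initial value \<open>FI\<close>; the growth class is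
  boundedness on every strip \<open>\<real> \<times> [0, T]\<close>, which excludes the nonuniqueness of the heat equation.
  As \<open>bl\<close> and \<open>br\<close> are only Lipschitz, their derivatives, and hence the equation, are only
  available for almost every \<open>t\<close>; local Lipschitz continuity in \<open>t\<close> makes \<open>F x\<close> the integral of
  its almost everywhere derivative. The initial value is an equality of essentially bounded
  functions, i.e. it holds almost everywhere.\<close>

definition price_solution ::
  "real \<Rightarrow> (real \<Rightarrow> real) \<Rightarrow> (real \<Rightarrow> real) \<Rightarrow> (real \<Rightarrow> real) \<Rightarrow> (real \<Rightarrow> real \<Rightarrow> real) \<Rightarrow> bool" where
  "price_solution k bl br FI F \<longleftrightarrow>
     continuous_on (UNIV \<times> {0..}) (\<lambda>(x, t). F x t) \<and>
     (\<forall>T. bounded ((\<lambda>(x, t). F x t) ` (UNIV \<times> {0..T}))) \<and>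
     (AE x in lebesgue. F x 0 = FI x) \<and>
     (\<forall>x S T. 0 < S \<longrightarrow> S \<le> T \<longrightarrow> (\<exists>L. L-lipschitz_on {S..T} (F x))) \<and>
     (\<exists>Fx Fxx.
        continuous_on (UNIV \<times> {0<..}) (\<lambda>(x, t). Fxx x t) \<and>
        (\<forall>x. \<forall>t>0. ((\<lambda>y. F y t) has_real_derivative Fx x t) (at x) \<and>
                  ((\<lambda>y. Fx y t) has_real_derivative Fxx x t) (at x)) \<and>
        (\<forall>x. AE t in lebesgue. t > 0 \<longrightarrow>
           (F x has_real_derivative
              k * Fxx x t + deriv bl t * pos_part (F x t) - deriv br t * neg_part (F x t)) (at t)))"

text \<open>The sign condition is required for positive times only: \<open>FI\<close> may vanish on an interval
  around 0, so at time 0 the zero need not be unique and \<open>p 0 = 0\<close> is a normalisation.\<close>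

definition free_boundary :: "(real \<Rightarrow> real \<Rightarrow> real) \<Rightarrow> (real \<Rightarrow> real) \<Rightarrow> bool" where
  "free_boundary F p \<longleftrightarrow>
     p 0 = 0 \<and>
     (\<forall>t>0. F (p t) t = 0 \<and> (\<forall>x<p t. F x t > 0) \<and> (\<forall>x>p t. F x t < 0))"

definition transaction_rate :: "real \<Rightarrow> (real \<Rightarrow> real \<Rightarrow> real) \<Rightarrow> (real \<Rightarrow> real) \<Rightarrow> real \<Rightarrow> real" where
  "transaction_rate k F p t = - k * deriv (\<lambda>x. F x t) (p t)"

end

theory Submission
  imports Defs "HOL-Probability.Distributions" "HOL-Real_Asymp.Real_Asymp"
begin

text \<open>The function \<open>V = e\<^bsup>b\<^sub>l(\<infinity>) - b\<^sub>l(t)\<^esup> F\<^sup>+ - e\<^bsup>b\<^sub>r(\<infinity>) - b\<^sub>r(t)\<^esup> F\<^sup>-\<close> solves the heat equation with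
  the point source \<open>- \<zeta>(\<infinity>, t) \<lambda>(t)\<close> at the free boundary, so it is the heat evolution of its initial
  value minus a Duhamel integral along \<open>p\<close>. Since \<open>F\<^sup>+ \<ge> 0\<close>, the Duhamel integral of \<open>\<lambda>\<close> itself is
  bounded uniformly in space and time, without any pointwise information on \<open>\<lambda>\<close> or \<open>p\<close>. With the decay
  of \<open>\<zeta>\<close> this makes the source term vanish as \<open>t \<rightarrow> \<infinity>\<close>, and \<open>V(p(t), t) = 0\<close> forces
  \<open>p(t) = o(\<surd>t)\<close>. Hence \<open>\<integral>\<^sub>0\<^sup>t \<lambda> = O(\<surd>t)\<close>, \<open>\<zeta> \<lambda>\<close> is integrable, and \<open>\<surd>(4 \<pi> k t)\<close> times the source
  term converges to \<open>\<integral> \<zeta> \<lambda>\<close>. The initial value is a superposition of half-infinite combs of point masses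
  with spacing \<open>a\<close>; the midpoint rule for the heat kernel gives \<open>\<surd>(4 \<pi> k t)\<close> times its evolution at
  \<open>p(t)\<close> as \<open>- 2 \<alpha> p(t)\<close> plus a constant, and \<open>V(p(t), t) = 0\<close> yields the limit of \<open>p\<close>.\<close>

section \<open>Almost everywhere differentiability of Lipschitz functions\<close>

text \<open>Low regularity shapes the proof: \<open>bl\<close>, \<open>br\<close> and
  \<open>F x\<close> are only Lipschitz in time, no regularity of \<open>Fx\<close> in time is
  assumed, and for fixed \<open>x\<close> the set of times with \<open>p t = x\<close> is
  uncontrolled. Hence only identities integrated in time are used, and Lebesgue's differentiation
  theorem comes first. The two signs of \<open>F\<close> are treated separately: the factor
  \<open>exp (- bl t)\<close> removes the reaction term of the positive part, and the reflection
  \<open>- F (- x) t\<close> with \<open>bl\<close> and \<open>br\<close> exchanged turns the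
  negative part into the same problem. Recombined with the weights \<open>linf\<close> and
  \<open>rinf\<close>, the two equal fluxes leave the strength \<zeta>, and equality of the two
  \<alpha> cancels the leading term of the initial contribution. There is an apparent circle: the
  growth of the integral of \<lambda> is read off from the size of \<open>p\<close>, and the size of
  \<open>p\<close> from the source term; the uniform Duhamel bound breaks it. An exact limiting
  constant requires the midpoint error to vanish: cell errors that telescope make it of order 1 /
  sqrt t.\<close>

lemma ball_interval: "ball ((a + b) / 2) ((b - a) / 2) = {a<..<b::real}"
  by (simp add: ball_eq_greaterThanLessThan field_simps)

lemma cball_interval: "cball ((a + b) / 2) ((b - a) / 2) = {a..b::real}"
  by (simp add: cball_eq_atLeastAtMost field_simps)

text \<open>Vitali's theorem covers almost all of \<open>E\<close> by intervals on which \<open>f\<close> grows at rate less than \<open>p\<close>,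
  inside an open set barely larger than \<open>E\<close>, and then again, inside these intervals, by intervals on
  which it grows at rate more than \<open>q\<close>.\<close>

lemma two_slopes_null_sets:
  fixes f :: "real \<Rightarrow> real" and p q :: real
  assumes mono: "\<And>x y. x \<le> y \<Longrightarrow> f x \<le> f y" and cont: "continuous_on UNIV f" and pq: "0 < p" "p < q"
  defines "E \<equiv> {x. \<forall>d>0. (\<exists>a b. a < x \<and> x < b \<and> b - a < d \<and> f b - f a < p * (b - a)) \<and>
                          (\<exists>a b. a < x \<and> x < b \<and> b - a < d \<and> q * (b - a) < f b - f a)}"
  shows "E \<in> null_sets lborel"
proof -
  define P where "P n = (\<Union>(a,b)\<in>{(a,b). b - a < 1 / real (Suc n) \<and> f b - f a < p * (b - a)}. {a<..<b})" for n
  define Q where "Q n = (\<Union>(a,b)\<in>{(a,b). b - a < 1 / real (Suc n) \<and> q * (b - a) < f b - f a}. {a<..<b})" for n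
  \<comment> \<open>Requiring \<open>x\<close> strictly inside the intervals makes every
    \<open>P n\<close> and \<open>Q n\<close> open, so \<open>E\<close> is a countable intersection
    of open sets and hence Borel.\<close>
  have E_eq: "E = (\<Inter>n. P n) \<inter> (\<Inter>n. Q n)"
  proof (intro equalityI subsetI)
    fix x assume "x \<in> E"
    then show "x \<in> (\<Inter>n. P n) \<inter> (\<Inter>n. Q n)"
      unfolding E_def P_def Q_def
      apply (clarsimp)
      by (metis of_nat_Suc zero_less_divide_1_iff of_nat_0_less_iff zero_less_Suc)
  next
    fix x assume x: "x \<in> (\<Inter>n. P n) \<inter> (\<Inter>n. Q n)"
    show "x \<in> E" unfolding E_def
    proof (clarify)
      fix d :: real assume "d > 0"
      then obtain n where n: "1 / real (Suc n) < d"
        by (metis nat_approx_posE)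
      have xP: "x \<in> P n" and xQ: "x \<in> Q n" using x by auto
      obtain a b where 1: "a < x" "x < b" "b - a < 1 / real (Suc n)" "f b - f a < p * (b - a)"
        using xP unfolding P_def by auto
      obtain a' b' where 2: "a' < x" "x < b'" "b' - a' < 1 / real (Suc n)" "q * (b' - a') < f b' - f a'"
        using xQ unfolding Q_def by auto
      show "(\<exists>a b. a < x \<and> x < b \<and> b - a < d \<and> f b - f a < p * (b - a)) \<and>
            (\<exists>a b. a < x \<and> x < b \<and> b - a < d \<and> q * (b - a) < f b - f a)"
        using 1 2 n by (meson less_trans)
    qed
  qed
  have opP: "open (P n)" and opQ: "open (Q n)" for n
    unfolding P_def Q_def by auto
  have E_sets: "E \<in> sets borel"
    unfolding E_eq using opP opQ by (intro sets.Int sets.countable_INT) auto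
  \<comment> \<open>The Lebesgue-Stieltjes measure of \<open>f\<close> compares the two covers: on
    \<open>V\<close> it is at most \<open>p\<close> times length, on \<open>W\<close> at least
    \<open>q\<close> times length.\<close>
  define \<mu> where "\<mu> = interval_measure f"
  have \<mu>_sets[simp]: "sets \<mu> = sets borel" by (simp add: \<mu>_def)
  have \<mu>_Icc: "emeasure \<mu> {a..b} = ennreal (f b - f a)" if "a \<le> b" for a b
    unfolding \<mu>_def by (rule emeasure_interval_measure_Icc[OF that mono cont])
  have bdd: "emeasure lborel (E \<inter> {-N<..<N}) = 0" for N :: real
  proof -
    let ?E = "E \<inter> {-N<..<N}"
    have Es: "?E \<in> sets borel" using E_sets by auto
    have fin: "emeasure lborel ?E < \<infinity>"
      by (rule emeasure_bounded_finite) (auto intro: bounded_Int)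
    \<comment> \<open>\<open>W\<close> covers almost all of \<open>?E\<close> and lies in
      \<open>V\<close>, which lies in \<open>U\<close>, and \<open>U\<close> exceeds
      \<open>?E\<close> by at most \<open>e\<close>. As \<open>?E\<close> has finite measure,
      \<open>p < q\<close> then forces this measure to be 0.\<close>
    have main: "ennreal q * emeasure lborel ?E \<le> ennreal p * (emeasure lborel ?E + ennreal e)" if e: "e > 0" for e :: real
    proof -
      obtain U where U: "open U" "?E \<subseteq> U" "emeasure lborel (U - ?E) < e"
        using outer_regular_lborel[OF Es e] by blast
      have mU: "emeasure lborel U \<le> emeasure lborel ?E + e"
      proof -
        have "emeasure lborel U = emeasure lborel (?E \<union> (U - ?E))" using U by (auto intro!: arg_cong[where f="emeasure lborel"])
        also have "\<dots> \<le> emeasure lborel ?E + emeasure lborel (U - ?E)"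
          using U Es by (intro emeasure_subadditive) auto
        also have "\<dots> \<le> emeasure lborel ?E + e" using U(3) by (intro add_left_mono) auto
        finally show ?thesis .
      qed
      define c r where "c = (\<lambda>(a,b). (a + b) / 2 :: real)" and "r = (\<lambda>(a,b). (b - a) / 2 :: real)"
      have cbl: "ball (c i) (r i) = {fst i<..<snd i}" "cball (c i) (r i) = {fst i..snd i}" for i
        by (simp_all add: c_def r_def case_prod_beta ball_interval cball_interval)
      define K1 where "K1 = {(a,b). a < b \<and> {a<..<b} \<subseteq> U \<and> f b - f a < p * (b - a)}"
      obtain C where C: "countable C" "C \<subseteq> K1" "pairwise (\<lambda>i j. disjnt (ball (c i) (r i)) (ball (c j) (r j))) C"
        "negligible (?E - (\<Union>i\<in>C. ball (c i) (r i)))"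
      proof (rule Vitali_covering_theorem_balls)
        fix x d assume x: "x \<in> ?E" and d: "(0::real) < d"
        obtain \<delta> where \<delta>: "\<delta> > 0" "ball x \<delta> \<subseteq> U" using U x by (meson openE subsetD)
        have "min d \<delta> > 0" using d \<delta> by simp
        then obtain a b where ab: "a < x" "x < b" "b - a < min d \<delta>" "f b - f a < p * (b - a)"
          using x unfolding E_def by blast
        have "{a<..<b} \<subseteq> ball x \<delta>" using ab by (auto simp: dist_real_def)
        moreover have "x \<in> ball (c (a,b)) (r (a,b))" unfolding cbl using ab by simp
        ultimately show "\<exists>i. i \<in> K1 \<and> x \<in> ball (c i) (r i) \<and> r i < d"
          using ab \<delta> d by (intro exI[of _ "(a,b)"] conjI) (auto simp: K1_def r_def)
      qed
      define V where "V = (\<Union>i\<in>C. {fst i<..<snd i})"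
      have "open V" unfolding V_def by auto
      have VU: "V \<subseteq> U" using C(2) unfolding V_def K1_def by fastforce
      have disjC: "disjoint_family_on (\<lambda>i. {fst i<..<snd i}) C"
        using C(3) unfolding cbl disjoint_family_on_def pairwise_def disjnt_def by blast
      have \<mu>V: "emeasure \<mu> V \<le> ennreal p * emeasure lborel V"
      proof -
        have "emeasure \<mu> V = (\<integral>\<^sup>+i. emeasure \<mu> {fst i<..<snd i} \<partial>count_space C)"
          unfolding V_def using C disjC by (intro emeasure_UN_countable) auto
        also have "\<dots> \<le> (\<integral>\<^sup>+i. ennreal p * emeasure lborel {fst i<..<snd i} \<partial>count_space C)"
        proof (rule nn_integral_mono)
          fix i assume "i \<in> space (count_space C)"
          then have i: "fst i < snd i" "f (snd i) - f (fst i) < p * (snd i - fst i)" using C(2) unfolding K1_def by auto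
          have "emeasure \<mu> {fst i<..<snd i} \<le> emeasure \<mu> {fst i..snd i}" by (intro emeasure_mono) auto
          also have "\<dots> = ennreal (f (snd i) - f (fst i))" using i by (simp add: \<mu>_Icc)
          also have "\<dots> \<le> ennreal (p * (snd i - fst i))" using i by (intro ennreal_leI) auto
          also have "\<dots> = ennreal p * emeasure lborel {fst i<..<snd i}"
            using i pq by (simp add: ennreal_mult)
          finally show "emeasure \<mu> {fst i<..<snd i} \<le> ennreal p * emeasure lborel {fst i<..<snd i}" .
        qed
        also have "\<dots> = ennreal p * (\<integral>\<^sup>+i. emeasure lborel {fst i<..<snd i} \<partial>count_space C)"
          by (rule nn_integral_cmult) auto
        also have "(\<integral>\<^sup>+i. emeasure lborel {fst i<..<snd i} \<partial>count_space C) = emeasure lborel V"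
          unfolding V_def using C disjC by (intro emeasure_UN_countable[symmetric]) auto
        finally show ?thesis .
      qed
      \<comment> \<open>Closed intervals here, since their \<mu>-measure is exactly
        \<open>f b - f a\<close>; for the upper bound on \<open>V\<close> open ones suffice, as they
        are contained in their closures.\<close>
      define K2 where "K2 = {(a,b). a < b \<and> {a..b} \<subseteq> V \<and> q * (b - a) < f b - f a}"
      obtain D where D: "countable D" "D \<subseteq> K2" "pairwise (\<lambda>i j. disjnt (cball (c i) (r i)) (cball (c j) (r j))) D"
        "negligible (?E \<inter> V - (\<Union>i\<in>D. cball (c i) (r i)))"
      proof (rule Vitali_covering_theorem_cballs)
        show "0 < r i" if "i \<in> K2" for i using that by (auto simp: K2_def r_def)
        fix x d assume x: "x \<in> ?E \<inter> V" and d: "(0::real) < d"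
        obtain \<delta> where \<delta>: "\<delta> > 0" "ball x \<delta> \<subseteq> V" using \<open>open V\<close> x by (meson IntD2 openE subsetD)
        have "min d \<delta> > 0" using d \<delta> by simp
        then obtain a b where ab: "a < x" "x < b" "b - a < min d \<delta>" "q * (b - a) < f b - f a"
          using x unfolding E_def by blast
        have "{a..b} \<subseteq> ball x \<delta>" using ab by (auto simp: dist_real_def)
        moreover have "x \<in> cball (c (a,b)) (r (a,b))" unfolding cbl using ab by simp
        ultimately show "\<exists>i. i \<in> K2 \<and> x \<in> cball (c i) (r i) \<and> r i < d"
          using ab \<delta> d by (intro exI[of _ "(a,b)"] conjI) (auto simp: K2_def r_def)
      qed
      define W where "W = (\<Union>i\<in>D. {fst i..snd i})"
      have WV: "W \<subseteq> V" using D(2) unfolding W_def K2_def by fastforce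
      have Ws[measurable]: "W \<in> sets borel" unfolding W_def using D(1) by (intro sets.countable_UN') auto
      have disjD: "disjoint_family_on (\<lambda>i. {fst i..snd i}) D"
        using D(3) unfolding cbl disjoint_family_on_def pairwise_def disjnt_def by blast
      have \<mu>W: "ennreal q * emeasure lborel W \<le> emeasure \<mu> W"
      proof -
        have "ennreal q * emeasure lborel W = ennreal q * (\<integral>\<^sup>+i. emeasure lborel {fst i..snd i} \<partial>count_space D)"
          unfolding W_def using D disjD by (subst emeasure_UN_countable) auto
        also have "\<dots> = (\<integral>\<^sup>+i. ennreal q * emeasure lborel {fst i..snd i} \<partial>count_space D)"
          by (rule nn_integral_cmult[symmetric]) auto
        also have "\<dots> \<le> (\<integral>\<^sup>+i. emeasure \<mu> {fst i..snd i} \<partial>count_space D)"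
        proof (rule nn_integral_mono)
          fix i assume "i \<in> space (count_space D)"
          then have i: "fst i < snd i" "q * (snd i - fst i) < f (snd i) - f (fst i)" using D(2) unfolding K2_def by auto
          then have "ennreal (q * (snd i - fst i)) \<le> ennreal (f (snd i) - f (fst i))" by (intro ennreal_leI) auto
          then show "ennreal q * emeasure lborel {fst i..snd i} \<le> emeasure \<mu> {fst i..snd i}"
            using i pq by (simp add: \<mu>_Icc ennreal_mult)
        qed
        also have "\<dots> = emeasure \<mu> W"
          unfolding W_def using D disjD by (intro emeasure_UN_countable[symmetric]) auto
        finally show ?thesis .
      qed
      have n1: "?E - V \<in> null_sets lborel" and n2: "?E \<inter> V - W \<in> null_sets lborel"
        using C(4) D(4) Es \<open>open V\<close> Ws unfolding V_def[symmetric] W_def[symmetric] cbl negligible_iff_null_sets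
        by (simp_all add: null_sets_completion_iff)
      have "emeasure lborel ?E \<le> emeasure lborel (W \<union> ((?E - V) \<union> (?E \<inter> V - W)))"
        using Es \<open>open V\<close> Ws by (intro emeasure_mono) auto
      also have "\<dots> = emeasure lborel W"
        using n1 n2 by (intro emeasure_Un_null_set) auto
      finally have "ennreal q * emeasure lborel ?E \<le> ennreal q * emeasure lborel W" by (rule mult_left_mono) auto
      also have "\<dots> \<le> emeasure \<mu> W" by (rule \<mu>W)
      also have "\<dots> \<le> emeasure \<mu> V" using WV \<open>open V\<close> by (intro emeasure_mono) auto
      also have "\<dots> \<le> ennreal p * emeasure lborel V" by (rule \<mu>V)
      also have "\<dots> \<le> ennreal p * emeasure lborel U" using VU U by (intro mult_left_mono emeasure_mono) auto
      also have "\<dots> \<le> ennreal p * (emeasure lborel ?E + ennreal e)" using mU by (intro mult_left_mono) auto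
      finally show ?thesis .
    qed
    define m where "m = measure lborel ?E"
    have m: "emeasure lborel ?E = ennreal m" "m \<ge> 0"
      unfolding m_def using fin by (auto intro!: emeasure_eq_ennreal_measure)
    have "q * m \<le> p * (m + e)" if e: "e > 0" for e
    proof -
      have "ennreal (q * m) \<le> ennreal (p * (m + e))"
        using main[OF e] m e pq by (simp add: ennreal_mult ennreal_plus)
      then show ?thesis using m e pq by (subst (asm) ennreal_le_iff) auto
    qed
    then have "q * m \<le> p * (m + e / p)" if "e > 0" for e
      using that pq by simp
    then have "q * m \<le> p * m + e" if "e > 0" for e
      using that pq by (simp add: distrib_left)
    then have "q * m \<le> p * m" by (rule field_le_epsilon)
    then have "m \<le> 0" using pq m by (metis less_le_not_le mult_right_le_imp_le mult_le_cancel_right)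
    then show ?thesis using m by simp
  qed
  have "(\<Union>n::nat. E \<inter> {-real n<..<real n}) \<in> null_sets lborel"
    using bdd E_sets by (intro null_sets_UN) auto
  moreover have "(\<Union>n::nat. E \<inter> {-real n<..<real n}) = E"
  proof -
    have "\<exists>n::nat. - real n < x \<and> x < real n" for x :: real
      using reals_Archimedean2[of "\<bar>x\<bar>"] by (auto simp: abs_less_iff minus_less_iff)
    then show ?thesis by auto
  qed
  ultimately show ?thesis by simp
qed


text \<open>In a difference quotient at \<open>x\<close> the point is an endpoint, whereas the
  exceptional set asks for intervals with \<open>x\<close> in the interior. Continuity allows a
  slight widening without losing the strict slope inequality; with 1 or -1 for
  \<open>\<sigma>\<close>, slopes below and above \<open>c\<close> are covered at once.\<close>

lemma widen_interval_slope:
  fixes f :: "real \<Rightarrow> real"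
  assumes cont: "continuous_on UNIV f" and uv: "u \<le> x" "x \<le> v" "v - u < d"
    and pos: "0 < \<sigma> * (c * (v - u) - (f v - f u))"
  obtains a b where "a < x" "x < b" "b - a < d" "0 < \<sigma> * (c * (b - a) - (f b - f a))"
proof -
  have c: "isCont f y" for y using cont by (simp add: continuous_on_eq_continuous_at)
  have "((\<lambda>\<eta>. \<sigma> * (c * ((v + \<eta>) - (u - \<eta>)) - (f (v + \<eta>) - f (u - \<eta>)))) \<longlongrightarrow>
      \<sigma> * (c * ((v + 0) - (u - 0)) - (f (v + 0) - f (u - 0)))) (at_right 0)"
    by (intro tendsto_intros isCont_tendsto_compose[OF c])
  then have "((\<lambda>\<eta>. \<sigma> * (c * ((v + \<eta>) - (u - \<eta>)) - (f (v + \<eta>) - f (u - \<eta>)))) \<longlongrightarrow>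
      \<sigma> * (c * (v - u) - (f v - f u))) (at_right 0)" by simp
  from order_tendstoD(1)[OF this pos]
  have "\<forall>\<^sub>F \<eta> in at_right 0. 0 < \<sigma> * (c * ((v + \<eta>) - (u - \<eta>)) - (f (v + \<eta>) - f (u - \<eta>)))" .
  moreover have "\<forall>\<^sub>F \<eta> in at_right 0. \<eta> < (d - (v - u)) / 2"
    using uv by (intro eventually_mono[OF eventually_at_right_real[of 0 "(d - (v - u)) / 2"]]) auto
  moreover have "\<forall>\<^sub>F \<eta>::real in at_right 0. 0 < \<eta>"
    by (simp add: eventually_at_right_less)
  ultimately have "\<forall>\<^sub>F \<eta> in at_right 0. 0 < \<sigma> * (c * ((v + \<eta>) - (u - \<eta>)) - (f (v + \<eta>) - f (u - \<eta>)))
     \<and> \<eta> < (d - (v - u)) / 2 \<and> 0 < \<eta>" by eventually_elim auto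
  then obtain \<eta> where "0 < \<sigma> * (c * ((v + \<eta>) - (u - \<eta>)) - (f (v + \<eta>) - f (u - \<eta>)))"
     "\<eta> < (d - (v - u)) / 2" "0 < \<eta>"
    using eventually_happens'[OF trivial_limit_at_right_real] by blast
  note \<eta> = this
  show ?thesis
  proof (rule that)
    have "2 * \<eta> < d - (v - u)" using \<eta>(2) by simp
    then show "(v + \<eta>) - (u - \<eta>) < d" by simp
    show "u - \<eta> < x" "x < v + \<eta>" using uv(1,2) \<eta>(3) by linarith+
  qed (rule \<eta>(1))
qed

text \<open>Lebesgue's theorem. Where the lower and the upper limit of the difference quotient
  differ, two rationals \<open>p < q\<close> fit between them and the point lies in the null set of
  that pair; the Lipschitz bound keeps the common limit finite.\<close>

lemma mono_lipschitz_AE_differentiable: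
  fixes f :: "real \<Rightarrow> real"
  assumes mono: "\<And>x y. x \<le> y \<Longrightarrow> f x \<le> f y" and lip: "\<And>x y. x \<le> y \<Longrightarrow> f y - f x \<le> M * (y - x)"
  shows "AE x in lborel. f differentiable (at x)"
proof -
  have M: "M \<ge> 0" using lip[of 0 1] mono[of 0 1] by auto
  have lip': "\<bar>f y - f x\<bar> \<le> M * \<bar>y - x\<bar>" for x y
    using lip[of x y] lip[of y x] mono[of x y] mono[of y x] by (cases "x \<le> y") auto
  then have "M-lipschitz_on UNIV f" using M by (auto simp: lipschitz_on_def dist_real_def)
  then have cont: "continuous_on UNIV f" by (rule lipschitz_on_continuous_on)
  define E where "E p q = {x. \<forall>d>0. (\<exists>a b. a < x \<and> x < b \<and> b - a < d \<and> f b - f a < p * (b - a)) \<and>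
                          (\<exists>a b. a < x \<and> x < b \<and> b - a < d \<and> q * (b - a) < f b - f a)}" for p q
  define N where "N = (\<Union>(p,q)\<in>{(p,q). p \<in> \<rat> \<and> q \<in> \<rat> \<and> 0 < p \<and> p < q}. E p q)"
  have "N \<in> null_sets lborel" unfolding N_def
  proof (rule null_sets_UN')
    have "{(p,q). p \<in> \<rat> \<and> q \<in> \<rat> \<and> 0 < p \<and> p < q} \<subseteq> \<rat> \<times> (\<rat>::real set)" by auto
    then show "countable {(p::real,q). p \<in> \<rat> \<and> q \<in> \<rat> \<and> 0 < p \<and> p < q}"
      using countable_rat countable_SIGMA countable_subset by meson
    fix i :: "real \<times> real" assume "i \<in> {(p,q). p \<in> \<rat> \<and> q \<in> \<rat> \<and> 0 < p \<and> p < q}"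
    then show "(case i of (p, q) \<Rightarrow> E p q) \<in> null_sets lborel"
      using two_slopes_null_sets[OF mono cont, of "fst i" "snd i"] by (auto simp: E_def)
  qed
  moreover have "f differentiable (at x)" if "x \<notin> N" for x
  proof -
    define s where "s y = (f y - f x) / (y - x)" for y
    have s: "0 \<le> s y" "s y \<le> M" if "y \<noteq> x" for y
      using that lip[of x y] lip[of y x] mono[of x y] mono[of y x]
      by (cases "x < y"; force simp: s_def pos_divide_le_eq neg_divide_le_eq zero_le_divide_iff algebra_simps)+
    have slope: "\<exists>u v. u \<le> x \<and> x \<le> v \<and> u < v \<and> v - u = \<bar>y - x\<bar> \<and> f v - f u = s y * (v - u)" if "y \<noteq> x" for y
      using that by (intro exI[of _ "min x y"] exI[of _ "max x y"]) (auto simp: s_def min_def max_def field_simps)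
    \<comment> \<open>A point outside \<open>E p q\<close> has a scale \<open>d\<close> below which
      intervals of slope less than \<open>p\<close>, or those of slope more than \<open>q\<close>,
      are absent; this puts all nearby quotients on one side.\<close>
    have dich: "(\<forall>\<^sub>F y in at x. p \<le> s y) \<or> (\<forall>\<^sub>F y in at x. s y \<le> q)"
      if pq: "p \<in> \<rat>" "q \<in> \<rat>" "0 < p" "p < q" for p q
    proof -
      have "x \<notin> E p q" using \<open>x \<notin> N\<close> pq unfolding N_def by auto
      then obtain d where d: "d > 0" and or:
        "\<not> (\<exists>a b. a < x \<and> x < b \<and> b - a < d \<and> f b - f a < p * (b - a)) \<or>
         \<not> (\<exists>a b. a < x \<and> x < b \<and> b - a < d \<and> q * (b - a) < f b - f a)" unfolding E_def by blast
      have ev: "\<forall>\<^sub>F y in at x. y \<noteq> x \<and> \<bar>y - x\<bar> < d"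
        using d by (auto simp: eventually_at dist_real_def intro!: exI[of _ d])
      from or show ?thesis
      proof
        assume *: "\<not> (\<exists>a b. a < x \<and> x < b \<and> b - a < d \<and> f b - f a < p * (b - a))"
        have "p \<le> s y" if y: "y \<noteq> x \<and> \<bar>y - x\<bar> < d" for y
        proof (rule ccontr)
          assume "\<not> p \<le> s y"
          obtain u v where uv: "u \<le> x" "x \<le> v" "u < v" "v - u = \<bar>y - x\<bar>" "f v - f u = s y * (v - u)" using slope y by blast
          have "s y * (v - u) < p * (v - u)" using uv(3) \<open>\<not> p \<le> s y\<close> by (intro mult_strict_right_mono) auto
          then have "0 < 1 * (p * (v - u) - (f v - f u))" by (simp only: uv(5) mult_1 diff_gt_0_iff_gt)
          moreover have "v - u < d" using uv(4) y by (simp only:)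
          ultimately obtain a b where "a < x" "x < b" "b - a < d" "0 < 1 * (p * (b - a) - (f b - f a))"
            using widen_interval_slope[OF cont uv(1,2)] by metis
          then show False using * by auto
        qed
        then have "\<forall>\<^sub>F y in at x. p \<le> s y" by (rule eventually_mono[OF ev])
        then show ?thesis ..
      next
        assume *: "\<not> (\<exists>a b. a < x \<and> x < b \<and> b - a < d \<and> q * (b - a) < f b - f a)"
        have "s y \<le> q" if y: "y \<noteq> x \<and> \<bar>y - x\<bar> < d" for y
        proof (rule ccontr)
          assume "\<not> s y \<le> q"
          obtain u v where uv: "u \<le> x" "x \<le> v" "u < v" "v - u = \<bar>y - x\<bar>" "f v - f u = s y * (v - u)" using slope y by blast
          have "q * (v - u) < s y * (v - u)" using uv(3) \<open>\<not> s y \<le> q\<close> by (intro mult_strict_right_mono) auto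
          then have "0 < (-1) * (q * (v - u) - (f v - f u))"
            by (simp only: uv(5) mult_minus1 minus_diff_eq diff_gt_0_iff_gt)
          moreover have "v - u < d" using uv(4) y by (simp only:)
          ultimately obtain a b where "a < x" "x < b" "b - a < d" "0 < (-1) * (q * (b - a) - (f b - f a))"
            using widen_interval_slope[OF cont uv(1,2)] by metis
          then show False using * by auto
        qed
        then have "\<forall>\<^sub>F y in at x. s y \<le> q" by (rule eventually_mono[OF ev])
        then show ?thesis ..
      qed
    qed
    let ?s = "\<lambda>y. ereal (s y)"
    have evne: "\<forall>\<^sub>F y in at x. y \<noteq> x" by (simp add: eventually_at_filter)
    have lo: "0 \<le> Liminf (at x) ?s"
      by (rule Liminf_bounded) (rule eventually_mono[OF evne], use s in simp)
    have hi: "Limsup (at x) ?s \<le> M"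
      by (rule Limsup_bounded) (rule eventually_mono[OF evne], use s in simp)
    have le: "Limsup (at x) ?s \<le> Liminf (at x) ?s"
    proof (rule ccontr)
      assume "\<not> Limsup (at x) ?s \<le> Liminf (at x) ?s"
      then have "Liminf (at x) ?s < Limsup (at x) ?s" by simp
      then obtain q where q: "Liminf (at x) ?s < real_of_rat q" "real_of_rat q < Limsup (at x) ?s"
        using ereal_dense3 by blast
      then obtain p where p: "Liminf (at x) ?s < real_of_rat p" "ereal (real_of_rat p) < real_of_rat q"
        using ereal_dense3 by blast
      have "0 < real_of_rat p" using le_less_trans[OF lo p(1)] by simp
      moreover have "(real_of_rat p :: real) < real_of_rat q" using p(2) by simp
      ultimately have "(\<forall>\<^sub>F y in at x. real_of_rat p \<le> s y) \<or> (\<forall>\<^sub>F y in at x. s y \<le> real_of_rat q)"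
        by (intro dich) auto
      then show False
      proof
        assume "\<forall>\<^sub>F y in at x. real_of_rat p \<le> s y"
        then have "ereal (real_of_rat p) \<le> Liminf (at x) ?s" by (intro Liminf_bounded) simp
        then show False using p(1) by simp
      next
        assume "\<forall>\<^sub>F y in at x. s y \<le> real_of_rat q"
        then have "Limsup (at x) ?s \<le> ereal (real_of_rat q)" by (intro Limsup_bounded) simp
        then show False using q(2) by simp
      qed
    qed
    have eq: "Liminf (at x) ?s = Limsup (at x) ?s"
      using le Liminf_le_Limsup[of "at x" ?s] by simp
    define D where "D = real_of_ereal (Limsup (at x) ?s)"
    have "Limsup (at x) ?s = ereal D"
      unfolding D_def using lo hi eq by (cases "Limsup (at x) ?s") auto
    then have "(?s \<longlongrightarrow> ereal D) (at x)"
      using eq by (intro Liminf_eq_Limsup) auto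
    then have "(s \<longlongrightarrow> D) (at x)" by simp
    then have "(f has_real_derivative D) (at x)"
      unfolding has_field_derivative_iff s_def[abs_def] .
    then show ?thesis unfolding real_differentiable_def by blast
  qed
  ultimately show ?thesis
    by (intro AE_I'[of N]) auto
qed

text \<open>Adding \<open>L * x\<close> makes \<open>h\<close> nondecreasing, and composing with the
  clamp \<open>cl\<close> extends it to the whole line; neither change affects differentiability
  inside the interval.\<close>

lemma lipschitz_on_AE_differentiable:
  fixes h :: "real \<Rightarrow> real"
  assumes lip: "L-lipschitz_on {a..b} h"
  shows "AE t in lborel. a < t \<and> t < b \<longrightarrow> h differentiable (at t)"
proof (cases "a < b")
  case True
  define cl where "cl x = max a (min b x)" for x
  define f where "f x = h (cl x) + L * x" for x
  have L: "L \<ge> 0" using lip lipschitz_on_nonneg by blast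
  have clm: "cl x \<in> {a..b}" for x using True by (auto simp: cl_def)
  have cll: "\<bar>cl y - cl x\<bar> \<le> y - x" if "x \<le> y" for x y using that True by (auto simp: cl_def)
  have hl: "\<bar>h (cl y) - h (cl x)\<bar> \<le> L * (y - x)" if "x \<le> y" for x y
  proof -
    have "\<bar>h (cl y) - h (cl x)\<bar> \<le> L * \<bar>cl y - cl x\<bar>"
      using lipschitz_onD[OF lip clm clm, of y x] by (simp add: dist_real_def)
    also have "\<dots> \<le> L * (y - x)" using cll[OF that] L by (intro mult_left_mono) auto
    finally show ?thesis .
  qed
  have "AE x in lborel. f differentiable (at x)"
  proof (rule mono_lipschitz_AE_differentiable[where M="2 * L"])
    fix x y :: real assume "x \<le> y"
    from hl[OF this] show "f x \<le> f y" "f y - f x \<le> 2 * L * (y - x)"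
      by (auto simp: f_def algebra_simps abs_le_iff)
  qed
  then show ?thesis
  proof eventually_elim
    case (elim t)
    show ?case
    proof
      assume t: "a < t \<and> t < b"
      have "(\<lambda>x. f x - L * x) differentiable (at t)" using elim by (intro derivative_intros)
      then obtain D where D: "((\<lambda>x. f x - L * x) has_derivative D) (at t)" by (auto simp: differentiable_def)
      have "(h has_derivative D) (at t)"
      proof (rule has_derivative_transform_within_open[OF D, of "{a<..<b}"])
        fix x assume "x \<in> {a<..<b}"
        then have "cl x = x" by (auto simp: cl_def)
        then show "f x - L * x = h x" by (simp add: f_def)
      qed (use t in auto)
      then show "h differentiable (at t)" by (auto simp: differentiable_def)
    qed
  qed
next
  case False
  then have "\<not> (a < t \<and> t < b)" for t by linarith
  then show ?thesis by (intro AE_I2) blast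
qed

lemma LBINT_has_real_derivative:
  fixes f :: "real \<Rightarrow> real"
  assumes "continuous_on UNIV f"
  shows "((\<lambda>x. LBINT y=0..ereal x. f y) has_real_derivative f x) (at x)"
proof -
  define A where "A = - \<bar>x\<bar> - 1"
  define B where "B = \<bar>x\<bar> + 1"
  have "((\<lambda>u. LBINT y=ereal 0..u. f y) has_vector_derivative f x) (at x within {A..B})"
    by (rule interval_integral_FTC2) (auto simp: A_def B_def intro: continuous_on_subset[OF assms])
  moreover have "x \<in> interior {A..B}" by (simp add: A_def B_def) linarith
  ultimately show ?thesis
    by (simp only: at_within_interior has_real_derivative_iff_has_vector_derivative zero_ereal_def)
qed

text \<open>Difference quotients with step 1 / (n + 1) are bounded by \<open>L\<close> and converge
  almost everywhere to \<open>g\<close>, so dominated convergence applies; their integrals are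
  quotients of the primitive \<open>\<Phi>\<close> at the endpoints and tend to
  \<open>f b - f a\<close>. The clamp gives \<open>f\<close> a meaning beyond
  \<open>b\<close>.\<close>

lemma lipschitz_FTC:
  fixes h g :: "real \<Rightarrow> real"
  assumes ab: "a < b" and lip: "L-lipschitz_on {a..b} h"
    and der: "AE t in lborel. a < t \<and> t < b \<longrightarrow> (h has_real_derivative g t) (at t)"
    and meas: "set_borel_measurable lborel {a..b} g"
  shows "set_integrable lborel {a..b} g" and "(LBINT t:{a..b}. g t) = h b - h a"
proof -
  define cl where "cl x = max a (min b x)" for x
  define f where "f x = h (cl x)" for x
  have L: "L \<ge> 0" using lip lipschitz_on_nonneg by blast
  have clm: "cl x \<in> {a..b}" for x using ab by (auto simp: cl_def)
  have fl: "\<bar>f y - f x\<bar> \<le> L * \<bar>y - x\<bar>" for x y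
  proof -
    have "\<bar>f y - f x\<bar> \<le> L * \<bar>cl y - cl x\<bar>"
      using lipschitz_onD[OF lip clm clm, of y x] by (simp add: f_def dist_real_def)
    also have "\<dots> \<le> L * \<bar>y - x\<bar>" using ab L by (intro mult_left_mono) (auto simp: cl_def)
    finally show ?thesis .
  qed
  have "L-lipschitz_on UNIV f" using L fl by (auto simp: lipschitz_on_def dist_real_def)
  then have cont: "continuous_on UNIV f" by (rule lipschitz_on_continuous_on)
  then have cont': "continuous_on A f" for A by (rule continuous_on_subset) auto
  define \<Phi> where "\<Phi> x = (LBINT y=0..ereal x. f y)" for x
  have \<Phi>: "(\<Phi> has_real_derivative f x) (at x)" for x
    unfolding \<Phi>_def by (rule LBINT_has_real_derivative[OF cont])
  define q where "q n t = real (Suc n) * (f (t + 1 / real (Suc n)) - f t)" for n t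
  have qcont: "continuous_on A (q n)" for A n
    unfolding q_def by (intro continuous_intros continuous_on_compose2[OF cont]) auto
  have qb: "\<bar>q n t\<bar> \<le> L" for n t
  proof -
    have "\<bar>q n t\<bar> = real (Suc n) * \<bar>f (t + 1 / real (Suc n)) - f t\<bar>" by (simp add: q_def abs_mult)
    also have "\<dots> \<le> real (Suc n) * (L * \<bar>1 / real (Suc n)\<bar>)"
      using fl[of "t + 1 / real (Suc n)" t] by (intro mult_left_mono) auto
    also have "\<dots> = L" by simp
    finally show ?thesis .
  qed
  have inv0: "filterlim (\<lambda>n. 1 / real (Suc n)) (at 0) sequentially"
    using LIMSEQ_inverse_real_of_nat by (auto simp: filterlim_at inverse_eq_divide)
  have quot: "(\<lambda>n. real (Suc n) * (F (x + 1 / real (Suc n)) - F x)) \<longlonglongrightarrow> D"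
    if "(F has_real_derivative D) (at x)" for F :: "real \<Rightarrow> real" and D x
  proof -
    have "(\<lambda>n. (F (x + 1 / real (Suc n)) - F x) / (1 / real (Suc n))) \<longlonglongrightarrow> D"
      using filterlim_compose[OF that[unfolded DERIV_def] inv0] .
    then show ?thesis by (simp add: mult.commute)
  qed
  have qint: "(LBINT t:{a..b}. q n t) =
      real (Suc n) * (\<Phi> (b + 1 / real (Suc n)) - \<Phi> b) - real (Suc n) * (\<Phi> (a + 1 / real (Suc n)) - \<Phi> a)" for n
  proof -
    let ?d = "1 / real (Suc n)"
    have "integral\<^sup>L lborel (\<lambda>x. indicator {a..b} x *\<^sub>R q n x) =
       (real (Suc n) * (\<Phi> (b + ?d) - \<Phi> b)) - (real (Suc n) * (\<Phi> (a + ?d) - \<Phi> a))"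
    proof (rule integral_FTC_atLeastAtMost)
      fix x assume "a \<le> x" "x \<le> b"
      have "((\<lambda>x. real (Suc n) * (\<Phi> (x + ?d) - \<Phi> x)) has_real_derivative q n x) (at x)"
        unfolding q_def
        by (rule derivative_eq_intros DERIV_chain2[OF \<Phi>] \<Phi> refl | simp)+
      then show "((\<lambda>x. real (Suc n) * (\<Phi> (x + ?d) - \<Phi> x)) has_vector_derivative q n x) (at x within {a..b})"
        by (simp add: has_real_derivative_iff_has_vector_derivative has_vector_derivative_at_within)
    qed (use ab qcont in auto)
    then show ?thesis by (simp add: set_lebesgue_integral_def)
  qed
  have AEl: "AE t in lborel. (\<lambda>n. indicator {a..b} t *\<^sub>R q n t) \<longlonglongrightarrow> indicator {a..b} t *\<^sub>R g t"
  proof -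
    have "AE t in lborel. t \<noteq> a" "AE t in lborel. t \<noteq> b" by (auto intro: AE_lborel_singleton)
    with der show ?thesis
    proof eventually_elim
      case (elim t)
      show ?case
      proof (cases "t \<in> {a..b}")
        case True
        then have t: "a < t" "t < b" using elim by auto
        then have D: "(h has_real_derivative g t) (at t)" using elim by auto
        have "(f has_real_derivative g t) (at t)"
        proof (rule has_field_derivative_transform_within_open[OF D, of "{a<..<b}"])
          fix x assume "x \<in> {a<..<b}"
          then have "cl x = x" by (auto simp: cl_def)
          then show "h x = f x" by (simp add: f_def)
        qed (use t in auto)
        then have "(\<lambda>n. q n t) \<longlonglongrightarrow> g t" unfolding q_def by (rule quot)
        then show ?thesis using True by simp
      qed auto
    qed
  qed
  have m1: "(\<lambda>t. indicator {a..b} t *\<^sub>R g t) \<in> borel_measurable lborel"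
    using meas by (simp add: set_borel_measurable_def)
  have m2: "(\<lambda>t. indicator {a..b} t *\<^sub>R q n t) \<in> borel_measurable lborel" for n
    using qcont[of UNIV n] by (intro borel_measurable_scaleR) (auto intro!: borel_measurable_continuous_onI)
  have w: "integrable lborel (\<lambda>t. indicator {a..b} t *\<^sub>R L)"
    by (intro integrable_scaleR_left integrable_real_indicator) (auto simp: emeasure_lborel_Icc_eq)
  have bnd: "AE t in lborel. norm (indicator {a..b} t *\<^sub>R q n t) \<le> indicator {a..b} t *\<^sub>R L" for n
    using qb by (auto simp: indicator_def)
  show "set_integrable lborel {a..b} g"
    unfolding set_integrable_def by (rule integrable_dominated_convergence[OF m1 m2 w AEl bnd])
  have "(\<lambda>n. LBINT t:{a..b}. q n t) \<longlonglongrightarrow> (LBINT t:{a..b}. g t)"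
    unfolding set_lebesgue_integral_def by (rule integral_dominated_convergence[OF m1 m2 w AEl bnd])
  moreover have "(\<lambda>n. LBINT t:{a..b}. q n t) \<longlonglongrightarrow> f b - f a"
    unfolding qint by (intro tendsto_diff quot \<Phi>)
  ultimately have "(LBINT t:{a..b}. g t) = f b - f a" by (rule LIMSEQ_unique)
  then show "(LBINT t:{a..b}. g t) = h b - h a" using ab by (simp add: f_def cl_def)
qed

section \<open>The heat kernel\<close>

text \<open>Time and diffusivity enter only through \<open>c\<close>, which is \<open>k\<close>
  times the elapsed time. Without its normalisation the kernel has peak 1, which suits the limits
  taken after multiplication by \<open>sqrt (4 * pi * c)\<close>.\<close>

definition gauss :: "real \<Rightarrow> real \<Rightarrow> real" where
  "gauss c y = exp (- y\<^sup>2 / (4 * c))"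

definition heat :: "real \<Rightarrow> real \<Rightarrow> real" where
  "heat c y = gauss c y / sqrt (4 * pi * c)"

text \<open>For positive \<open>c\<close> this is \<open>sqrt (pi * c)\<close> times the error
  function at \<open>z / (2 * sqrt c)\<close>.\<close>

definition gauss_int :: "real \<Rightarrow> real \<Rightarrow> real" where
  "gauss_int c z = (LBINT y=0..ereal z. gauss c y)"

lemma gauss_pos [simp]: "0 < gauss c y" and gauss_nonneg [simp]: "0 \<le> gauss c y"
  by (simp_all add: gauss_def)

lemma gauss_le_1: "0 < c \<Longrightarrow> gauss c y \<le> 1"
  by (simp add: gauss_def)

lemma gauss_minus [simp]: "gauss c (- y) = gauss c y"
  by (simp add: gauss_def)

lemma heat_minus [simp]: "heat c (- y) = heat c y"
  by (simp add: heat_def)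

lemma heat_pos: "0 < c \<Longrightarrow> 0 < heat c y"
  by (simp add: heat_def)

lemma heat_nonneg: "0 < c \<Longrightarrow> 0 \<le> heat c y"
  by (simp add: heat_def)

lemma heat_le: "0 < c \<Longrightarrow> heat c y \<le> 1 / sqrt (4 * pi * c)"
  unfolding heat_def by (intro divide_right_mono gauss_le_1) auto

lemma gauss_eq_heat: "0 < c \<Longrightarrow> gauss c = (\<lambda>y. sqrt (4 * pi * c) * heat c y)"
  by (simp add: fun_eq_iff heat_def)

lemma continuous_on_gauss [continuous_intros]:
  assumes "continuous_on A f" "continuous_on A h" "\<And>x. x \<in> A \<Longrightarrow> f x \<noteq> 0"
  shows "continuous_on A (\<lambda>x. gauss (f x) (h x))"
  unfolding gauss_def by (intro continuous_intros assms) (use assms in auto)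

lemma continuous_on_heat [continuous_intros]:
  assumes "continuous_on A f" "continuous_on A h" "\<And>x. x \<in> A \<Longrightarrow> 0 < f x"
  shows "continuous_on A (\<lambda>x. heat (f x) (h x))"
  unfolding heat_def by (intro continuous_intros assms) (use assms in force)+

lemma borel_measurable_gauss [measurable]: "gauss c \<in> borel_measurable borel"
  unfolding gauss_def[abs_def] by measurable

lemma borel_measurable_heat [measurable]: "heat c \<in> borel_measurable borel"
  unfolding heat_def[abs_def] by measurable

lemma gauss_has_real_derivative:
  "c \<noteq> 0 \<Longrightarrow> (gauss c has_real_derivative - (y / (2 * c)) * gauss c y) (at y)"
  unfolding gauss_def[abs_def] by (auto intro!: derivative_eq_intros simp: field_simps)

lemma heat_has_real_derivative:
  "c \<noteq> 0 \<Longrightarrow> (heat c has_real_derivative - (y / (2 * c)) * heat c y) (at y)"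
  unfolding heat_def[abs_def]
  by (auto intro!: derivative_eq_intros gauss_has_real_derivative simp: field_simps)

text \<open>The factor is the same as for the second space derivative in
  \<open>heat_space_derivatives\<close>; their agreement is the heat equation.\<close>

lemma heat_has_real_derivative_time:
  assumes "0 < c"
  shows "((\<lambda>c. heat c y) has_real_derivative (y\<^sup>2 / (4 * c\<^sup>2) - 1 / (2 * c)) * heat c y) (at c)"
proof -
  have s: "sqrt (4 * pi * c) \<noteq> 0" "sqrt (4 * pi * c) * sqrt (4 * pi * c) = 4 * pi * c"
    using mult_pos_pos[OF pi_gt_zero assms] by auto
  have "((\<lambda>c. sqrt (4 * pi * c)) has_real_derivative inverse (sqrt (4 * pi * c)) / 2 * (4 * pi)) (at c)"
    by (rule DERIV_chain2[OF DERIV_real_sqrt]) (use assms in \<open>auto intro!: derivative_eq_intros\<close>)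
  moreover have "((\<lambda>c. gauss c y) has_real_derivative (y\<^sup>2 / (4 * c\<^sup>2)) * gauss c y) (at c)"
    unfolding gauss_def[abs_def] using assms
    by (auto intro!: derivative_eq_intros simp: field_simps power2_eq_square)
  ultimately have "((\<lambda>c. gauss c y / sqrt (4 * pi * c)) has_real_derivative
      ((y\<^sup>2 / (4 * c\<^sup>2)) * gauss c y * sqrt (4 * pi * c) - gauss c y * (inverse (sqrt (4 * pi * c)) / 2 * (4 * pi))) /
      (sqrt (4 * pi * c) * sqrt (4 * pi * c))) (at c)"
    using s(1) by (intro DERIV_divide) auto
  moreover have "((y\<^sup>2 / (4 * c\<^sup>2)) * gauss c y * sqrt (4 * pi * c) - gauss c y * (inverse (sqrt (4 * pi * c)) / 2 * (4 * pi))) /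
      (sqrt (4 * pi * c) * sqrt (4 * pi * c)) = (y\<^sup>2 / (4 * c\<^sup>2) - 1 / (2 * c)) * (gauss c y / sqrt (4 * pi * c))"
  proof -
    \<comment> \<open>Expressing \<open>c\<close> through this square root makes the identity
      rational.\<close>
    define r where "r = sqrt (4 * pi * c)"
    have r: "r \<noteq> 0" "c = r * r / (4 * pi)" using s assms by (auto simp: r_def)
    show ?thesis unfolding r_def[symmetric] using r(1) assms
      by (simp add: r(2) field_simps power2_eq_square)
  qed
  ultimately show ?thesis by (simp add: heat_def[abs_def])
qed

text \<open>The variance is \<open>2 * c\<close>; mass and first absolute moment then follow from
  the normal distribution.\<close>

lemma heat_eq_normal_density: "0 < c \<Longrightarrow> heat c = normal_density 0 (sqrt (2 * c))"
  by (simp add: fun_eq_iff heat_def gauss_def normal_density_def)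

lemma integrable_heat: "0 < c \<Longrightarrow> integrable lborel (heat c)"
  by (simp add: heat_eq_normal_density)

lemma integral_heat: "0 < c \<Longrightarrow> integral\<^sup>L lborel (heat c) = 1"
  by (simp add: heat_eq_normal_density)

lemma integrable_heat_shift: "0 < c \<Longrightarrow> integrable lborel (\<lambda>x. heat c (x0 - x))"
  using lborel_integrable_real_affine[OF integrable_heat, of c "-1" x0] by simp

lemma integral_heat_shift: "0 < c \<Longrightarrow> (LBINT x. heat c (x0 - x)) = 1"
  using lborel_integral_real_affine[of "-1" "heat c" x0] integral_heat[of c] by simp

lemma integrable_abs_heat_shift: "0 < c \<Longrightarrow> integrable lborel (\<lambda>x. \<bar>x0 - x\<bar> * heat c (x0 - x))"
proof -
  assume c: "0 < c"
  have "integrable lborel (\<lambda>x. \<bar>x\<bar> * heat c x)"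
    using integrable_normal_moment_abs[of "sqrt (2 * c)" 0 1] c
    by (simp add: heat_eq_normal_density mult.commute)
  from lborel_integrable_real_affine[OF this, of "-1" x0] show ?thesis by simp
qed

text \<open>This moment controls the error that the spatial cutoff produces in
  \<open>heat_identity_Icc\<close>.\<close>

lemma integral_abs_heat_shift:
  assumes c: "0 < c" shows "(LBINT x. \<bar>x0 - x\<bar> * heat c (x0 - x)) = sqrt (2 * c) * sqrt (2 / pi)"
proof -
  have "(LBINT x. \<bar>x\<bar> * heat c x) = sqrt (2 * c) * sqrt (2 / pi)"
    using integral_normal_moment_abs_odd[of "sqrt (2 * c)" 0 0] c
    by (simp add: heat_eq_normal_density mult.commute)
  then show ?thesis using lborel_integral_real_affine[of "-1" "\<lambda>x. \<bar>x\<bar> * heat c x" x0] by simp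
qed

lemma integrable_gauss: "0 < c \<Longrightarrow> integrable lborel (gauss c)"
  using integrable_heat[of c] by (simp add: gauss_eq_heat)

lemma integral_gauss: "0 < c \<Longrightarrow> integral\<^sup>L lborel (gauss c) = sqrt (4 * pi * c)"
  using integral_heat[of c] by (simp add: gauss_eq_heat)

lemma gauss_int_has_real_derivative:
  "c \<noteq> 0 \<Longrightarrow> (gauss_int c has_real_derivative gauss c z) (at z)"
  unfolding gauss_int_def[abs_def]
  by (intro LBINT_has_real_derivative continuous_intros) auto

lemma gauss_int_0 [simp]: "gauss_int c 0 = 0"
  by (simp add: gauss_int_def zero_ereal_def[symmetric])

lemma gauss_int_minus:
  assumes "c \<noteq> 0" shows "gauss_int c (- z) = - gauss_int c z"
proof -
  have "((\<lambda>z. gauss_int c (- z)) has_real_derivative gauss c (- z) * (- 1)) (at z)" for z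
    by (rule DERIV_chain2[OF gauss_int_has_real_derivative[OF assms]]) (auto intro!: derivative_eq_intros)
  from DERIV_add[OF gauss_int_has_real_derivative[OF assms] this]
  have "((\<lambda>z. gauss_int c z + gauss_int c (- z)) has_real_derivative 0) (at z)" for z
    by simp
  then have "gauss_int c z + gauss_int c (- z) = gauss_int c 0 + gauss_int c (- 0)"
    by (intro DERIV_isconst_all) auto
  then show ?thesis by simp
qed

lemma gauss_int_mvt:
  assumes "c \<noteq> 0"
  obtains \<xi> where "\<bar>\<xi>\<bar> \<le> \<bar>z\<bar>" "gauss_int c z = z * gauss c \<xi>"
proof (cases "z = 0")
  case True then show ?thesis using that by auto
next
  case False
  then consider "z < 0" | "0 < z" by linarith
  then show ?thesis
  proof cases
    case 1
    obtain \<xi> where "z < \<xi>" "\<xi> < 0" "gauss_int c 0 - gauss_int c z = (0 - z) * gauss c \<xi>"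
      using MVT2[OF 1, of "gauss_int c" "gauss c"] gauss_int_has_real_derivative[OF assms] by blast
    then show ?thesis using that[of \<xi>] by auto
  next
    case 2
    obtain \<xi> where "0 < \<xi>" "\<xi> < z" "gauss_int c z - gauss_int c 0 = (z - 0) * gauss c \<xi>"
      using MVT2[OF 2, of "gauss_int c" "gauss c"] gauss_int_has_real_derivative[OF assms] by blast
    then show ?thesis using that[of \<xi>] by auto
  qed
qed

lemma gauss_int_mono:
  assumes "c \<noteq> 0" "x \<le> y" shows "gauss_int c x \<le> gauss_int c y"
  by (rule DERIV_nonneg_imp_nondecreasing[OF assms(2)])
     (use gauss_int_has_real_derivative[OF assms(1)] gauss_nonneg in blast)

lemma gauss_int_diff_le:
  assumes "0 < c" shows "\<bar>gauss_int c x - gauss_int c y\<bar> \<le> \<bar>x - y\<bar>"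
proof -
  have *: "gauss_int c y - gauss_int c x \<le> y - x" if "x \<le> y" for x y
  proof -
    have "x - gauss_int c x \<le> y - gauss_int c y"
    proof (rule DERIV_nonneg_imp_nondecreasing[OF that])
      fix t show "\<exists>d. ((\<lambda>x. x - gauss_int c x) has_real_derivative d) (at t) \<and> 0 \<le> d"
        using assms gauss_le_1[of c t]
        by (intro exI[of _ "1 - gauss c t"]) (auto intro!: derivative_eq_intros gauss_int_has_real_derivative)
    qed
    then show ?thesis by simp
  qed
  show ?thesis using *[of x y] *[of y x] gauss_int_mono[of c x y] gauss_int_mono[of c y x] assms
    by (cases "x \<le> y") auto
qed

text \<open>Parabolic scaling; it later turns smallness of \<open>gauss_int c (p t) / sqrt c\<close>
  into smallness of \<open>p t / sqrt c\<close>.\<close>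

lemma gauss_int_scale:
  assumes "0 < c" shows "gauss_int c z = sqrt c * gauss_int 1 (z / sqrt c)"
proof -
  have "((\<lambda>z. gauss_int c z - sqrt c * gauss_int 1 (z / sqrt c)) has_real_derivative 0) (at z)" for z
  proof -
    have d2: "((\<lambda>z. gauss_int 1 (z / sqrt c)) has_real_derivative gauss 1 (z / sqrt c) * (1 / sqrt c)) (at z)"
      by (rule DERIV_chain2[OF gauss_int_has_real_derivative DERIV_cdivide[OF DERIV_ident]]) simp
    have "((\<lambda>z. gauss_int c z - sqrt c * gauss_int 1 (z / sqrt c)) has_real_derivative
        gauss c z - sqrt c * (gauss 1 (z / sqrt c) * (1 / sqrt c))) (at z)"
      by (rule DERIV_diff[OF gauss_int_has_real_derivative DERIV_cmult[OF d2]]) (use assms in simp)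
    moreover have "gauss 1 (z / sqrt c) = gauss c z"
      using assms by (simp add: gauss_def power_divide)
    ultimately show ?thesis using assms by simp
  qed
  then have "gauss_int c z - sqrt c * gauss_int 1 (z / sqrt c) = gauss_int c 0 - sqrt c * gauss_int 1 (0 / sqrt c)"
    by (intro DERIV_isconst_all) auto
  then show ?thesis by simp
qed

lemma gauss_int_eq_integral:
  assumes "c \<noteq> 0" "a \<le> b"
  shows "(LBINT x. indicator {a..b} x * gauss c x) = gauss_int c b - gauss_int c a"
proof -
  have "integral\<^sup>L lborel (\<lambda>x. indicator {a..b} x *\<^sub>R gauss c x) = gauss_int c b - gauss_int c a"
  proof (rule integral_FTC_atLeastAtMost[OF assms(2)])
    show "(gauss_int c has_vector_derivative gauss c x) (at x within {a..b})" for x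
      unfolding has_real_derivative_iff_has_vector_derivative[symmetric]
      by (rule has_field_derivative_at_within[OF gauss_int_has_real_derivative[OF assms(1)]])
    show "continuous_on {a..b} (gauss c)"
      by (intro continuous_intros) (use assms in simp)
  qed
  then show ?thesis by simp
qed

lemma gauss_int_tendsto:
  assumes c: "0 < c" shows "(gauss_int c \<longlongrightarrow> sqrt (pi * c)) at_top"
proof -
  have "((\<lambda>z. LBINT x. indicator {-z..z} x * gauss c x) \<longlongrightarrow> integral\<^sup>L lborel (gauss c)) at_top"
  proof (rule integral_dominated_convergence_at_top[where w="gauss c"])
    show "AE x in lborel. ((\<lambda>z. indicator {- z..z} x * gauss c x) \<longlongrightarrow> gauss c x) at_top"
    proof (rule AE_I2)
      fix x :: real
      have "\<forall>\<^sub>F z in at_top. indicator {- z..z} x * gauss c x = gauss c x"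
        using eventually_ge_at_top[of "\<bar>x\<bar>"] by eventually_elim (auto simp: indicator_def)
      then show "((\<lambda>z. indicator {- z..z} x * gauss c x) \<longlongrightarrow> gauss c x) at_top"
        by (rule tendsto_eventually)
    qed
  qed (use c integrable_gauss in \<open>auto simp: indicator_def\<close>)
  moreover have "\<forall>\<^sub>F z in at_top. (LBINT x. indicator {-z..z} x * gauss c x) = 2 * gauss_int c z"
    using eventually_ge_at_top[of 0]
    by eventually_elim (use c in \<open>simp add: gauss_int_eq_integral gauss_int_minus\<close>)
  ultimately have "((\<lambda>z. 2 * gauss_int c z) \<longlongrightarrow> integral\<^sup>L lborel (gauss c)) at_top"
    using tendsto_cong by force
  then have "((\<lambda>z. (2 * gauss_int c z) / 2) \<longlongrightarrow> sqrt (4 * pi * c) / 2) at_top"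
    using c by (intro tendsto_divide) (auto simp: integral_gauss)
  then show ?thesis by (simp add: real_sqrt_mult)
qed

lemma gauss_int_le:
  assumes c: "0 < c" shows "\<bar>gauss_int c z\<bar> \<le> sqrt (pi * c)"
proof -
  have *: "gauss_int c z \<le> sqrt (pi * c)" for z
  proof (rule tendsto_lowerbound[OF gauss_int_tendsto[OF c]])
    show "\<forall>\<^sub>F i in at_top. gauss_int c z \<le> gauss_int c i"
      using eventually_ge_at_top[of z] by eventually_elim (use c gauss_int_mono in auto)
  qed auto
  show ?thesis using *[of z] *[of "-z"] c by (simp add: gauss_int_minus)
qed

section \<open>The midpoint rule for the Gaussian\<close>

lemma gauss_second_derivative_bound:
  assumes c: "0 < c"
  shows "\<bar>(y\<^sup>2 / (4 * c\<^sup>2) - 1 / (2 * c)) * gauss c y\<bar> \<le> 5 / (2 * c) * gauss (2 * c) y"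
proof -
  \<comment> \<open>Half of the exponent absorbs the polynomial factor: with this \<open>v\<close>
    the Gaussian is exp (- 2 v), and \<open>v * exp (- v)\<close> is at most 1. The other half is
    the wider Gaussian of parameter \<open>2 * c\<close>; the constant 5 / 2 is 2 + 1 / 2.\<close>
  define v where "v = y\<^sup>2 / (8 * c)"
  have v: "0 \<le> v" using c by (simp add: v_def)
  have g: "gauss c y = exp (- v) * exp (- v)" "gauss (2 * c) y = exp (- v)"
    using c by (simp_all add: gauss_def v_def mult_exp_exp)
  have ve: "v * exp (- v) \<le> 1"
  proof -
    have "v \<le> exp v" using exp_ge_add_one_self[of v] by linarith
    then show ?thesis by (simp add: exp_minus field_simps)
  qed
  have "\<bar>y\<^sup>2 / (4 * c\<^sup>2) - 1 / (2 * c)\<bar> \<le> (2 * v + 1 / 2) / c"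
  proof -
    have "y\<^sup>2 / (4 * c\<^sup>2) = 2 * v / c" using c by (simp add: v_def field_simps power2_eq_square)
    then show ?thesis using c v by (simp add: field_simps abs_le_iff)
  qed
  then have "\<bar>(y\<^sup>2 / (4 * c\<^sup>2) - 1 / (2 * c)) * gauss c y\<bar> \<le> (2 * v + 1 / 2) / c * gauss c y"
    unfolding abs_mult abs_of_nonneg[OF gauss_nonneg] by (rule mult_right_mono) simp
  also have "\<dots> = (2 * (v * exp (- v)) + 1 / 2 * exp (- v)) / c * exp (- v)" by (simp add: g field_simps)
  also have "\<dots> \<le> (2 * 1 + 1 / 2 * 1) / c * exp (- v)"
    using ve v c by (intro mult_right_mono divide_right_mono add_mono mult_left_mono) auto
  finally show ?thesis using g c by simp
qed


text \<open>\<open>W\<close> is a primitive of the majorant of the second derivative, so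
  \<open>W - H\<close> and \<open>W + H\<close> are nondecreasing. Bounding by an increment of
  \<open>W\<close> over the cell, not by a supremum, is what later makes the errors
  telescope.\<close>

lemma gauss_derivative_increment:
  assumes c: "0 < c" and lu: "l \<le> x" "x \<le> u" "l \<le> y" "y \<le> u"
  shows "\<bar>(x / (2 * c)) * gauss c x - (y / (2 * c)) * gauss c y\<bar>
         \<le> 5 / (2 * c) * (gauss_int (2 * c) u - gauss_int (2 * c) l)"
proof -
  define W where "W z = 5 / (2 * c) * gauss_int (2 * c) z" for z
  define H where "H z = (z / (2 * c)) * gauss c z" for z
  have W: "(W has_real_derivative 5 / (2 * c) * gauss (2 * c) z) (at z)" for z
    unfolding W_def by (rule DERIV_cmult[OF gauss_int_has_real_derivative]) (use c in simp)
  have H: "(H has_real_derivative - ((z\<^sup>2 / (4 * c\<^sup>2) - 1 / (2 * c)) * gauss c z)) (at z)" for z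
  proof -
    have "(H has_real_derivative z / (2 * c) * (- (z / (2 * c)) * gauss c z) + 1 / (2 * c) * gauss c z) (at z)"
      unfolding H_def using c
      by (intro DERIV_mult' gauss_has_real_derivative DERIV_cdivide[OF DERIV_ident]) simp
    moreover have "z / (2 * c) * (- (z / (2 * c)) * gauss c z) + 1 / (2 * c) * gauss c z
        = - ((z\<^sup>2 / (4 * c\<^sup>2) - 1 / (2 * c)) * gauss c z)"
      using c by (simp add: field_simps power2_eq_square)
    ultimately show ?thesis by simp
  qed
  have mono: "H t - H s \<le> W t - W s \<and> H s - H t \<le> W t - W s" if "s \<le> t" for s t
  proof
    have "W s - H s \<le> W t - H t"
    proof (rule DERIV_nonneg_imp_nondecreasing[OF that])
      fix z
      show "\<exists>d. ((\<lambda>z. W z - H z) has_real_derivative d) (at z) \<and> 0 \<le> d"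
        using DERIV_diff[OF W H, of z] gauss_second_derivative_bound[OF c, of z]
        by (intro exI conjI) (assumption, linarith)
    qed
    then show "H t - H s \<le> W t - W s" by simp
    have "W s + H s \<le> W t + H t"
    proof (rule DERIV_nonneg_imp_nondecreasing[OF that])
      fix z
      show "\<exists>d. ((\<lambda>z. W z + H z) has_real_derivative d) (at z) \<and> 0 \<le> d"
        using DERIV_add[OF W H, of z] gauss_second_derivative_bound[OF c, of z]
        by (intro exI conjI) (assumption, linarith)
    qed
    then show "H s - H t \<le> W t - W s" by simp
  qed
  have Wm: "W s \<le> W t" if "s \<le> t" for s t
    using mono[OF that] by linarith
  have "\<bar>H x - H y\<bar> \<le> W u - W l"
    using mono[of x y] mono[of y x] Wm[OF lu(1)] Wm[OF lu(2)] Wm[OF lu(3)] Wm[OF lu(4)]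
    by (cases "x \<le> y") linarith+
  then show ?thesis by (simp only: W_def H_def right_diff_distrib)
qed

text \<open>\<open>D\<close> measures the defect on the symmetric cell of half-width
  \<open>h\<close>. Its derivative is a symmetric second difference, in which the linear Taylor term
  drops out.\<close>

lemma gauss_midpoint_cell:
  assumes c: "0 < c" and a: "0 < a"
  shows "\<bar>a * gauss c m - (gauss_int c (m + a / 2) - gauss_int c (m - a / 2))\<bar>
    \<le> a\<^sup>2 / 2 * (5 / (2 * c) * (gauss_int (2 * c) (m + a / 2) - gauss_int (2 * c) (m - a / 2)))"
proof -
  define W where "W = 5 / (2 * c) * (gauss_int (2 * c) (m + a / 2) - gauss_int (2 * c) (m - a / 2))"
  have W: "0 \<le> W" unfolding W_def using c a
    by (intro mult_nonneg_nonneg) (auto intro!: gauss_int_mono)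
  define g1 where "g1 y = - (y / (2 * c)) * gauss c y" for y
  have g1: "(gauss c has_real_derivative g1 y) (at y)" for y
    unfolding g1_def by (rule gauss_has_real_derivative) (use c in simp)
  have taylor: "\<bar>gauss c (m + h) - gauss c m - g1 m * h\<bar> \<le> W * \<bar>h\<bar>" if h: "\<bar>h\<bar> \<le> a / 2" for h
  proof -
    obtain z where z: "\<bar>z - m\<bar> \<le> \<bar>h\<bar>" "gauss c (m + h) - gauss c m = h * g1 z"
    proof (cases rule: linorder_cases[of h 0])
      case less
      then have "m + h < m" by simp
      from MVT2[OF this g1] obtain z where "m + h < z" "z < m" "gauss c m - gauss c (m + h) = (m - (m + h)) * g1 z"
        by blast
      with less show ?thesis by (intro that[of z]) auto
    next
      case equal then show ?thesis by (intro that[of m]) auto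
    next
      case greater
      then have "m < m + h" by simp
      from MVT2[OF this g1] obtain z where "m < z" "z < m + h" "gauss c (m + h) - gauss c m = (m + h - m) * g1 z"
        by blast
      with greater show ?thesis by (intro that[of z]) auto
    qed
    have "\<bar>(z / (2 * c)) * gauss c z - (m / (2 * c)) * gauss c m\<bar> \<le> W"
      unfolding W_def using z(1) h a by (intro gauss_derivative_increment[OF c]) linarith+
    then have "\<bar>g1 z - g1 m\<bar> \<le> W" by (simp add: g1_def abs_minus_commute)
    have "\<bar>gauss c (m + h) - gauss c m - g1 m * h\<bar> = \<bar>g1 z - g1 m\<bar> * \<bar>h\<bar>"
      unfolding z(2) abs_mult[symmetric] by (simp add: algebra_simps)
    also have "\<dots> \<le> W * \<bar>h\<bar>" by (rule mult_right_mono) (use \<open>\<bar>g1 z - g1 m\<bar> \<le> W\<close> in auto)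
    finally show ?thesis .
  qed
  define D where "D h = gauss_int c (m + h) - gauss_int c (m - h) - 2 * h * gauss c m" for h
  have D: "(D has_real_derivative gauss c (m + h) + gauss c (m - h) - 2 * gauss c m) (at h)" for h
  proof -
    have 1: "((\<lambda>h. gauss_int c (m + h)) has_real_derivative gauss c (m + h) * 1) (at h)"
      by (rule DERIV_chain2[OF gauss_int_has_real_derivative]) (use c in \<open>auto intro!: derivative_eq_intros\<close>)
    have 2: "((\<lambda>h. gauss_int c (m - h)) has_real_derivative gauss c (m - h) * (-1)) (at h)"
      by (rule DERIV_chain2[OF gauss_int_has_real_derivative]) (use c in \<open>auto intro!: derivative_eq_intros\<close>)
    have 3: "((\<lambda>h. 2 * h * gauss c m) has_real_derivative 2 * gauss c m) (at h)"
      by (auto intro!: derivative_eq_intros)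
    show ?thesis using DERIV_diff[OF DERIV_diff[OF 1 2] 3] unfolding D_def[abs_def] by simp
  qed
  have "0 < a / 2" using a by simp
  from MVT2[OF this D] obtain h where h: "0 < h" "h < a / 2"
    "D (a / 2) - D 0 = (a / 2 - 0) * (gauss c (m + h) + gauss c (m - h) - 2 * gauss c m)" by blast
  have "\<bar>gauss c (m + h) + gauss c (m - h) - 2 * gauss c m\<bar> \<le> W * h + W * h"
    using taylor[of h] taylor[of "- h"] h by simp
  also have "\<dots> \<le> W * a" using h W mult_left_mono[of "2 * h" a W] by simp
  finally have "\<bar>D (a / 2) - D 0\<bar> \<le> a / 2 * (W * a)"
    unfolding h(3) using a by (simp add: abs_mult)
  moreover have "D (a / 2) - D 0 = - (a * gauss c m - (gauss_int c (m + a / 2) - gauss_int c (m - a / 2)))"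
    by (simp add: D_def)
  moreover have "a / 2 * (W * a) = a\<^sup>2 / 2 * W" by (simp add: power2_eq_square)
  ultimately show ?thesis unfolding W_def[symmetric] by (simp only: abs_minus_cancel)
qed

text \<open>The point \<open>z + n * a\<close> is the midpoint of a cell of length \<open>a\<close>,
  the first cell starting at \<open>z - a / 2\<close>. The cell errors telescope to an increment of
  \<open>gauss_int (2 * c)\<close>, of order sqrt c, against a factor 1 / c: the total error is of
  order 1 / sqrt c.\<close>

lemma gauss_midpoint_rule:
  assumes c: "0 < c" and a: "0 < a"
  shows "summable (\<lambda>n. gauss c (z + real n * a))"
    and "\<bar>a * (\<Sum>n. gauss c (z + real n * a)) - (sqrt (pi * c) - gauss_int c (z - a / 2))\<bar>
           \<le> 5 * a\<^sup>2 * sqrt (2 * pi) / (2 * sqrt c)"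
proof -
  define K where "K = 5 * a\<^sup>2 * sqrt (2 * pi) / (2 * sqrt c)"
  have part: "\<bar>(\<Sum>n<N. a * gauss c (z + real n * a)) - (gauss_int c (z - a / 2 + real N * a) - gauss_int c (z - a / 2))\<bar>
     \<le> a\<^sup>2 / 2 * (5 / (2 * c) * (gauss_int (2 * c) (z - a / 2 + real N * a) - gauss_int (2 * c) (z - a / 2)))" for N
  proof (induction N)
    case (Suc N)
    have e: "z + real N * a - a / 2 = z - a / 2 + real N * a" "z + real N * a + a / 2 = z - a / 2 + real (Suc N) * a"
      by (simp_all add: field_simps)
    note cell = gauss_midpoint_cell[OF c a, of "z + real N * a", unfolded e]
    show ?case using Suc cell
      unfolding right_diff_distrib sum.lessThan_Suc by linarith
  qed simp
  \<comment> \<open>\<open>K\<close> arises from the telescoped error when both values of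
    \<open>gauss_int (2 * c)\<close> are bounded by \<open>sqrt (pi * (2 * c))\<close>.\<close>
  have K: "a\<^sup>2 / 2 * (5 / (2 * c) * (gauss_int (2 * c) x - gauss_int (2 * c) y)) \<le> K" for x y
  proof -
    have "gauss_int (2 * c) x - gauss_int (2 * c) y \<le> 2 * sqrt (pi * (2 * c))"
      using gauss_int_le[of "2 * c" x] gauss_int_le[of "2 * c" y] c by linarith
    then have "a\<^sup>2 / 2 * (5 / (2 * c) * (gauss_int (2 * c) x - gauss_int (2 * c) y))
        \<le> a\<^sup>2 / 2 * (5 / (2 * c) * (2 * sqrt (pi * (2 * c))))"
      using c by (intro mult_left_mono) auto
    also have "\<dots> = K"
    proof -
      have r: "c = sqrt c * sqrt c" "sqrt c \<noteq> 0" using c by auto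
      have "sqrt (pi * (2 * c)) = sqrt (2 * pi) * sqrt c" by (simp add: real_sqrt_mult)
      then have "a\<^sup>2 / 2 * (5 / (2 * c) * (2 * sqrt (pi * (2 * c)))) = 5 * a\<^sup>2 * sqrt (2 * pi) / 2 * (sqrt c / c)"
        by simp
      also have "sqrt c / c = 1 / sqrt c" using c by (simp add: real_div_sqrt field_simps)
      finally show ?thesis by (simp add: K_def)
    qed
    finally show ?thesis .
  qed
  have lim: "(\<lambda>N. gauss_int c (z - a / 2 + real N * a)) \<longlonglongrightarrow> sqrt (pi * c)"
  proof (rule filterlim_compose[OF gauss_int_tendsto[OF c]])
    show "filterlim (\<lambda>N. z - a / 2 + real N * a) at_top sequentially"
      using a by real_asymp
  qed
  have "summable (\<lambda>n. a * gauss c (z + real n * a))"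
  proof (rule bounded_imp_summable)
    show "0 \<le> a * gauss c (z + real n * a)" for n using a by simp
    show "(\<Sum>k\<le>n. a * gauss c (z + real k * a)) \<le> K + 2 * sqrt (pi * c)" for n
      using part[of "Suc n"] K[of "z - a / 2 + real (Suc n) * a" "z - a / 2"]
        gauss_int_le[OF c, of "z - a / 2 + real (Suc n) * a"] gauss_int_le[OF c, of "z - a / 2"]
      unfolding lessThan_Suc_atMost by linarith
  qed
  then show s: "summable (\<lambda>n. gauss c (z + real n * a))"
    using a by (simp add: summable_cmult_iff)
  then have "(\<lambda>N. \<Sum>n<N. gauss c (z + real n * a)) \<longlonglongrightarrow> (\<Sum>n. gauss c (z + real n * a))"
    by (rule summable_LIMSEQ)
  then have "(\<lambda>N. a * (\<Sum>n<N. gauss c (z + real n * a))) \<longlonglongrightarrow> a * (\<Sum>n. gauss c (z + real n * a))"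
    by (intro tendsto_mult_left)
  then have "(\<lambda>N. \<bar>(\<Sum>n<N. a * gauss c (z + real n * a)) - (gauss_int c (z - a / 2 + real N * a) - gauss_int c (z - a / 2))\<bar>)
      \<longlonglongrightarrow> \<bar>a * (\<Sum>n. gauss c (z + real n * a)) - (sqrt (pi * c) - gauss_int c (z - a / 2))\<bar>"
    unfolding sum_distrib_left by (intro tendsto_intros lim)
  then show "\<bar>a * (\<Sum>n. gauss c (z + real n * a)) - (sqrt (pi * c) - gauss_int c (z - a / 2))\<bar>
      \<le> 5 * a\<^sup>2 * sqrt (2 * pi) / (2 * sqrt c)"
    unfolding K_def[symmetric]
  proof (rule LIMSEQ_le_const2)
    show "\<exists>N. \<forall>n\<ge>N. \<bar>(\<Sum>n<n. a * gauss c (z + real n * a)) - (gauss_int c (z - a / 2 + real n * a) - gauss_int c (z - a / 2))\<bar> \<le> K"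
      using part K by (meson order_trans)
  qed
qed

section \<open>Duhamel's formula for the positive part\<close>

lemma lipschitz_on_times_bounded:
  fixes f g :: "real \<Rightarrow> real"
  assumes f: "K-lipschitz_on S f" and g: "L-lipschitz_on S g"
    and fb: "\<And>x. x \<in> S \<Longrightarrow> \<bar>f x\<bar> \<le> B" and gb: "\<And>x. x \<in> S \<Longrightarrow> \<bar>g x\<bar> \<le> D" and BD: "0 \<le> B" "0 \<le> D"
  shows "(K * D + B * L)-lipschitz_on S (\<lambda>x. f x * g x)"
proof (rule lipschitz_onI)
  have K: "0 \<le> K" "0 \<le> L" using f g lipschitz_on_nonneg by auto
  show "0 \<le> K * D + B * L" using K BD by simp
  fix x y assume xy: "x \<in> S" "y \<in> S"
  have "f x * g x - f y * g y = (f x - f y) * g x + f y * (g x - g y)" by (simp add: algebra_simps)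
  then have "\<bar>f x * g x - f y * g y\<bar> \<le> \<bar>f x - f y\<bar> * \<bar>g x\<bar> + \<bar>f y\<bar> * \<bar>g x - g y\<bar>"
    by (metis abs_mult abs_triangle_ineq)
  also have "\<dots> \<le> (K * dist x y) * D + B * (L * dist x y)"
    using lipschitz_onD[OF f xy] lipschitz_onD[OF g xy] fb[OF xy(2)] gb[OF xy(1)] K BD
    by (intro add_mono mult_mono) (auto simp: dist_real_def)
  also have "\<dots> = (K * D + B * L) * dist x y" by (simp add: algebra_simps)
  finally show "dist (f x * g x) (f y * g y) \<le> (K * D + B * L) * dist x y" by (simp add: dist_real_def)
qed

lemma continuous_on_Icc_bounded:
  fixes f :: "real \<Rightarrow> real"
  assumes "continuous_on {a..b} f"
  obtains B where "0 \<le> B" "\<And>x. x \<in> {a..b} \<Longrightarrow> \<bar>f x\<bar> \<le> B"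
proof -
  have "bounded (f ` {a..b})" using assms by (intro compact_imp_bounded compact_continuous_image) auto
  then obtain B where B: "\<forall>y\<in>f ` {a..b}. norm y \<le> B" unfolding bounded_iff by blast
  then have "\<bar>f x\<bar> \<le> B" if "x \<in> {a..b}" for x using that by force
  then show ?thesis using that[of "\<bar>B\<bar>"] by force
qed

lemma C1_lipschitz_on:
  fixes f :: "real \<Rightarrow> real"
  assumes d: "\<And>x. x \<in> {a..b} \<Longrightarrow> (f has_real_derivative f' x) (at x)" and c: "continuous_on {a..b} f'"
  obtains L where "L-lipschitz_on {a..b} f"
proof -
  obtain B where B: "0 \<le> B" "\<And>x. x \<in> {a..b} \<Longrightarrow> \<bar>f' x\<bar> \<le> B"
    using continuous_on_Icc_bounded[OF c] by blast
  have "B-lipschitz_on {a..b} f"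
  proof (rule lipschitz_onI)
    fix x y assume xy: "x \<in> {a..b}" "y \<in> {a..b}"
    have "norm (f x - f y) \<le> B * norm (x - y)"
      by (rule field_differentiable_bound[of "{a..b}" f f'])
         (use d B xy in \<open>auto intro: has_field_derivative_at_within\<close>)
    then show "dist (f x) (f y) \<le> B * dist x y" by (simp add: dist_real_def)
  qed fact
  then show ?thesis by (rule that)
qed

lemma continuous_on_slices:
  assumes "continuous_on (A \<times> T) (\<lambda>(x, t). f x t)"
  shows "t \<in> T \<Longrightarrow> continuous_on A (\<lambda>x. f x t)" and "x \<in> A \<Longrightarrow> continuous_on T (f x)"
proof -
  note compose = continuous_on_compose[OF _ continuous_on_subset[OF assms]]
  show "continuous_on A (\<lambda>x. f x t)" if "t \<in> T"
    using compose[of A "\<lambda>x. (x, t)"] that by (simp add: comp_def continuous_on_Pair image_subset_iff)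
  show "continuous_on T (f x)" if "x \<in> A"
    using compose[of T "\<lambda>t. (x, t)"] that by (simp add: comp_def continuous_on_Pair image_subset_iff)
qed

text \<open>Nonnegativity of \<open>g\<close> makes the enlargement from \<open>A\<close> to
  \<open>B\<close> free. Integrability and size pass together from a known integral, in particular
  to the source terms.\<close>

lemma set_integral_dominated:
  fixes f g :: "real \<Rightarrow> real"
  assumes f: "set_borel_measurable lborel A f" and g: "set_integrable lborel B g" and AB: "A \<subseteq> B"
    and le: "\<And>s. s \<in> A \<Longrightarrow> \<bar>f s\<bar> \<le> q * g s" and q: "0 \<le> q" and nonneg: "\<And>s. s \<in> B \<Longrightarrow> 0 \<le> g s"
  shows "set_integrable lborel A f" and "\<bar>LBINT s:A. f s\<bar> \<le> q * (LBINT s:B. g s)"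
proof -
  have gi: "integrable lborel (\<lambda>s. q * (indicator B s *\<^sub>R g s))"
    using g by (simp add: set_integrable_def)
  have nn: "0 \<le> q * (indicator B s *\<^sub>R g s)" for s
    using q nonneg by (auto simp: indicator_def)
  have b: "norm (indicator A s *\<^sub>R f s) \<le> q * (indicator B s *\<^sub>R g s)" for s
    using le[of s] AB nn[of s] by (cases "s \<in> A") auto
  show "set_integrable lborel A f" unfolding set_integrable_def
    by (rule Bochner_Integration.integrable_bound[OF gi f[unfolded set_borel_measurable_def]])
       (use order_trans[OF b abs_ge_self] in auto)
  have "\<bar>LBINT s:A. f s\<bar> \<le> (LBINT s. norm (indicator A s *\<^sub>R f s))"
    unfolding set_lebesgue_integral_def real_norm_def[symmetric] by (rule integral_norm_bound)
  also have "\<dots> \<le> (LBINT s. q * (indicator B s *\<^sub>R g s))"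
    by (rule integral_mono'[OF gi b nn])
  finally show "\<bar>LBINT s:A. f s\<bar> \<le> q * (LBINT s:B. g s)" by (simp add: set_lebesgue_integral_def)
qed

lemma set_borel_measurable_times:
  fixes f g :: "real \<Rightarrow> real"
  assumes "set_borel_measurable lborel A f" and "set_borel_measurable lborel B g" and "B \<subseteq> A"
  shows "set_borel_measurable lborel B (\<lambda>s. f s * g s)"
proof -
  have "(\<lambda>s. (indicator A s *\<^sub>R f s) * (indicator B s *\<^sub>R g s)) \<in> borel_measurable lborel"
    using assms(1,2) unfolding set_borel_measurable_def by (rule borel_measurable_times)
  moreover have "(\<lambda>s. (indicator A s *\<^sub>R f s) * (indicator B s *\<^sub>R g s)) = (\<lambda>s. indicator B s *\<^sub>R (f s * g s))"
    using assms(3) by (auto simp: fun_eq_iff indicator_def)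
  ultimately show ?thesis by (simp add: set_borel_measurable_def)
qed

lemma continuous_on_set_borel_measurable:
  fixes f :: "real \<Rightarrow> real"
  shows "A \<in> sets borel \<Longrightarrow> continuous_on A f \<Longrightarrow> set_borel_measurable lborel A f"
  unfolding set_borel_measurable_def using borel_measurable_continuous_on_indicator[of A f] by simp

lemma set_borel_measurable_mono:
  fixes f :: "real \<Rightarrow> real"
  assumes "set_borel_measurable lborel A f" "B \<in> sets borel" "B \<subseteq> A"
  shows "set_borel_measurable lborel B f"
  using set_borel_measurable_subset[OF assms(1) _ assms(3)] assms(2) by simp

lemma set_integrable_measurable:
  fixes f :: "real \<Rightarrow> real"
  shows "set_integrable lborel A f \<Longrightarrow> set_borel_measurable lborel A f"
  unfolding set_integrable_def set_borel_measurable_def by (rule borel_measurable_integrable)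

lemma set_integrable_mult_continuous:
  fixes f g :: "real \<Rightarrow> real"
  assumes f: "set_integrable lborel {a..b} f" and g: "continuous_on {a..b} g"
  shows "set_integrable lborel {a..b} (\<lambda>x. f x * g x)"
proof -
  obtain B where B: "0 \<le> B" "\<And>x. x \<in> {a..b} \<Longrightarrow> \<bar>g x\<bar> \<le> B" using continuous_on_Icc_bounded[OF g] by blast
  show ?thesis
  proof (rule set_integral_dominated(1)[where g="\<lambda>x. \<bar>f x\<bar>" and B="{a..b}" and q=B])
    show "set_borel_measurable lborel {a..b} (\<lambda>x. f x * g x)"
      by (rule set_borel_measurable_times[OF set_integrable_measurable[OF f] continuous_on_set_borel_measurable[OF _ g]]) auto
    show "\<bar>f x * g x\<bar> \<le> B * \<bar>f x\<bar>" if "x \<in> {a..b}" for x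
      using mult_right_mono[OF B(2)[OF that], of "\<bar>f x\<bar>"] by (simp add: abs_mult mult.commute)
  qed (use B f set_integrable_abs in auto)
qed

section \<open>The one-sided free boundary problem: weak form and heat identity\<close>

lemma heat_space_derivatives:
  assumes "0 < c"
  shows "((\<lambda>x. heat c (x0 - x)) has_real_derivative ((x0 - x) / (2 * c)) * heat c (x0 - x)) (at x)"
    and "((\<lambda>x. ((x0 - x) / (2 * c)) * heat c (x0 - x)) has_real_derivative
          ((x0 - x)\<^sup>2 / (4 * c\<^sup>2) - 1 / (2 * c)) * heat c (x0 - x)) (at x)"
proof -
  have 1: "((\<lambda>x. x0 - x) has_real_derivative - 1) (at x)" for x by (auto intro!: derivative_eq_intros)
  show 2: "((\<lambda>x. heat c (x0 - x)) has_real_derivative ((x0 - x) / (2 * c)) * heat c (x0 - x)) (at x)" for x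
    using DERIV_chain2[OF heat_has_real_derivative 1, of c] assms by simp
  have "((\<lambda>x. ((x0 - x) / (2 * c)) * heat c (x0 - x)) has_real_derivative
      (x0 - x) / (2 * c) * (((x0 - x) / (2 * c)) * heat c (x0 - x)) + (- 1) / (2 * c) * heat c (x0 - x)) (at x)"
    by (rule DERIV_mult'[OF DERIV_cdivide[OF 1] 2])
  moreover have "(x0 - x) / (2 * c) * (((x0 - x) / (2 * c)) * heat c (x0 - x)) + (- 1) / (2 * c) * heat c (x0 - x)
     = ((x0 - x)\<^sup>2 / (4 * c\<^sup>2) - 1 / (2 * c)) * heat c (x0 - x)"
    using assms by (simp add: field_simps power2_eq_square)
  ultimately show "((\<lambda>x. ((x0 - x) / (2 * c)) * heat c (x0 - x)) has_real_derivative
          ((x0 - x)\<^sup>2 / (4 * c\<^sup>2) - 1 / (2 * c)) * heat c (x0 - x)) (at x)" by simp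
qed

text \<open>Read backward from the horizon \<open>T\<close>, the kernel solves the adjoint heat
  equation, which qualifies it as a test function.\<close>

lemma heat_backward_time_derivative:
  assumes "0 < k" "t < T"
  shows "((\<lambda>t. heat (k * (T - t)) y) has_real_derivative
     - (k * ((y\<^sup>2 / (4 * (k * (T - t))\<^sup>2) - 1 / (2 * (k * (T - t)))) * heat (k * (T - t)) y))) (at t)"
proof -
  have 1: "((\<lambda>t. k * (T - t)) has_real_derivative - k) (at t)" by (auto intro!: derivative_eq_intros)
  have "0 < k * (T - t)" using assms by simp
  from DERIV_chain2[OF heat_has_real_derivative_time[OF this] 1] show ?thesis by (simp add: mult.commute)
qed

text \<open>\<open>U\<close> stands for \<open>exp (- bl t) * F x t\<close>, or for its reflected
  counterpart. The heat equation is asked only where \<open>U\<close> is positive: on the other side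
  the exponential factor does not remove the reaction term, and there only the sign of
  \<open>U\<close> matters. The flux \<open>Ux\<close> is given no regularity in time.\<close>

locale half_problem =
  fixes k :: real and U Ux Uxx :: "real \<Rightarrow> real \<Rightarrow> real" and p :: "real \<Rightarrow> real"
  assumes k_pos: "0 < k"
    and cont: "continuous_on (UNIV \<times> {0..}) (\<lambda>(x, t). U x t)"
    and bdd: "\<And>T. bounded ((\<lambda>(x, t). U x t) ` (UNIV \<times> {0..T}))"
    and lip: "\<And>x S T. 0 < S \<Longrightarrow> S \<le> T \<Longrightarrow> \<exists>L. L-lipschitz_on {S..T} (U x)"
    and Uxx_cont: "continuous_on (UNIV \<times> {0<..}) (\<lambda>(x, t). Uxx x t)"
    and dx: "\<And>x t. 0 < t \<Longrightarrow> ((\<lambda>y. U y t) has_real_derivative Ux x t) (at x)"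
    and dxx: "\<And>x t. 0 < t \<Longrightarrow> ((\<lambda>y. Ux y t) has_real_derivative Uxx x t) (at x)"
    and eq: "\<And>x. AE t in lborel. 0 < t \<and> 0 < U x t \<longrightarrow> (U x has_real_derivative k * Uxx x t) (at t)"
    and zero: "\<And>t. 0 < t \<Longrightarrow> U (p t) t = 0"
    and left: "\<And>x t. 0 < t \<Longrightarrow> x < p t \<Longrightarrow> 0 < U x t"
    and right: "\<And>x t. 0 < t \<Longrightarrow> p t < x \<Longrightarrow> U x t < 0"
begin

definition "u x t = max (U x t) 0"

lemma u_nonneg [simp]: "0 \<le> u x t" by (simp add: u_def)

lemma U_pos_iff: "0 < t \<Longrightarrow> 0 < U x t \<longleftrightarrow> x < p t"
  using zero[of t] left[of t x] right[of t x] by (cases x "p t" rule: linorder_cases) auto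

lemma u_eq_0: "0 < t \<Longrightarrow> p t \<le> x \<Longrightarrow> u x t = 0"
  using U_pos_iff[of t x] by (auto simp: u_def)

lemma u_eq_U: "0 < t \<Longrightarrow> x \<le> p t \<Longrightarrow> u x t = U x t"
  using U_pos_iff[of t x] zero[of t] by (cases "x = p t") (auto simp: u_def)

lemma cont_time: "continuous_on {0..} (U x)"
  by (rule continuous_on_slices(2)[OF cont]) simp

lemma cont_space: "0 \<le> t \<Longrightarrow> continuous_on A (\<lambda>x. U x t)"
  by (rule continuous_on_subset[OF continuous_on_slices(1)[OF cont]]) simp_all

lemma u_cont: "continuous_on (UNIV \<times> {0..}) (\<lambda>(x, t). u x t)"
  using continuous_on_max[OF cont continuous_on_const[of _ 0]] by (simp add: u_def case_prod_beta)

lemma u_cont_space: "0 \<le> t \<Longrightarrow> continuous_on A (\<lambda>x. u x t)"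
  unfolding u_def by (intro continuous_intros cont_space)

lemma isCont_time: "0 < t \<Longrightarrow> isCont (U x) t"
  using continuous_on_subset[OF cont_time[of x], of "{0<..}"]
  by (simp add: continuous_on_eq_continuous_at subset_iff)

lemma Uxx_cont_space: "0 < t \<Longrightarrow> continuous_on A (\<lambda>x. Uxx x t)"
  by (rule continuous_on_subset[OF continuous_on_slices(1)[OF Uxx_cont]]) simp_all

lemma Uxx_cont_time: "A \<subseteq> {0<..} \<Longrightarrow> continuous_on A (Uxx x)"
  by (rule continuous_on_subset[OF continuous_on_slices(2)[OF Uxx_cont]]) simp_all

lemma u_bounded: obtains M where "0 \<le> M" "\<And>x t. 0 \<le> t \<Longrightarrow> t \<le> T \<Longrightarrow> u x t \<le> M"
proof -
  obtain M where M: "\<And>z. z \<in> UNIV \<times> {0..T} \<Longrightarrow> norm (case z of (x, t) \<Rightarrow> U x t) \<le> M"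
    using bdd[of T] unfolding bounded_iff by auto
  show ?thesis
  proof (rule that)
    show "0 \<le> max M 0" by simp
    fix x t assume "0 \<le> t" "t \<le> T"
    then have "\<bar>U x t\<bar> \<le> M" using M[of "(x, t)"] by simp
    then show "u x t \<le> max M 0" by (auto simp: u_def)
  qed
qed

text \<open>The signs of \<open>U\<close> at fixed points on either side of \<open>p t\<close>
  persist for nearby times, and the sign of \<open>U\<close> tells on which side of the boundary a
  point lies.\<close>

lemma isCont_p: assumes "0 < t" shows "isCont p t"
proof (unfold isCont_def, rule tendstoI)
  fix e :: real assume e: "0 < e"
  have "0 < U (p t - e / 2) t" "U (p t + e / 2) t < 0" using left[OF assms] right[OF assms] e by simp_all
  then have "\<forall>\<^sub>F s in at t. 0 < U (p t - e / 2) s" "\<forall>\<^sub>F s in at t. U (p t + e / 2) s < 0"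
    using isCont_time[OF assms] order_tendstoD unfolding isCont_def by blast+
  moreover have "\<forall>\<^sub>F s in at t. 0 < s"
    using order_tendstoD(1)[OF tendsto_ident_at assms] .
  ultimately show "\<forall>\<^sub>F s in at t. dist (p s) (p t) < e"
  proof eventually_elim
    case (elim s)
    have "p t - e / 2 < p s" using U_pos_iff[OF elim(3)] elim(1) by blast
    moreover have "p s < p t + e / 2 \<or> p s = p t + e / 2"
      using left[OF elim(3), of "p t + e / 2"] elim(2) by fastforce
    ultimately show ?case using e by (auto simp: dist_real_def)
  qed
qed

lemma p_cont: "continuous_on {0<..} p"
  by (simp add: continuous_on_eq_continuous_at isCont_p)

text \<open>Nothing is assumed about the times at which \<open>U x\<close> vanishes: \<open>u x\<close> has a minimum there, so its
  derivative, which exists almost everywhere, is 0.\<close>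

lemma FTC_time:
  assumes t: "0 < t1" "t1 < t2"
    and d: "\<And>t. t \<in> {t1..t2} \<Longrightarrow> (\<phi> has_real_derivative \<phi>' t) (at t)" and c: "continuous_on {t1..t2} \<phi>'"
  shows "(LBINT t:{t1..t2}. (if 0 < U x t then k * Uxx x t * \<phi> t else 0) + u x t * \<phi>' t)
         = u x t2 * \<phi> t2 - u x t1 * \<phi> t1"
proof -
  obtain L1 where L1: "L1-lipschitz_on {t1..t2} (U x)" using lip[of t1 t2 x] t by auto
  have L1u: "L1-lipschitz_on {t1..t2} (u x)"
  proof (rule lipschitz_onI)
    fix s t assume "s \<in> {t1..t2}" "t \<in> {t1..t2}"
    from lipschitz_onD[OF L1 this] show "dist (u x s) (u x t) \<le> L1 * dist s t"
      by (auto simp: u_def dist_real_def max_def split: if_splits)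
  qed (use L1 lipschitz_on_nonneg in auto)
  obtain L2 where L2: "L2-lipschitz_on {t1..t2} \<phi>" using C1_lipschitz_on[OF d c] by blast
  have c\<phi>: "continuous_on {t1..t2} \<phi>" using L2 by (rule lipschitz_on_continuous_on)
  have cu: "continuous_on {t1..t2} (u x)" using L1u by (rule lipschitz_on_continuous_on)
  have cU: "continuous_on {t1..t2} (U x)" using L1 by (rule lipschitz_on_continuous_on)
  obtain B1 where B1: "0 \<le> B1" "\<And>s. s \<in> {t1..t2} \<Longrightarrow> \<bar>u x s\<bar> \<le> B1" using continuous_on_Icc_bounded[OF cu] by blast
  obtain B2 where B2: "0 \<le> B2" "\<And>s. s \<in> {t1..t2} \<Longrightarrow> \<bar>\<phi> s\<bar> \<le> B2" using continuous_on_Icc_bounded[OF c\<phi>] by blast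
  define g where "g t = (if 0 < U x t then k * Uxx x t * \<phi> t else 0) + u x t * \<phi>' t" for t
  have AEd: "AE t in lborel. t1 < t \<and> t < t2 \<longrightarrow> ((\<lambda>t. u x t * \<phi> t) has_real_derivative g t) (at t)"
    using eq[of x] lipschitz_on_AE_differentiable[OF L1u]
  proof eventually_elim
    case (elim t)
    show ?case
    proof
      assume tt: "t1 < t \<and> t < t2"
      then have t0: "0 < t" using t by simp
      have "(u x has_real_derivative (if 0 < U x t then k * Uxx x t else 0)) (at t)"
      proof (cases "U x t" "0::real" rule: linorder_cases)
        case greater
        have "\<forall>\<^sub>F s in nhds t. U x s > 0"
          using isCont_time[OF t0, of x] greater order_tendstoD(1) unfolding isCont_def
          by (metis eventually_nhds_conv_at)
        then have "\<forall>\<^sub>F s in nhds t. U x s = u x s" by eventually_elim (simp add: u_def)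
        moreover have "(U x has_real_derivative k * Uxx x t) (at t)" using elim(1) t0 greater by blast
        ultimately show ?thesis using greater DERIV_cong_ev[of t t "U x" "u x"] by simp
      next
        case less
        have "\<forall>\<^sub>F s in nhds t. U x s < 0"
          using isCont_time[OF t0, of x] less order_tendstoD(2) unfolding isCont_def
          by (metis eventually_nhds_conv_at)
        then have "\<forall>\<^sub>F s in nhds t. 0 = u x s" by eventually_elim (simp add: u_def)
        then show ?thesis using less DERIV_cong_ev[of t t "\<lambda>_. 0" "u x" 0] by simp
      next
        case equal
        from elim(2) tt obtain D where D: "(u x has_real_derivative D) (at t)"
          unfolding real_differentiable_def by blast
        have "D = 0"
        proof (rule DERIV_local_min[OF D zero_less_one])
          show "\<forall>y. \<bar>t - y\<bar> < 1 \<longrightarrow> u x t \<le> u x y" using equal by (simp add: u_def)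
        qed
        then show ?thesis using D equal by simp
      qed
      from DERIV_mult[OF this d[of t]] tt
      show "((\<lambda>t. u x t * \<phi> t) has_real_derivative g t) (at t)"
        by (auto simp: g_def mult_ac)
    qed
  qed
  have meas: "set_borel_measurable lborel {t1..t2} g"
  proof -
    have c1: "continuous_on {t1..t2} (\<lambda>t. k * Uxx x t * \<phi> t)"
      by (intro continuous_intros Uxx_cont_time c\<phi>) (use t in auto)
    have c2: "continuous_on {t1..t2} (\<lambda>t. u x t * \<phi>' t)" by (intro continuous_intros cu c)
    have [measurable]: "(\<lambda>t. indicator {t1..t2} t *\<^sub>R U x t) \<in> borel_measurable borel"
      "(\<lambda>t. indicator {t1..t2} t *\<^sub>R (k * Uxx x t * \<phi> t)) \<in> borel_measurable borel"
      "(\<lambda>t. indicator {t1..t2} t *\<^sub>R (u x t * \<phi>' t)) \<in> borel_measurable borel"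
      by (intro borel_measurable_continuous_on_indicator cU c1 c2; simp)+
    have "(\<lambda>t. indicator {t1..t2} t *\<^sub>R g t) =
      (\<lambda>t. (if 0 < indicator {t1..t2} t *\<^sub>R U x t then indicator {t1..t2} t *\<^sub>R (k * Uxx x t * \<phi> t) else 0)
           + indicator {t1..t2} t *\<^sub>R (u x t * \<phi>' t))"
      by (auto simp: fun_eq_iff g_def indicator_def)
    also have "\<dots> \<in> borel_measurable borel" by measurable
    finally show ?thesis by (simp add: set_borel_measurable_def)
  qed
  show ?thesis
    using lipschitz_FTC(2)[OF t(2) lipschitz_on_times_bounded[OF L1u L2 B1(2) B2(2) B1(1) B2(1)] AEd meas]
    by (simp add: g_def)
qed

text \<open>Green's second identity on \<open>{A..p t}\<close>. At \<open>p t\<close> the value of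
  \<open>U\<close> is 0, so only the flux survives; at \<open>A\<close> the test function and its
  derivative vanish. Beyond \<open>p t\<close> both integrands are 0, which allows the fixed right
  end \<open>P\<close>.\<close>

lemma FTC_space:
  assumes t: "0 < t" and A: "A \<le> p t" "p t \<le> P"
    and d: "\<And>x. x \<in> {A..P} \<Longrightarrow> (\<phi> has_real_derivative \<phi>x x) (at x)"
    and dd: "\<And>x. x \<in> {A..P} \<Longrightarrow> (\<phi>x has_real_derivative \<phi>xx x) (at x)"
    and c: "continuous_on {A..P} \<phi>xx" and bc: "\<phi> A = 0" "\<phi>x A = 0"
  shows "(LBINT x:{A..P}. (if 0 < U x t then k * Uxx x t * \<phi> x else 0))
       = k * Ux (p t) t * \<phi> (p t) + (LBINT x:{A..P}. u x t * (k * \<phi>xx x))"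
proof -
  have c\<phi>: "continuous_on {A..P} \<phi>"
    by (rule continuous_at_imp_continuous_on) (use d DERIV_isCont in blast)
  have sub: "{A..p t} \<subseteq> {A..P}" using A by auto
  have "integral\<^sup>L lborel (\<lambda>x. indicator {A..p t} x *\<^sub>R (k * Uxx x t * \<phi> x - u x t * (k * \<phi>xx x)))
     = k * (Ux (p t) t * \<phi> (p t) - U (p t) t * \<phi>x (p t)) - k * (Ux A t * \<phi> A - U A t * \<phi>x A)"
  proof (rule integral_FTC_atLeastAtMost[OF A(1)])
    fix x assume x: "A \<le> x" "x \<le> p t"
    then have xm: "x \<in> {A..P}" using A by auto
    have "((\<lambda>x. k * (Ux x t * \<phi> x - U x t * \<phi>x x)) has_real_derivative
        k * ((Uxx x t * \<phi> x + \<phi>x x * Ux x t) - (Ux x t * \<phi>x x + \<phi>xx x * U x t))) (at x)"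
      by (intro DERIV_cmult DERIV_diff DERIV_mult dx dxx t d[OF xm] dd[OF xm])
    moreover have "k * ((Uxx x t * \<phi> x + \<phi>x x * Ux x t) - (Ux x t * \<phi>x x + \<phi>xx x * U x t))
       = k * Uxx x t * \<phi> x - u x t * (k * \<phi>xx x)"
      using u_eq_U[OF t x(2)] by (simp add: algebra_simps)
    ultimately show "((\<lambda>x. k * (Ux x t * \<phi> x - U x t * \<phi>x x)) has_vector_derivative
        k * Uxx x t * \<phi> x - u x t * (k * \<phi>xx x)) (at x within {A..p t})"
      by (simp add: has_real_derivative_iff_has_vector_derivative has_vector_derivative_at_within)
  next
    show "continuous_on {A..p t} (\<lambda>x. k * Uxx x t * \<phi> x - u x t * (k * \<phi>xx x))"
      using t by (intro continuous_intros Uxx_cont_space u_cont_space continuous_on_subset[OF c\<phi> sub]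
          continuous_on_subset[OF c sub]) auto
  qed
  also have "\<dots> = k * Ux (p t) t * \<phi> (p t)" using bc zero[OF t] by simp
  finally have *: "(LBINT x. indicator {A..p t} x *\<^sub>R (k * Uxx x t * \<phi> x - u x t * (k * \<phi>xx x)))
     = k * Ux (p t) t * \<phi> (p t)" .
  have i1: "integrable lborel (\<lambda>x. indicator {A..P} x *\<^sub>R (u x t * (k * \<phi>xx x)))"
    using t by (intro borel_integrable_compact continuous_intros u_cont_space c) auto
  have i2: "integrable lborel (\<lambda>x. indicator {A..p t} x *\<^sub>R (k * Uxx x t * \<phi> x - u x t * (k * \<phi>xx x)))"
    using t by (intro borel_integrable_compact continuous_intros u_cont_space Uxx_cont_space continuous_on_subset[OF c\<phi> sub]
          continuous_on_subset[OF c sub]) auto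
  have "(LBINT x:{A..P}. (if 0 < U x t then k * Uxx x t * \<phi> x else 0))
    = (LBINT x. indicator {A..p t} x *\<^sub>R (k * Uxx x t * \<phi> x - u x t * (k * \<phi>xx x))
        + indicator {A..P} x *\<^sub>R (u x t * (k * \<phi>xx x)))"
    unfolding set_lebesgue_integral_def
  proof (rule integral_cong_AE)
    have [measurable]: "(\<lambda>x. indicator {A..P} x *\<^sub>R U x t) \<in> borel_measurable borel"
      "(\<lambda>x. indicator {A..P} x *\<^sub>R (k * Uxx x t * \<phi> x)) \<in> borel_measurable borel"
      using t by (intro borel_measurable_continuous_on_indicator cont_space continuous_intros Uxx_cont_space c\<phi>; simp)+
    have "(\<lambda>x. indicator {A..P} x *\<^sub>R (if 0 < U x t then k * Uxx x t * \<phi> x else 0)) =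
      (\<lambda>x. if 0 < indicator {A..P} x *\<^sub>R U x t then indicator {A..P} x *\<^sub>R (k * Uxx x t * \<phi> x) else 0)"
      by (auto simp: indicator_def fun_eq_iff)
    also have "\<dots> \<in> borel_measurable lborel" by measurable
    finally show "(\<lambda>x. indicator {A..P} x *\<^sub>R (if 0 < U x t then k * Uxx x t * \<phi> x else 0)) \<in> borel_measurable lborel" .
    show "(\<lambda>x. indicator {A..p t} x *\<^sub>R (k * Uxx x t * \<phi> x - u x t * (k * \<phi>xx x))
        + indicator {A..P} x *\<^sub>R (u x t * (k * \<phi>xx x))) \<in> borel_measurable lborel"
      using i1 i2 by (intro borel_measurable_add) auto
    have "AE x in lborel. x \<noteq> p t" by (rule AE_lborel_singleton)
    then show "AE x in lborel. indicator {A..P} x *\<^sub>R (if 0 < U x t then k * Uxx x t * \<phi> x else 0) =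
       indicator {A..p t} x *\<^sub>R (k * Uxx x t * \<phi> x - u x t * (k * \<phi>xx x))
        + indicator {A..P} x *\<^sub>R (u x t * (k * \<phi>xx x))"
    proof eventually_elim
      case (elim x)
      consider "x < p t" | "p t < x" using elim by linarith
      then show ?case
      proof cases
        case 1
        then show ?thesis using A U_pos_iff[OF t, of x] by (auto simp: indicator_def)
      next
        case 2
        then show ?thesis using A U_pos_iff[OF t, of x] u_eq_0[OF t, of x] by (auto simp: indicator_def)
      qed
    qed
  qed
  also have "\<dots> = k * Ux (p t) t * \<phi> (p t) + (LBINT x:{A..P}. u x t * (k * \<phi>xx x))"
    using Bochner_Integration.integral_add[OF i2 i1] * by (simp add: set_lebesgue_integral_def)
  finally show ?thesis .
qed

text \<open>Fubini on a fixed rectangle: integrating first in time yields the end values by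
  \<open>FTC_time\<close>, first in space the flux by \<open>FTC_space\<close>. The term with
  \<open>Uxx\<close> may jump across the free boundary but is dominated by a continuous function on
  the compact rectangle.\<close>

lemma weak_form:
  assumes t: "0 < t1" "t1 < t2" and AP: "\<And>t. t \<in> {t1..t2} \<Longrightarrow> A \<le> p t \<and> p t \<le> P"
    and dt: "\<And>x t. x \<in> {A..P} \<Longrightarrow> t \<in> {t1..t2} \<Longrightarrow> ((\<lambda>s. \<phi> x s) has_real_derivative \<phi>t x t) (at t)"
    and d1: "\<And>x t. x \<in> {A..P} \<Longrightarrow> t \<in> {t1..t2} \<Longrightarrow> ((\<lambda>y. \<phi> y t) has_real_derivative \<phi>x x t) (at x)"
    and d2: "\<And>x t. x \<in> {A..P} \<Longrightarrow> t \<in> {t1..t2} \<Longrightarrow> ((\<lambda>y. \<phi>x y t) has_real_derivative \<phi>xx x t) (at x)"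
    and c\<phi>: "continuous_on ({A..P} \<times> {t1..t2}) (\<lambda>(x, t). \<phi> x t)"
    and ct: "continuous_on ({A..P} \<times> {t1..t2}) (\<lambda>(x, t). \<phi>t x t)"
    and cxx: "continuous_on ({A..P} \<times> {t1..t2}) (\<lambda>(x, t). \<phi>xx x t)"
    and bc: "\<And>t. t \<in> {t1..t2} \<Longrightarrow> \<phi> A t = 0 \<and> \<phi>x A t = 0"
  shows "set_integrable lborel {t1..t2} (\<lambda>t. k * Ux (p t) t * \<phi> (p t) t)"
    and "(LBINT x:{A..P}. u x t2 * \<phi> x t2) - (LBINT x:{A..P}. u x t1 * \<phi> x t1)
      = (LBINT t:{t1..t2}. k * Ux (p t) t * \<phi> (p t) t)
        + (LBINT t:{t1..t2}. LBINT x:{A..P}. u x t * (\<phi>t x t + k * \<phi>xx x t))"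
proof -
  let ?B = "{A..P} \<times> {t1..t2}"
  have B: "compact ?B" "?B \<subseteq> UNIV \<times> {0..}" "?B \<subseteq> UNIV \<times> {0<..}" using t by (auto intro: compact_Times)
  note slice_x = continuous_on_slices(1)[where A="{A..P}" and T="{t1..t2}"]
  note slice_t = continuous_on_slices(2)[where A="{A..P}" and T="{t1..t2}"]
  have mult: "continuous_on ?B (\<lambda>(x, t). f x t * g x t)"
    if "continuous_on ?B (\<lambda>(x, t). f x t)" "continuous_on ?B (\<lambda>(x, t). g x t)" for f g :: "real \<Rightarrow> real \<Rightarrow> real"
    using continuous_on_mult[OF that] by (simp add: case_prod_beta)
  have box: "integrable (lborel \<Otimes>\<^sub>M lborel) (\<lambda>(x, t). indicator {A..P} x * (indicator {t1..t2} t * f x t))"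
    if "continuous_on ?B (\<lambda>(x, t). f x t)" for f :: "real \<Rightarrow> real \<Rightarrow> real"
  proof -
    have "integrable lborel (\<lambda>z. indicator ?B z *\<^sub>R (case z of (x, t) \<Rightarrow> f x t))"
      by (rule borel_integrable_compact[OF B(1) that])
    moreover have "(\<lambda>z. indicator ?B z *\<^sub>R (case z of (x, t) \<Rightarrow> f x t)) =
        (\<lambda>(x, t). indicator {A..P} x * (indicator {t1..t2} t * f x t))"
      by (auto simp: fun_eq_iff indicator_def)
    ultimately show ?thesis by (simp add: lborel_prod)
  qed
  have cu: "continuous_on ?B (\<lambda>(x, t). u x t)" by (rule continuous_on_subset[OF u_cont B(2)])
  have cU: "continuous_on ?B (\<lambda>(x, t). U x t)" by (rule continuous_on_subset[OF cont B(2)])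
  have ck: "continuous_on ?B (\<lambda>(x, t). k)" by simp
  have ckUxx: "continuous_on ?B (\<lambda>(x, t). k * Uxx x t * \<phi> x t)"
    by (intro mult ck c\<phi> continuous_on_subset[OF Uxx_cont B(3)])
  define f1 where "f1 x t = (if 0 < U x t then k * Uxx x t * \<phi> x t else 0)" for x t
  define G where "G f x t = indicator {A..P} x * (indicator {t1..t2} t * f x t)" for f :: "real \<Rightarrow> real \<Rightarrow> real" and x t :: real
  define f2 where "f2 x t = u x t * \<phi>t x t" for x t
  define f3 where "f3 x t = u x t * (k * \<phi>xx x t)" for x t
  have I2: "integrable (lborel \<Otimes>\<^sub>M lborel) (\<lambda>(x, t). G f2 x t)"
    unfolding G_def f2_def by (intro box mult cu ct)
  have I3: "integrable (lborel \<Otimes>\<^sub>M lborel) (\<lambda>(x, t). G f3 x t)"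
    unfolding G_def f3_def by (intro box mult cu cxx ck)
  have I1: "integrable (lborel \<Otimes>\<^sub>M lborel) (\<lambda>(x, t). G f1 x t)"
  proof (rule Bochner_Integration.integrable_bound[OF box[OF ckUxx]])
    have m1: "(\<lambda>(x, t). indicator {A..P} x * (indicator {t1..t2} t * U x t)) \<in> borel_measurable (lborel \<Otimes>\<^sub>M lborel)"
      using box[OF cU] by auto
    have m2: "(\<lambda>(x, t). indicator {A..P} x * (indicator {t1..t2} t * (k * Uxx x t * \<phi> x t))) \<in> borel_measurable (lborel \<Otimes>\<^sub>M lborel)"
      using box[OF ckUxx] by auto
    have "(\<lambda>z. if 0 < (\<lambda>(x, t). indicator {A..P} x * (indicator {t1..t2} t * U x t)) z
         then (\<lambda>(x, t). indicator {A..P} x * (indicator {t1..t2} t * (k * Uxx x t * \<phi> x t))) z else 0)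
         \<in> borel_measurable (lborel \<Otimes>\<^sub>M lborel)"
      using m1 m2 by measurable
    also have "(\<lambda>z. if 0 < (\<lambda>(x, t). indicator {A..P} x * (indicator {t1..t2} t * U x t)) z
         then (\<lambda>(x, t). indicator {A..P} x * (indicator {t1..t2} t * (k * Uxx x t * \<phi> x t))) z else 0) =
         (\<lambda>(x, t). G f1 x t)"
      by (auto simp: fun_eq_iff G_def f1_def indicator_def)
    finally show "(\<lambda>(x, t). G f1 x t) \<in> borel_measurable (lborel \<Otimes>\<^sub>M lborel)" .
    show "AE z in lborel \<Otimes>\<^sub>M lborel. norm (case z of (x, t) \<Rightarrow> G f1 x t) \<le>
        norm (case z of (x, t) \<Rightarrow> indicator {A..P} x * (indicator {t1..t2} t * (k * Uxx x t * \<phi> x t)))"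
      by (intro AE_I2) (auto simp: G_def f1_def)
  qed
  have I12: "integrable (lborel \<Otimes>\<^sub>M lborel) (\<lambda>(x, t). G f1 x t + G f2 x t)"
    using Bochner_Integration.integrable_add[OF I1 I2] by (simp add: case_prod_unfold)
  define \<Lambda> where "\<Lambda> t = indicator {t1..t2} t * (k * Ux (p t) t * \<phi> (p t) t)" for t
  have space: "(LBINT x. G f1 x t) = \<Lambda> t + (LBINT x. G f3 x t)" for t
  proof (cases "t \<in> {t1..t2}")
    case True
    then have "0 < t" using t by simp
    from FTC_space[OF this, of A P "\<lambda>x. \<phi> x t" "\<lambda>x. \<phi>x x t" "\<lambda>x. \<phi>xx x t"]
    show ?thesis using True AP[OF True] d1[OF _ True] d2[OF _ True] slice_x[OF cxx True] bc[OF True]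
      by (simp add: G_def f1_def f3_def \<Lambda>_def set_lebesgue_integral_def)
  qed (simp add: G_def \<Lambda>_def)
  have int1: "integrable lborel (\<lambda>t. LBINT x. G f1 x t)" by (rule lborel_pair.integrable_snd[OF I1])
  have int3: "integrable lborel (\<lambda>t. LBINT x. G f3 x t)" by (rule lborel_pair.integrable_snd[OF I3])
  have int2: "integrable lborel (\<lambda>t. LBINT x. G f2 x t)" by (rule lborel_pair.integrable_snd[OF I2])
  \<comment> \<open>The flux appears as a difference of two integrable functions of time, so its
    measurability needs no separate argument.\<close>
  have "integrable lborel (\<lambda>t. (LBINT x. G f1 x t) - (LBINT x. G f3 x t))"
    by (rule Bochner_Integration.integrable_diff[OF int1 int3])
  then have int\<Lambda>: "integrable lborel \<Lambda>" by (simp add: space)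
  then show "set_integrable lborel {t1..t2} (\<lambda>t. k * Ux (p t) t * \<phi> (p t) t)"
    by (simp add: set_integrable_def \<Lambda>_def[abs_def])
  have inner: "(LBINT x. G f2 x t) + (LBINT x. G f3 x t)
      = indicator {t1..t2} t * (LBINT x:{A..P}. u x t * (\<phi>t x t + k * \<phi>xx x t))" for t
  proof (cases "t \<in> {t1..t2}")
    case True
    then have t0: "0 \<le> t" using t by simp
    have i2: "integrable lborel (\<lambda>x. indicator {A..P} x *\<^sub>R f2 x t)"
      unfolding f2_def by (intro borel_integrable_compact continuous_intros u_cont_space t0 slice_x[OF ct True]) simp
    have i3: "integrable lborel (\<lambda>x. indicator {A..P} x *\<^sub>R f3 x t)"
      unfolding f3_def by (intro borel_integrable_compact continuous_intros u_cont_space t0 slice_x[OF cxx True]) simp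
    have e: "(\<lambda>x. indicator {A..P} x *\<^sub>R (u x t * (\<phi>t x t + k * \<phi>xx x t)))
        = (\<lambda>x. indicator {A..P} x *\<^sub>R f2 x t + indicator {A..P} x *\<^sub>R f3 x t)"
      by (auto simp: fun_eq_iff f2_def f3_def algebra_simps)
    show ?thesis using True Bochner_Integration.integral_add[OF i2 i3]
      unfolding set_lebesgue_integral_def e by (simp add: G_def)
  qed (simp add: G_def)
  have "(LBINT x. (LBINT t. G f1 x t + G f2 x t)) = (LBINT t. (LBINT x. G f1 x t + G f2 x t))"
    by (rule lborel_pair.Fubini_integral[symmetric, OF I12])
  also have "\<dots> = (LBINT t. (LBINT x. G f1 x t) + (LBINT x. G f2 x t))"
  proof (rule integral_cong_AE)
    show "(\<lambda>t. LBINT x. G f1 x t + G f2 x t) \<in> borel_measurable lborel"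
      using lborel_pair.integrable_snd[OF I12] by simp
    show "(\<lambda>t. (LBINT x. G f1 x t) + (LBINT x. G f2 x t)) \<in> borel_measurable lborel"
      using int1 int2 by simp
    show "AE t in lborel. (LBINT x. G f1 x t + G f2 x t) = (LBINT x. G f1 x t) + (LBINT x. G f2 x t)"
      using lborel_pair.AE_integrable_snd[OF I1] lborel_pair.AE_integrable_snd[OF I2]
      by eventually_elim (rule Bochner_Integration.integral_add)
  qed
  also have "\<dots> = (LBINT t. \<Lambda> t + ((LBINT x. G f2 x t) + (LBINT x. G f3 x t)))"
    by (simp add: space algebra_simps)
  also have "\<dots> = (LBINT t. \<Lambda> t) + (LBINT t. (LBINT x. G f2 x t) + (LBINT x. G f3 x t))"
    by (intro Bochner_Integration.integral_add int\<Lambda> Bochner_Integration.integrable_add int2 int3)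
  also have "\<dots> = (LBINT t:{t1..t2}. k * Ux (p t) t * \<phi> (p t) t)
        + (LBINT t:{t1..t2}. LBINT x:{A..P}. u x t * (\<phi>t x t + k * \<phi>xx x t))"
    by (simp add: inner \<Lambda>_def set_lebesgue_integral_def)
  finally have main: "(LBINT x. (LBINT t. G f1 x t + G f2 x t)) = \<dots>" .
  have time: "(LBINT t. G f1 x t + G f2 x t)
      = indicator {A..P} x * (u x t2 * \<phi> x t2) - indicator {A..P} x * (u x t1 * \<phi> x t1)" for x
  proof (cases "x \<in> {A..P}")
    case True
    have "(LBINT t:{t1..t2}. (if 0 < U x t then k * Uxx x t * \<phi> x t else 0) + u x t * \<phi>t x t)
         = u x t2 * \<phi> x t2 - u x t1 * \<phi> x t1"
      by (rule FTC_time[OF t dt[OF True] slice_t[OF ct True]])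
    then show ?thesis using True
      by (simp add: G_def f1_def f2_def set_lebesgue_integral_def distrib_left)
  qed (simp add: G_def)
  have ends: "integrable lborel (\<lambda>x. indicator {A..P} x * (u x s * \<phi> x s))" if "s \<in> {t1..t2}" for s
    using borel_integrable_compact[of "{A..P}" "\<lambda>x. u x s * \<phi> x s"] slice_x[OF mult[OF cu c\<phi>] that] by simp
  have "(LBINT x. (LBINT t. G f1 x t + G f2 x t)) =
     (LBINT x:{A..P}. u x t2 * \<phi> x t2) - (LBINT x:{A..P}. u x t1 * \<phi> x t1)"
    unfolding time set_lebesgue_integral_def using ends[of t1] ends[of t2] t
    by (simp add: Bochner_Integration.integral_diff)
  with main show "(LBINT x:{A..P}. u x t2 * \<phi> x t2) - (LBINT x:{A..P}. u x t1 * \<phi> x t1)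
      = (LBINT t:{t1..t2}. k * Ux (p t) t * \<phi> (p t) t)
        + (LBINT t:{t1..t2}. LBINT x:{A..P}. u x t * (\<phi>t x t + k * \<phi>xx x t))" by simp
qed

text \<open>The factor \<open>(1 + x / R)\<^sup>2\<close> and its derivative vanish at \<open>x = - R\<close>, and \<^term>\<open>u x t\<close> vanishes
  to the right of \<^term>\<open>p t\<close>; so no compactly supported cutoff is needed.\<close>

lemma heat_weak_form:
  fixes t1 t2 T R P x0 :: real
  assumes t: "0 < t1" "t1 < t2" "t2 < T" and R: "0 < R" and P: "\<And>t. t \<in> {t1..t2} \<Longrightarrow> - R \<le> p t \<and> p t \<le> P"
  defines "\<phi> \<equiv> \<lambda>x t. (1 + x / R)\<^sup>2 * heat (k * (T - t)) (x0 - x)"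
  shows "set_integrable lborel {t1..t2} (\<lambda>t. k * Ux (p t) t * \<phi> (p t) t)"
    and "(LBINT x:{-R..P}. u x t2 * \<phi> x t2) - (LBINT x:{-R..P}. u x t1 * \<phi> x t1)
      = (LBINT t:{t1..t2}. k * Ux (p t) t * \<phi> (p t) t)
        + (LBINT t:{t1..t2}. LBINT x:{-R..P}. u x t *
            (k * (2 / R\<^sup>2 * heat (k * (T - t)) (x0 - x)
              + 4 / R * (1 + x / R) * ((x0 - x) / (2 * (k * (T - t))) * heat (k * (T - t)) (x0 - x)))))"
proof -
  define h where "h x t = heat (k * (T - t)) (x0 - x)" for x t
  define h1 where "h1 x t = (x0 - x) / (2 * (k * (T - t))) * heat (k * (T - t)) (x0 - x)" for x t
  define h2 where "h2 x t = ((x0 - x)\<^sup>2 / (4 * (k * (T - t))\<^sup>2) - 1 / (2 * (k * (T - t)))) * heat (k * (T - t)) (x0 - x)" for x t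
  define \<phi>t where "\<phi>t x t = (1 + x / R)\<^sup>2 * (- (k * h2 x t))" for x t
  define \<phi>x where "\<phi>x x t = (1 + x / R)\<^sup>2 * h1 x t + 2 / R * (1 + x / R) * h x t" for x t
  define \<phi>xx where "\<phi>xx x t = ((1 + x / R)\<^sup>2 * h2 x t + 2 / R * (1 + x / R) * h1 x t)
      + (2 / R * (1 + x / R) * h1 x t + 2 / R * (1 / R) * h x t)" for x t
  have \<phi>: "\<phi> x t = (1 + x / R)\<^sup>2 * h x t" for x t by (simp add: \<phi>_def h_def)
  have c: "0 < k * (T - t)" if "t \<in> {t1..t2}" for t using that t k_pos by simp
  have r1: "((\<lambda>x. 1 + x / R) has_real_derivative 1 / R) (at x)" for x
    using R by (auto intro!: derivative_eq_intros)
  have r2: "((\<lambda>x. (1 + x / R)\<^sup>2) has_real_derivative 2 / R * (1 + x / R)) (at x)" for x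
    using DERIV_power[OF r1, of 2 x] by (simp add: mult_ac)
  have r3: "((\<lambda>x. 2 / R * (1 + x / R)) has_real_derivative 2 / R * (1 / R)) (at x)" for x
    by (rule DERIV_cmult[OF r1])
  have hx: "((\<lambda>x. h x t) has_real_derivative h1 x t) (at x)"
    "((\<lambda>x. h1 x t) has_real_derivative h2 x t) (at x)" if "t \<in> {t1..t2}" for x t
    unfolding h_def h1_def h2_def using heat_space_derivatives[OF c[OF that], of x0 x] by simp_all
  have ht: "((\<lambda>t. h x t) has_real_derivative - (k * h2 x t)) (at t)" if "t \<in> {t1..t2}" for x t
    unfolding h_def h2_def using heat_backward_time_derivative[OF k_pos, of t T "x0 - x"] that t by simp
  have dt: "((\<lambda>s. \<phi> x s) has_real_derivative \<phi>t x t) (at t)" if "t \<in> {t1..t2}" for x t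
    unfolding \<phi> \<phi>t_def by (rule DERIV_cmult[OF ht[OF that]])
  have d1: "((\<lambda>y. \<phi> y t) has_real_derivative \<phi>x x t) (at x)" if "t \<in> {t1..t2}" for x t
    unfolding \<phi> \<phi>x_def by (rule DERIV_mult'[OF r2 hx(1)[OF that]])
  have d2: "((\<lambda>y. \<phi>x y t) has_real_derivative \<phi>xx x t) (at x)" if "t \<in> {t1..t2}" for x t
    unfolding \<phi>x_def \<phi>xx_def
    by (intro DERIV_add DERIV_mult'[OF r2 hx(2)[OF that]] DERIV_mult'[OF r3 hx(1)[OF that]])
  let ?B = "{-R..P} \<times> {t1..t2}"
  have cB: "0 < k * (T - snd z)" "k * (T - snd z) \<noteq> 0" if "z \<in> ?B" for z using c[of "snd z"] that by auto
  have ch: "continuous_on ?B (\<lambda>z. h (fst z) (snd z))"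
    unfolding h_def by (intro continuous_intros cB)
  have ch1: "continuous_on ?B (\<lambda>z. h1 (fst z) (snd z))"
    unfolding h1_def by (intro continuous_intros cB) (use cB in auto)
  have ch2: "continuous_on ?B (\<lambda>z. h2 (fst z) (snd z))"
    unfolding h2_def by (intro continuous_intros cB) (use cB in auto)
  have c1: "continuous_on ?B (\<lambda>(x, t). \<phi> x t)"
    unfolding \<phi> case_prod_unfold using R by (intro continuous_intros ch) auto
  have c2: "continuous_on ?B (\<lambda>(x, t). \<phi>t x t)"
    unfolding \<phi>t_def case_prod_unfold using R by (intro continuous_intros ch2) auto
  have c3: "continuous_on ?B (\<lambda>(x, t). \<phi>xx x t)"
    unfolding \<phi>xx_def case_prod_unfold using R by (intro continuous_intros ch ch1 ch2) auto
  have bc: "\<phi> (- R) t = 0 \<and> \<phi>x (- R) t = 0" for t using R by (simp add: \<phi> \<phi>x_def)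
  note W = weak_form[OF t(1,2) P dt d1 d2 c1 c2 c3 bc]
  show "set_integrable lborel {t1..t2} (\<lambda>t. k * Ux (p t) t * \<phi> (p t) t)" using W(1) by simp
  \<comment> \<open>The terms with both derivatives on the kernel cancel by the backward heat
    equation; each remaining term carries a derivative of the cutoff and hence a factor 1 /
    R.\<close>
  have "\<phi>t x t + k * \<phi>xx x t = k * (2 / R\<^sup>2 * h x t + 4 / R * (1 + x / R) * h1 x t)" for x t
    by (simp add: \<phi>t_def \<phi>xx_def algebra_simps power2_eq_square)
  with W(2) show "(LBINT x:{-R..P}. u x t2 * \<phi> x t2) - (LBINT x:{-R..P}. u x t1 * \<phi> x t1)
      = (LBINT t:{t1..t2}. k * Ux (p t) t * \<phi> (p t) t)
        + (LBINT t:{t1..t2}. LBINT x:{-R..P}. u x t *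
            (k * (2 / R\<^sup>2 * heat (k * (T - t)) (x0 - x)
              + 4 / R * (1 + x / R) * ((x0 - x) / (2 * (k * (T - t))) * heat (k * (T - t)) (x0 - x)))))"
    by (simp add: h_def h1_def)
qed

lemma p_bounded_on:
  assumes "0 < t1"
  obtains P where "0 \<le> P" "\<And>t. t \<in> {t1..t2} \<Longrightarrow> \<bar>p t\<bar> \<le> P"
proof -
  have "continuous_on {t1..t2} p" by (rule continuous_on_subset[OF p_cont]) (use assms in auto)
  from continuous_on_Icc_bounded[OF this] that show ?thesis by blast
qed

definition "rate s = - k * Ux (p s) s"

lemma rate_nonneg: assumes "0 < s" shows "0 \<le> rate s"
proof (rule ccontr)
  assume "\<not> 0 \<le> rate s"
  then have "0 < k * Ux (p s) s" by (simp add: rate_def)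
  then have "0 < Ux (p s) s" using k_pos by (simp add: zero_less_mult_iff)
  from DERIV_pos_inc_right[OF dx[OF assms] this] obtain d where d: "0 < d"
    "\<And>h. 0 < h \<Longrightarrow> h < d \<Longrightarrow> U (p s) s < U (p s + h) s" by blast
  have "U (p s) s < U (p s + d / 2) s" using d by simp
  then show False using zero[OF assms] right[OF assms, of "p s + d / 2"] d(1) by simp
qed

text \<open>The weak form gives integrability of the flux times a test function; along the curve
  that function is continuous and nowhere 0 on a compact interval, so it can be divided out.\<close>

lemma rate_integrable_Icc:
  assumes t: "0 < t1" "t1 < t2" shows "set_integrable lborel {t1..t2} rate"
proof -
  obtain P where P: "0 \<le> P" "\<And>t. t \<in> {t1..t2} \<Longrightarrow> \<bar>p t\<bar> \<le> P" using p_bounded_on[OF t(1)] by blast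
  \<comment> \<open>A horizon one unit beyond \<open>t2\<close> keeps the kernel regular, and the
    cutoff radius \<open>P + 1\<close> exceeds every \<open>|p s|\<close>, so that
    \<open>\<psi>\<close> does not vanish.\<close>
  define T where "T = t2 + 1"
  define \<psi> where "\<psi> s = (1 + p s / (P + 1))\<^sup>2 * heat (k * (T - s)) (0 - p s)" for s
  have b: "- (P + 1) \<le> p s \<and> p s \<le> P" if "s \<in> {t1..t2}" for s using P(2)[OF that] by auto
  have "set_integrable lborel {t1..t2} (\<lambda>s. k * Ux (p s) s * \<psi> s)"
    unfolding \<psi>_def by (rule heat_weak_form(1)[OF t]) (use b P in \<open>auto simp: T_def\<close>)
  moreover have "continuous_on {t1..t2} (\<lambda>s. - 1 / \<psi> s)"
  proof -
    have "continuous_on {t1..t2} p" by (rule continuous_on_subset[OF p_cont]) (use t in auto)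
    moreover have "\<psi> s \<noteq> 0" if "s \<in> {t1..t2}" for s
    proof -
      have "\<bar>p s\<bar> \<le> P" by (rule P(2)[OF that])
      then have "0 < P + 1 + p s" by linarith
      then have "1 + p s / (P + 1) \<noteq> 0" using P(1) by (simp add: field_simps)
      moreover have "0 < heat (k * (T - s)) (0 - p s)" using that k_pos by (intro heat_pos) (simp add: T_def)
      ultimately show ?thesis by (simp add: \<psi>_def)
    qed
    ultimately show ?thesis unfolding \<psi>_def using P k_pos
      by (intro continuous_intros) (auto simp: T_def)
  qed
  ultimately have "set_integrable lborel {t1..t2} (\<lambda>s. k * Ux (p s) s * \<psi> s * (- 1 / \<psi> s))"
    by (rule set_integrable_mult_continuous)
  moreover have "k * Ux (p s) s * \<psi> s * (- 1 / \<psi> s) = rate s" if "s \<in> {t1..t2}" for s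
  proof -
    have "\<bar>p s\<bar> \<le> P" by (rule P(2)[OF that])
    then have "0 < P + 1 + p s" by linarith
    then have "1 + p s / (P + 1) \<noteq> 0" using P(1) by (simp add: field_simps)
    moreover have "0 < heat (k * (T - s)) (0 - p s)" using that k_pos by (intro heat_pos) (simp add: T_def)
    ultimately have "\<psi> s \<noteq> 0" by (simp add: \<psi>_def)
    then show ?thesis by (simp add: rate_def)
  qed
  ultimately show ?thesis
    by (subst (asm) set_integrable_cong[OF refl refl]) auto
qed

lemma u_heat_integrable:
  assumes "0 \<le> t" "0 < c" shows "integrable lborel (\<lambda>x. u x t * heat c (x0 - x))"
proof -
  obtain M where M: "0 \<le> M" "\<And>x s. 0 \<le> s \<Longrightarrow> s \<le> t \<Longrightarrow> u x s \<le> M" using u_bounded[of t] by blast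
  show ?thesis
  proof (rule Bochner_Integration.integrable_bound[OF integrable_mult_right[OF integrable_heat_shift[OF assms(2)], of M x0]])
    have "(\<lambda>x. u x t) \<in> borel_measurable borel"
      by (rule borel_measurable_continuous_onI[OF u_cont_space[OF assms(1)]])
    then show "(\<lambda>x. u x t * heat c (x0 - x)) \<in> borel_measurable lborel" by measurable
    show "AE x in lborel. norm (u x t * heat c (x0 - x)) \<le> norm (M * heat c (x0 - x))"
      using M(2)[of t] assms M(1) heat_nonneg[OF assms(2)]
      by (intro AE_I2) (auto simp: abs_mult intro!: mult_right_mono)
  qed
qed

lemma cutoff_limit:
  assumes t: "0 < t" and P: "0 \<le> P" "p t \<le> P" and c: "0 < c"
  shows "(\<lambda>n. LBINT x:{-(P + 1 + real n)..P}. u x t * ((1 + x / (P + 1 + real n))\<^sup>2 * heat c (x0 - x)))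
    \<longlonglongrightarrow> (LBINT x. u x t * heat c (x0 - x))"
proof -
  obtain M where M: "0 \<le> M" "\<And>x s. 0 \<le> s \<Longrightarrow> s \<le> t \<Longrightarrow> u x s \<le> M" using u_bounded[of t] by blast
  have uM: "u x t \<le> M" for x using M(2)[of t x] t by simp
  let ?R = "\<lambda>n. P + 1 + real n"
  have R: "filterlim ?R at_top sequentially" by real_asymp
  have um: "(\<lambda>x. u x t) \<in> borel_measurable borel"
    using t by (intro borel_measurable_continuous_onI u_cont_space) simp
  show ?thesis unfolding set_lebesgue_integral_def
  \<comment> \<open>Where the indicator is 1, the cutoff base \<open>1 + x / R\<close> is at most 2
    in modulus because \<open>P\<close> is below the radius; hence the factor 4.\<close>
  proof (rule integral_dominated_convergence[where w="\<lambda>x. M * 4 * heat c (x0 - x)"])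
    show "(\<lambda>x. u x t * heat c (x0 - x)) \<in> borel_measurable lborel" using um by measurable
    show "(\<lambda>x. indicator {- ?R n..P} x *\<^sub>R (u x t * ((1 + x / ?R n)\<^sup>2 * heat c (x0 - x)))) \<in> borel_measurable lborel" for n
      using um by measurable
    show "integrable lborel (\<lambda>x. M * 4 * heat c (x0 - x))" by (intro integrable_mult_right integrable_heat_shift c)
    show "AE x in lborel. (\<lambda>n. indicator {- ?R n..P} x *\<^sub>R (u x t * ((1 + x / ?R n)\<^sup>2 * heat c (x0 - x))))
        \<longlonglongrightarrow> u x t * heat c (x0 - x)"
    proof (rule AE_I2)
      fix x
      show "(\<lambda>n. indicator {- ?R n..P} x *\<^sub>R (u x t * ((1 + x / ?R n)\<^sup>2 * heat c (x0 - x)))) \<longlonglongrightarrow> u x t * heat c (x0 - x)"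
      proof (cases "x \<le> P")
        case True
        have "(\<lambda>n. x / ?R n) \<longlonglongrightarrow> 0" by (rule real_tendsto_divide_at_top[OF tendsto_const R])
        then have "(\<lambda>n. u x t * ((1 + x / ?R n)\<^sup>2 * heat c (x0 - x))) \<longlonglongrightarrow> u x t * ((1 + 0)\<^sup>2 * heat c (x0 - x))"
          by (intro tendsto_intros)
        then have lim: "(\<lambda>n. u x t * ((1 + x / ?R n)\<^sup>2 * heat c (x0 - x))) \<longlonglongrightarrow> u x t * heat c (x0 - x)"
          by simp
        have "\<forall>\<^sub>F n in sequentially. u x t * ((1 + x / ?R n)\<^sup>2 * heat c (x0 - x)) =
            indicator {- ?R n..P} x *\<^sub>R (u x t * ((1 + x / ?R n)\<^sup>2 * heat c (x0 - x)))"
          using filterlim_at_top_dense[THEN iffD1, OF R, rule_format, of "- x"]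
          by eventually_elim (use True in \<open>auto simp: indicator_def\<close>)
        then show ?thesis by (rule Lim_transform_eventually[OF lim])
      next
        case False
        then have "u x t = 0" using u_eq_0[OF t] P by simp
        then show ?thesis by simp
      qed
    qed
    show "AE x in lborel. norm (indicator {- ?R n..P} x *\<^sub>R (u x t * ((1 + x / ?R n)\<^sup>2 * heat c (x0 - x)))) \<le> M * 4 * heat c (x0 - x)" for n
    proof (rule AE_I2)
      fix x
      show "norm (indicator {- ?R n..P} x *\<^sub>R (u x t * ((1 + x / ?R n)\<^sup>2 * heat c (x0 - x)))) \<le> M * 4 * heat c (x0 - x)"
      proof (cases "x \<in> {- ?R n..P}")
        case True
        have "0 < ?R n" using P by simp
        then have "\<bar>1 + x / ?R n\<bar> \<le> 2" using True P by (simp add: abs_le_iff field_simps)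
        then have "(1 + x / ?R n)\<^sup>2 \<le> 2\<^sup>2" by (intro power2_le_iff_abs_le[THEN iffD2]) auto
        then have "u x t * ((1 + x / ?R n)\<^sup>2 * heat c (x0 - x)) \<le> M * (4 * heat c (x0 - x))"
          using uM M(1) heat_nonneg[OF c] by (intro mult_mono) auto
        then show ?thesis using True heat_nonneg[OF c] by (simp add: abs_mult)
      qed (use M heat_nonneg[OF c] in simp)
    qed
  qed
qed

lemma heat_continuous_along_p:
  assumes "0 < t1" "t2 < T" shows "continuous_on {t1..t2} (\<lambda>s. heat (k * (T - s)) (x0 - p s))"
proof -
  have "continuous_on {t1..t2} p" by (rule continuous_on_subset[OF p_cont]) (use assms in auto)
  then show ?thesis using k_pos assms by (intro continuous_intros) auto
qed

lemma rate_heat_integrable_Icc: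
  assumes "0 < t1" "t1 < t2" "t2 < T"
  shows "set_integrable lborel {t1..t2} (\<lambda>s. rate s * heat (k * (T - s)) (x0 - p s))"
  by (rule set_integrable_mult_continuous[OF rate_integrable_Icc heat_continuous_along_p])
     (use assms in auto)

text \<open>The cutoff radius tends to infinity. Every error term has at least one factor 1 / R, and
  the unbounded factor \<open>x0 - x\<close> from the derivative of the kernel is controlled by the
  first absolute moment.\<close>

lemma heat_identity_Icc:
  assumes t: "0 < t1" "t1 < t2" "t2 < T"
  shows "(LBINT x. u x t2 * heat (k * (T - t2)) (x0 - x))
       = (LBINT x. u x t1 * heat (k * (T - t1)) (x0 - x))
         - (LBINT s:{t1..t2}. rate s * heat (k * (T - s)) (x0 - p s))"
proof -
  obtain P where P: "0 \<le> P" "\<And>t. t \<in> {t1..t2} \<Longrightarrow> \<bar>p t\<bar> \<le> P" using p_bounded_on[OF t(1)] by blast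
  obtain M where M: "0 \<le> M" "\<And>x s. 0 \<le> s \<Longrightarrow> s \<le> t2 \<Longrightarrow> u x s \<le> M" using u_bounded[of t2] by blast
  let ?R = "\<lambda>n. P + 1 + real n"
  have R: "filterlim ?R at_top sequentially" by real_asymp
  have R1: "1 \<le> ?R n" for n using P by simp
  define \<phi> where "\<phi> n x t = (1 + x / ?R n)\<^sup>2 * heat (k * (T - t)) (x0 - x)" for n x t
  define err where "err n t x = u x t * (k * (2 / (?R n)\<^sup>2 * heat (k * (T - t)) (x0 - x)
              + 4 / ?R n * (1 + x / ?R n) * ((x0 - x) / (2 * (k * (T - t))) * heat (k * (T - t)) (x0 - x))))" for n t x
  have id: "(LBINT x:{-?R n..P}. u x t2 * \<phi> n x t2) - (LBINT x:{-?R n..P}. u x t1 * \<phi> n x t1)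
      = (LBINT t:{t1..t2}. k * Ux (p t) t * \<phi> n (p t) t)
        + (LBINT t:{t1..t2}. LBINT x:{-?R n..P}. err n t x)" for n
    unfolding \<phi>_def err_def
  proof (rule heat_weak_form(2)[OF t])
    show "0 < ?R n" using P by simp
    fix t assume "t \<in> {t1..t2}"
    from P(2)[OF this] show "- ?R n \<le> p t \<and> p t \<le> P" by auto
  qed
  have l: "(\<lambda>n. LBINT x:{-?R n..P}. u x t * \<phi> n x t) \<longlonglongrightarrow> (LBINT x. u x t * heat (k * (T - t)) (x0 - x))"
    if "t \<in> {t1..t2}" for t
    unfolding \<phi>_def using that t k_pos P by (intro cutoff_limit) (auto intro: order_trans[OF abs_ge_self])
  have lrate: "(\<lambda>n. LBINT t:{t1..t2}. k * Ux (p t) t * \<phi> n (p t) t) \<longlonglongrightarrow>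
      (LBINT s:{t1..t2}. - (rate s * heat (k * (T - s)) (x0 - p s)))"
    unfolding set_lebesgue_integral_def
  proof (rule integral_dominated_convergence[where w="\<lambda>s. 4 * norm (indicator {t1..t2} s *\<^sub>R (rate s * heat (k * (T - s)) (x0 - p s)))"])
    have I: "integrable lborel (\<lambda>s. indicator {t1..t2} s *\<^sub>R (rate s * heat (k * (T - s)) (x0 - p s)))"
      using rate_heat_integrable_Icc[OF t] by (simp add: set_integrable_def)
    then show "integrable lborel (\<lambda>s. 4 * norm (indicator {t1..t2} s *\<^sub>R (rate s * heat (k * (T - s)) (x0 - p s))))"
      by (intro integrable_mult_right integrable_norm)
    show "(\<lambda>s. indicator {t1..t2} s *\<^sub>R - (rate s * heat (k * (T - s)) (x0 - p s))) \<in> borel_measurable lborel"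
      using borel_measurable_uminus[OF borel_measurable_integrable[OF I]] by simp
    show "(\<lambda>s. indicator {t1..t2} s *\<^sub>R (k * Ux (p s) s * \<phi> n (p s) s)) \<in> borel_measurable lborel" for n
    proof -
      have "set_integrable lborel {t1..t2} (\<lambda>t. k * Ux (p t) t * \<phi> n (p t) t)"
        unfolding \<phi>_def
      proof (rule heat_weak_form(1)[OF t])
        show "0 < ?R n" using P by simp
        fix t assume "t \<in> {t1..t2}"
        from P(2)[OF this] show "- ?R n \<le> p t \<and> p t \<le> P" by auto
      qed
      then show ?thesis unfolding set_integrable_def by (rule borel_measurable_integrable)
    qed
    show "AE s in lborel. (\<lambda>n. indicator {t1..t2} s *\<^sub>R (k * Ux (p s) s * \<phi> n (p s) s)) \<longlonglongrightarrow>
        indicator {t1..t2} s *\<^sub>R - (rate s * heat (k * (T - s)) (x0 - p s))"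
    proof (rule AE_I2)
      fix s
      have "(\<lambda>n. p s / ?R n) \<longlonglongrightarrow> 0" by (rule real_tendsto_divide_at_top[OF tendsto_const R])
      then have "(\<lambda>n. indicator {t1..t2} s *\<^sub>R (k * Ux (p s) s * \<phi> n (p s) s)) \<longlonglongrightarrow>
          indicator {t1..t2} s *\<^sub>R (k * Ux (p s) s * ((1 + 0)\<^sup>2 * heat (k * (T - s)) (x0 - p s)))"
        unfolding \<phi>_def by (intro tendsto_intros)
      then show "(\<lambda>n. indicator {t1..t2} s *\<^sub>R (k * Ux (p s) s * \<phi> n (p s) s)) \<longlonglongrightarrow>
        indicator {t1..t2} s *\<^sub>R - (rate s * heat (k * (T - s)) (x0 - p s))" by (simp add: rate_def)
    qed
    show "AE s in lborel. norm (indicator {t1..t2} s *\<^sub>R (k * Ux (p s) s * \<phi> n (p s) s)) \<le>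
        4 * norm (indicator {t1..t2} s *\<^sub>R (rate s * heat (k * (T - s)) (x0 - p s)))" for n
    proof (rule AE_I2)
      fix s
      show "norm (indicator {t1..t2} s *\<^sub>R (k * Ux (p s) s * \<phi> n (p s) s)) \<le>
        4 * norm (indicator {t1..t2} s *\<^sub>R (rate s * heat (k * (T - s)) (x0 - p s)))"
      proof (cases "s \<in> {t1..t2}")
        case True
        have "0 < ?R n" using P by simp
        then have "\<bar>1 + p s / ?R n\<bar> \<le> 2" using P(2)[OF True] by (simp add: abs_le_iff field_simps)
        then have sq: "(1 + p s / ?R n)\<^sup>2 \<le> 2\<^sup>2" by (intro power2_le_iff_abs_le[THEN iffD2]) auto
        have "\<bar>k * Ux (p s) s * \<phi> n (p s) s\<bar> = (1 + p s / ?R n)\<^sup>2 * \<bar>rate s * heat (k * (T - s)) (x0 - p s)\<bar>"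
          by (simp add: \<phi>_def rate_def abs_mult)
        also have "\<dots> \<le> 4 * \<bar>rate s * heat (k * (T - s)) (x0 - p s)\<bar>" using sq by (intro mult_right_mono) auto
        finally show ?thesis using True by simp
      qed simp
    qed
  qed
  \<comment> \<open>Worst case over the time interval: the moment in the numerator is largest at
    \<open>t1\<close>, the denominator smallest at \<open>t2\<close>.\<close>
  define \<kappa> where "\<kappa> = sqrt (2 * (k * (T - t1))) * sqrt (2 / pi) / (2 * (k * (T - t2)))"
  define K where "K = M * k * (2 + 8 * \<kappa>)"
  have \<kappa>: "0 \<le> \<kappa>" using t k_pos by (simp add: \<kappa>_def)
  have inner: "\<bar>LBINT x:{-?R n..P}. err n t x\<bar> \<le> K / ?R n" if tt: "t \<in> {t1..t2}" for n t
  proof -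
    define c where "c = k * (T - t)"
    have c: "0 < c" "k * (T - t2) \<le> c" "c \<le> k * (T - t1)" using tt t k_pos by (auto simp: c_def)
    have c2: "0 < k * (T - t2)" using t k_pos by simp
    define w where "w x = M * k / ?R n * (2 * heat c (x0 - x) + 4 / c * (\<bar>x0 - x\<bar> * heat c (x0 - x)))" for x
    have wi: "integrable lborel w" unfolding w_def
      by (intro integrable_mult_right Bochner_Integration.integrable_add integrable_heat_shift integrable_abs_heat_shift c)
    have e: "norm (indicator {-?R n..P} x *\<^sub>R err n t x) \<le> w x" for x
    proof (cases "x \<in> {-?R n..P}")
      case True
      have R0: "0 < ?R n" using P by simp
      have r2: "\<bar>1 + x / ?R n\<bar> \<le> 2" using True P R0 by (simp add: abs_le_iff field_simps)
      have h: "0 \<le> heat c (x0 - x)" using heat_nonneg[OF c(1)] .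
      have "\<bar>2 / (?R n)\<^sup>2 * heat c (x0 - x) + 4 / ?R n * (1 + x / ?R n) * ((x0 - x) / (2 * c) * heat c (x0 - x))\<bar>
         \<le> \<bar>2 / (?R n)\<^sup>2 * heat c (x0 - x)\<bar> + \<bar>4 / ?R n * (1 + x / ?R n) * ((x0 - x) / (2 * c) * heat c (x0 - x))\<bar>"
        by (rule abs_triangle_ineq)
      also have "\<dots> = 2 / (?R n)\<^sup>2 * heat c (x0 - x) + 4 / ?R n * \<bar>1 + x / ?R n\<bar> * (\<bar>x0 - x\<bar> / (2 * c) * heat c (x0 - x))"
        by (simp only: abs_mult abs_divide abs_of_pos[OF R0] abs_of_nonneg[OF h] power_abs[symmetric])
           (use c in simp)
      also have "\<dots> \<le> 2 / ?R n * heat c (x0 - x) + 4 / ?R n * 2 * (\<bar>x0 - x\<bar> / (2 * c) * heat c (x0 - x))"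
      proof (intro add_mono mult_right_mono mult_left_mono h r2)
        have "?R n * 1 \<le> ?R n * ?R n" using R1[of n] R0 by (intro mult_left_mono) auto
        then show "2 / (?R n)\<^sup>2 \<le> 2 / ?R n" using R0 by (intro divide_left_mono) (auto simp: power2_eq_square)
      qed (use h R0 c in auto)
      also have "\<dots> = 1 / ?R n * (2 * heat c (x0 - x) + 4 / c * (\<bar>x0 - x\<bar> * heat c (x0 - x)))"
      proof -
        have gen: "2 / r * h + 4 / r * 2 * (y / (2 * c) * h) = 1 / r * (2 * h + 4 / c * (y * h))" if "r \<noteq> 0" for r h y :: real
          using c(1) that by (simp add: field_simps)
        show ?thesis by (rule gen[OF less_imp_neq[OF R0, symmetric]])
      qed
      finally have b: "\<bar>2 / (?R n)\<^sup>2 * heat c (x0 - x) + 4 / ?R n * (1 + x / ?R n) * ((x0 - x) / (2 * c) * heat c (x0 - x))\<bar>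
         \<le> 1 / ?R n * (2 * heat c (x0 - x) + 4 / c * (\<bar>x0 - x\<bar> * heat c (x0 - x)))" .
      have uM: "u x t \<le> M" using M(2)[of t x] tt t by simp
      have "\<bar>err n t x\<bar> = u x t * (k * \<bar>2 / (?R n)\<^sup>2 * heat c (x0 - x) + 4 / ?R n * (1 + x / ?R n) * ((x0 - x) / (2 * c) * heat c (x0 - x))\<bar>)"
        using k_pos unfolding err_def c_def[symmetric] abs_mult by simp
      also have "\<dots> \<le> M * (k * (1 / ?R n * (2 * heat c (x0 - x) + 4 / c * (\<bar>x0 - x\<bar> * heat c (x0 - x)))))"
        using uM b k_pos M by (intro mult_mono mult_left_mono) auto
      also have "\<dots> = w x" by (simp add: w_def)
      finally show ?thesis using True by simp
    next
      case False
      then show ?thesis using M k_pos P c heat_nonneg[OF c(1)] by (simp add: w_def)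
    qed
    have "\<bar>LBINT x:{-?R n..P}. err n t x\<bar> \<le> (LBINT x. norm (indicator {-?R n..P} x *\<^sub>R err n t x))"
      unfolding set_lebesgue_integral_def real_norm_def[symmetric] by (rule integral_norm_bound)
    also have "\<dots> \<le> integral\<^sup>L lborel w"
      by (rule integral_mono'[OF wi]) (use e order_trans[OF norm_ge_zero e] in auto)
    also have "integral\<^sup>L lborel w = M * k / ?R n * (2 + 8 * (sqrt (2 * c) * sqrt (2 / pi) / (2 * c)))"
      unfolding w_def using c
      by (subst integral_mult_right_zero, subst Bochner_Integration.integral_add)
         (auto simp: integral_heat_shift integral_abs_heat_shift intro!: integrable_mult_right integrable_heat_shift integrable_abs_heat_shift)
    also have "\<dots> \<le> M * k / ?R n * (2 + 8 * \<kappa>)"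
    proof (intro mult_left_mono add_left_mono)
      show "sqrt (2 * c) * sqrt (2 / pi) / (2 * c) \<le> \<kappa>"
        unfolding \<kappa>_def using c c2 by (intro frac_le mult_right_mono) auto
    qed (use M k_pos P in auto)
    finally show ?thesis by (simp add: K_def)
  qed
  have K: "0 \<le> K" using M k_pos \<kappa> by (simp add: K_def)
  have lerr: "(\<lambda>n. LBINT t:{t1..t2}. LBINT x:{-?R n..P}. err n t x) \<longlonglongrightarrow> 0"
  proof (rule Lim_null_comparison)
    show "(\<lambda>n. (t2 - t1) * K / ?R n) \<longlonglongrightarrow> 0" by (rule real_tendsto_divide_at_top[OF tendsto_const R])
    show "\<forall>\<^sub>F n in sequentially. norm (LBINT t:{t1..t2}. LBINT x:{-?R n..P}. err n t x) \<le> (t2 - t1) * K / ?R n"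
    proof (rule always_eventually, rule allI)
      fix n
      have i: "integrable lborel (\<lambda>t. indicator {t1..t2} t *\<^sub>R (K / ?R n))"
        by (intro integrable_scaleR_left integrable_real_indicator) (auto simp: emeasure_lborel_Icc_eq)
      have "norm (LBINT t:{t1..t2}. LBINT x:{-?R n..P}. err n t x)
         \<le> (LBINT t. norm (indicator {t1..t2} t *\<^sub>R (LBINT x:{-?R n..P}. err n t x)))"
        unfolding set_lebesgue_integral_def[of _ "{t1..t2}"] by (rule integral_norm_bound)
      also have "\<dots> \<le> (LBINT t. indicator {t1..t2} t *\<^sub>R (K / ?R n))"
        by (rule integral_mono'[OF i]) (use inner K P in \<open>auto simp: indicator_def\<close>)
      also have "\<dots> = (t2 - t1) * K / ?R n" using t by simp
      finally show "norm (LBINT t:{t1..t2}. LBINT x:{-?R n..P}. err n t x) \<le> (t2 - t1) * K / ?R n" .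
    qed
  qed
  have "(\<lambda>n. (LBINT x:{-?R n..P}. u x t2 * \<phi> n x t2) - (LBINT x:{-?R n..P}. u x t1 * \<phi> n x t1))
     \<longlonglongrightarrow> (LBINT x. u x t2 * heat (k * (T - t2)) (x0 - x)) - (LBINT x. u x t1 * heat (k * (T - t1)) (x0 - x))"
    using t by (intro tendsto_diff l) auto
  moreover have "(\<lambda>n. (LBINT x:{-?R n..P}. u x t2 * \<phi> n x t2) - (LBINT x:{-?R n..P}. u x t1 * \<phi> n x t1))
     \<longlonglongrightarrow> (LBINT s:{t1..t2}. - (rate s * heat (k * (T - s)) (x0 - p s))) + 0"
    unfolding id by (intro tendsto_add lrate lerr)
  ultimately have "(LBINT x. u x t2 * heat (k * (T - t2)) (x0 - x)) - (LBINT x. u x t1 * heat (k * (T - t1)) (x0 - x))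
     = (LBINT s:{t1..t2}. - (rate s * heat (k * (T - s)) (x0 - p s))) + 0" by (rule LIMSEQ_unique)
  then show ?thesis by (simp add: set_lebesgue_integral_def)
qed

end

section \<open>Extension of the heat identity down to time 0\<close>

lemma gauss_mono: "0 < c \<Longrightarrow> c \<le> d \<Longrightarrow> gauss c y \<le> gauss d y"
  unfolding gauss_def by (simp add: frac_le)

lemma integrable_gauss_shift: "0 < c \<Longrightarrow> integrable lborel (\<lambda>x. gauss c (x0 - x))"
  using lborel_integrable_real_affine[OF integrable_gauss, of c "-1" x0] by simp

context half_problem
begin

text \<open>Continuity of \<open>u\<close> up to time 0 gives pointwise convergence along times
  \<open>t / (n + 2)\<close>, which stay strictly between 0 and \<open>t\<close>; the majorant
  divides the widest Gaussian by the smallest normalisation.\<close>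

lemma initial_limit:
  assumes t: "0 < t" "t < T"
  shows "(\<lambda>n. LBINT x. u x (t / (real n + 2)) * heat (k * (T - t / (real n + 2))) (x0 - x))
     \<longlonglongrightarrow> (LBINT x. u x 0 * heat (k * T) (x0 - x))"
proof -
  define \<tau> where "\<tau> n = t / (real n + 2)" for n
  have \<tau>: "0 < \<tau> n" "\<tau> n < t" for n
    using t mult_strict_left_mono[of 1 "real n + 2" t] by (auto simp: \<tau>_def pos_divide_less_eq)
  have l\<tau>: "\<tau> \<longlonglongrightarrow> 0" unfolding \<tau>_def by real_asymp
  obtain M where M: "0 \<le> M" "\<And>x s. 0 \<le> s \<Longrightarrow> s \<le> t \<Longrightarrow> u x s \<le> M" using u_bounded[of t] by blast
  have c: "0 < k * (T - t)" "0 < k * T" using t k_pos by auto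
  have um: "(\<lambda>x. u x s) \<in> borel_measurable borel" if "0 \<le> s" for s
    by (intro borel_measurable_continuous_onI u_cont_space that)
  have "(\<lambda>n. LBINT x. u x (\<tau> n) * heat (k * (T - \<tau> n)) (x0 - x))
     \<longlonglongrightarrow> (LBINT x. u x 0 * heat (k * T) (x0 - x))"
  proof (rule integral_dominated_convergence[where w="\<lambda>x. M / sqrt (4 * pi * (k * (T - t))) * gauss (k * T) (x0 - x)"])
    show "(\<lambda>x. u x 0 * heat (k * T) (x0 - x)) \<in> borel_measurable lborel"
      using um[of 0] by measurable
    show "(\<lambda>x. u x (\<tau> n) * heat (k * (T - \<tau> n)) (x0 - x)) \<in> borel_measurable lborel" for n
      using um[of "\<tau> n"] \<tau>[of n] by simp
    show "integrable lborel (\<lambda>x. M / sqrt (4 * pi * (k * (T - t))) * gauss (k * T) (x0 - x))"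
      by (intro integrable_mult_right integrable_gauss_shift c)
    show "AE x in lborel. (\<lambda>n. u x (\<tau> n) * heat (k * (T - \<tau> n)) (x0 - x)) \<longlonglongrightarrow> u x 0 * heat (k * T) (x0 - x)"
    proof (rule AE_I2)
      fix x
      have "continuous_on {0..} (u x)" unfolding u_def[abs_def] by (intro continuous_intros cont_time)
      then have 1: "(\<lambda>n. u x (\<tau> n)) \<longlonglongrightarrow> u x 0"
        by (rule continuous_on_tendsto_compose[OF _ l\<tau>]) (use \<tau>(1) in \<open>auto intro!: always_eventually less_imp_le\<close>)
      have "continuous_on {..<T} (\<lambda>s. heat (k * (T - s)) (x0 - x))"
        using k_pos by (intro continuous_intros) auto
      then have 2: "(\<lambda>n. heat (k * (T - \<tau> n)) (x0 - x)) \<longlonglongrightarrow> heat (k * (T - 0)) (x0 - x)"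
        by (rule continuous_on_tendsto_compose[OF _ l\<tau>])
           (use \<tau> t in \<open>auto intro!: always_eventually intro: less_trans\<close>)
      show "(\<lambda>n. u x (\<tau> n) * heat (k * (T - \<tau> n)) (x0 - x)) \<longlonglongrightarrow> u x 0 * heat (k * T) (x0 - x)"
        using tendsto_mult[OF 1 2] by simp
    qed
    show "AE x in lborel. norm (u x (\<tau> n) * heat (k * (T - \<tau> n)) (x0 - x))
        \<le> M / sqrt (4 * pi * (k * (T - t))) * gauss (k * T) (x0 - x)" for n
    proof (rule AE_I2)
      fix x
      have c': "0 < k * (T - \<tau> n)" "k * (T - t) \<le> k * (T - \<tau> n)" "k * (T - \<tau> n) \<le> k * T"
        using \<tau>[of n] t k_pos by auto
      have "heat (k * (T - \<tau> n)) (x0 - x) \<le> gauss (k * T) (x0 - x) / sqrt (4 * pi * (k * (T - t)))"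
        unfolding heat_def using c c' by (intro frac_le gauss_mono) auto
      moreover have "u x (\<tau> n) \<le> M" using M(2)[of "\<tau> n"] \<tau>[of n] by simp
      ultimately have "u x (\<tau> n) * heat (k * (T - \<tau> n)) (x0 - x) \<le> M * (gauss (k * T) (x0 - x) / sqrt (4 * pi * (k * (T - t))))"
        using M heat_nonneg[OF c'(1)] by (intro mult_mono) auto
      then show "norm (u x (\<tau> n) * heat (k * (T - \<tau> n)) (x0 - x))
        \<le> M / sqrt (4 * pi * (k * (T - t))) * gauss (k * T) (x0 - x)"
        using heat_nonneg[OF c'(1)] by (simp add: abs_mult)
    qed
  qed
  then show ?thesis by (simp only: \<tau>_def)
qed

text \<open>No bound on \<open>rate\<close> near time 0 is available. Since it is nonnegative,
  monotone convergence applies to the lower limits \<open>\<tau> n\<close>, and the known limit of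
  the other terms yields integrability and value together.\<close>

lemma heat_identity:
  assumes t: "0 < t" "t < T"
  shows "set_integrable lborel {0<..t} (\<lambda>s. rate s * heat (k * (T - s)) (x0 - p s))"
    and "(LBINT x. u x t * heat (k * (T - t)) (x0 - x))
       = (LBINT x. u x 0 * heat (k * T) (x0 - x))
         - (LBINT s:{0<..t}. rate s * heat (k * (T - s)) (x0 - p s))"
proof -
  define \<tau> where "\<tau> n = t / (real n + 2)" for n
  have \<tau>: "0 < \<tau> n" "\<tau> n < t" for n
    using t mult_strict_left_mono[of 1 "real n + 2" t] by (auto simp: \<tau>_def pos_divide_less_eq)
  have l\<tau>: "\<tau> \<longlonglongrightarrow> 0" unfolding \<tau>_def by real_asymp
  define f where "f s = rate s * heat (k * (T - s)) (x0 - p s)" for s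
  have f0: "0 \<le> f s" if "0 < s" "s \<le> t" for s
    unfolding f_def using that t k_pos by (intro mult_nonneg_nonneg rate_nonneg heat_nonneg) auto
  define g where "g n s = indicator {\<tau> n..t} s *\<^sub>R f s" for n s
  have gi: "integrable lborel (g n)" for n
    using rate_heat_integrable_Icc[OF \<tau>(1) \<tau>(2) t(2)] by (simp add: set_integrable_def g_def[abs_def] f_def)
  have gm: "mono (\<lambda>n. g n s)" for s
  proof (rule monoI)
    fix m n :: nat assume "m \<le> n"
    then have "\<tau> n \<le> \<tau> m" using t by (auto simp: \<tau>_def intro!: divide_left_mono)
    then show "g m s \<le> g n s" using f0[of s] \<tau>(1)[of n] by (auto simp: g_def indicator_def)
  qed
  have gl: "(\<lambda>n. g n s) \<longlonglongrightarrow> indicator {0<..t} s *\<^sub>R f s" for s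
  proof (cases "0 < s")
    case True
    have "\<forall>\<^sub>F n in sequentially. \<tau> n < s" using order_tendstoD(2)[OF l\<tau> True] .
    then have "\<forall>\<^sub>F n in sequentially. indicator {0<..t} s *\<^sub>R f s = g n s"
      by eventually_elim (use True in \<open>auto simp: g_def indicator_def\<close>)
    then show ?thesis by (rule Lim_transform_eventually[OF tendsto_const])
  next
    case False
    then have "g n s = 0" for n using \<tau>(1)[of n] by (auto simp: g_def indicator_def)
    then show ?thesis using False by simp
  qed
  have A: "(LBINT s. g n s) = (LBINT x. u x (\<tau> n) * heat (k * (T - \<tau> n)) (x0 - x))
        - (LBINT x. u x t * heat (k * (T - t)) (x0 - x))" for n
    using heat_identity_Icc[OF \<tau>(1)[of n] \<tau>(2)[of n] t(2), of x0]
    unfolding g_def f_def set_lebesgue_integral_def by linarith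
  have lim: "(\<lambda>n. LBINT s. g n s) \<longlonglongrightarrow> (LBINT x. u x 0 * heat (k * T) (x0 - x))
        - (LBINT x. u x t * heat (k * (T - t)) (x0 - x))"
    unfolding A \<tau>_def by (intro tendsto_diff initial_limit t tendsto_const)
  have meas: "(\<lambda>s. indicator {0<..t} s *\<^sub>R f s) \<in> borel_measurable lborel"
    by (rule borel_measurable_LIMSEQ_real[OF gl]) (use gi in auto)
  have "integrable lborel (\<lambda>s. indicator {0<..t} s *\<^sub>R f s)"
    by (rule integrable_monotone_convergence[OF gi _ _ lim meas]) (use gm gl in auto)
  then show "set_integrable lborel {0<..t} (\<lambda>s. rate s * heat (k * (T - s)) (x0 - p s))"
    by (simp add: set_integrable_def f_def)
  have "integral\<^sup>L lborel (\<lambda>s. indicator {0<..t} s *\<^sub>R f s) = (LBINT x. u x 0 * heat (k * T) (x0 - x))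
        - (LBINT x. u x t * heat (k * (T - t)) (x0 - x))"
    by (rule integral_monotone_convergence[OF gi _ _ lim meas]) (use gm gl in auto)
  then show "(LBINT x. u x t * heat (k * (T - t)) (x0 - x))
       = (LBINT x. u x 0 * heat (k * T) (x0 - x))
         - (LBINT s:{0<..t}. rate s * heat (k * (T - s)) (x0 - p s))"
    by (simp add: set_lebesgue_integral_def f_def)
qed

lemma rate_measurable: "set_borel_measurable lborel {0<..} rate"
proof -
  have gl: "(\<lambda>n. indicator {1 / (real n + 2)..real n + 2} s *\<^sub>R rate s) \<longlonglongrightarrow> indicator {0<..} s *\<^sub>R rate s" for s
  proof (cases "0 < s")
    case True
    have "(\<lambda>n. 1 / (real n + 2)) \<longlonglongrightarrow> 0" by real_asymp
    then have 1: "\<forall>\<^sub>F n in sequentially. 1 / (real n + 2) < s" by (rule order_tendstoD(2)[OF _ True])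
    have "filterlim (\<lambda>n. real n + 2) at_top sequentially" by real_asymp
    then have 2: "\<forall>\<^sub>F n in sequentially. s < real n + 2" by (simp only: filterlim_at_top_dense)
    from 1 2 have "\<forall>\<^sub>F n in sequentially. indicator {0<..} s *\<^sub>R rate s = indicator {1 / (real n + 2)..real n + 2} s *\<^sub>R rate s"
      by eventually_elim (use True in \<open>auto simp: indicator_def\<close>)
    then show ?thesis by (rule Lim_transform_eventually[OF tendsto_const])
  next
    case False
    have "indicator {1 / (real n + 2)..real n + 2} s = (0::real)" for n
    proof -
      have "0 < 1 / (real n + 2)" by simp
      then have "\<not> 1 / (real n + 2) \<le> s" using False by linarith
      then show ?thesis by simp
    qed
    then show ?thesis using False by simp
  qed
  have "(\<lambda>s. indicator {1 / (real n + 2)..real n + 2} s *\<^sub>R rate s) \<in> borel_measurable lborel" for n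
  proof -
    have "1 / (real n + 2) < real n + 2" by (simp add: divide_less_eq) (simp add: add_pos_nonneg field_simps)
    from rate_integrable_Icc[OF _ this] show ?thesis
      unfolding set_integrable_def by (intro borel_measurable_integrable) auto
  qed
  then show ?thesis unfolding set_borel_measurable_def by (rule borel_measurable_LIMSEQ_real[OF gl])
qed

end

section \<open>From the price equation to two one-sided problems\<close>

lemma lipschitz_half_line_AE_derivative:
  fixes h :: "real \<Rightarrow> real"
  assumes "L-lipschitz_on {0..} h"
  shows "AE t in lborel. 0 < t \<longrightarrow> (h has_real_derivative deriv h t) (at t)"
proof -
  have "L-lipschitz_on {0..real n} h" for n
    by (rule lipschitz_on_subset[OF assms]) auto
  from lipschitz_on_AE_differentiable[OF this]
  have "AE t in lborel. \<forall>n::nat. 0 < t \<and> t < real n \<longrightarrow> h differentiable (at t)"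
    unfolding AE_all_countable by blast
  then show ?thesis
  proof eventually_elim
    case (elim t)
    obtain n :: nat where "t < real n" using reals_Archimedean2 by blast
    then show ?case using elim unfolding DERIV_deriv_iff_real_differentiable by blast
  qed
qed

text \<open>\<open>exp (- bl t)\<close> is an integrating factor: where \<open>F\<close> is
  positive, the term with \<open>br\<close> vanishes and that with \<open>deriv bl\<close> is
  cancelled. The product rule uses that \<open>deriv bl\<close> is the true derivative at almost
  every time, by Lebesgue's theorem.\<close>

lemma half_problem_price:
  assumes k: "0 < k" and sol: "price_solution k bl br FI F" and fb: "free_boundary F p"
    and lip: "L-lipschitz_on {0..} bl"
  obtains Ux Uxx where "half_problem k (\<lambda>x t. exp (- bl t) * F x t) Ux Uxx p"
    and "\<And>t. 0 < t \<Longrightarrow> - k * Ux (p t) t = exp (- bl t) * transaction_rate k F p t"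
proof -
  obtain Fx Fxx where Fxx_cont: "continuous_on (UNIV \<times> {0<..}) (\<lambda>(x, t). Fxx x t)"
    and d: "\<forall>x. \<forall>t>0. ((\<lambda>y. F y t) has_real_derivative Fx x t) (at x) \<and>
                  ((\<lambda>y. Fx y t) has_real_derivative Fxx x t) (at x)"
    and eq: "\<forall>x. AE t in lebesgue. t > 0 \<longrightarrow>
           (F x has_real_derivative
              k * Fxx x t + deriv bl t * pos_part (F x t) - deriv br t * neg_part (F x t)) (at t)"
    using sol unfolding price_solution_def by blast
  have cont: "continuous_on (UNIV \<times> {0..}) (\<lambda>(x, t). F x t)"
    and bdd: "\<forall>T. bounded ((\<lambda>(x, t). F x t) ` (UNIV \<times> {0..T}))"
    and Flip: "\<forall>x S T. 0 < S \<longrightarrow> S \<le> T \<longrightarrow> (\<exists>L. L-lipschitz_on {S..T} (F x))"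
    using sol unfolding price_solution_def by blast+
  define e where "e t = exp (- bl t)" for t
  have bl_cont: "continuous_on {0..} bl" by (rule lipschitz_on_continuous_on[OF lip])
  have e_cont: "continuous_on {0..} e" unfolding e_def by (intro continuous_intros bl_cont)
  have e_cont': "continuous_on (UNIV \<times> A) (\<lambda>z. e (snd z))" if "A \<subseteq> {0..}" for A :: "real set"
    using that by (intro continuous_on_compose2[OF e_cont]) (auto intro!: continuous_intros)
  have e_lip: "\<exists>K. K-lipschitz_on {S..T} e" if "0 < S" for S T
  proof -
    have "continuous_on {S..T} bl" by (rule continuous_on_subset[OF bl_cont]) (use that in auto)
    then obtain B where B: "\<And>t. t \<in> {S..T} \<Longrightarrow> \<bar>bl t\<bar> \<le> B" using continuous_on_Icc_bounded by metis
    have "L-lipschitz_on {S..T} (\<lambda>t. - bl t)"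
      using lipschitz_on_subset[OF lip, of "{S..T}"] that by (auto intro!: lipschitz_intros)
    moreover obtain K where "K-lipschitz_on {-B..B} (exp :: real \<Rightarrow> real)"
      by (rule C1_lipschitz_on[of "-B" B exp exp]) (auto intro!: continuous_intros)
    moreover have "(\<lambda>t. - bl t) ` {S..T} \<subseteq> {-B..B}" using B by (auto simp: abs_le_iff)
    ultimately have "(K * L)-lipschitz_on {S..T} (\<lambda>t. exp (- bl t))"
      by (intro lipschitz_on_compose2[of L _ "\<lambda>t. - bl t" K exp]) (auto intro: lipschitz_on_subset)
    then show ?thesis unfolding e_def by blast
  qed
  have hp: "half_problem k (\<lambda>x t. e t * F x t) (\<lambda>x t. e t * Fx x t) (\<lambda>x t. e t * Fxx x t) p"
  proof
    show "0 < k" by fact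
    show "continuous_on (UNIV \<times> {0..}) (\<lambda>(x, t). e t * F x t)"
      using continuous_on_mult[OF e_cont'[of "{0..}"] cont] by (simp add: case_prod_unfold)
    show "bounded ((\<lambda>(x, t). e t * F x t) ` (UNIV \<times> {0..T}))" for T
    proof -
      obtain B where B: "0 \<le> B" "\<And>t. t \<in> {0..T} \<Longrightarrow> \<bar>e t\<bar> \<le> B"
        using continuous_on_Icc_bounded[OF continuous_on_subset[OF e_cont], of 0 T] by auto
      obtain M where M: "\<And>z. z \<in> UNIV \<times> {0..T} \<Longrightarrow> norm (case z of (x, t) \<Rightarrow> F x t) \<le> M"
        using bdd[rule_format, of T] unfolding bounded_iff by auto
      show ?thesis unfolding bounded_iff
      proof (intro exI[of _ "B * M"] ballI)
        fix y assume "y \<in> (\<lambda>(x, t). e t * F x t) ` (UNIV \<times> {0..T})"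
        then obtain x t where y: "y = e t * F x t" "t \<in> {0..T}" by auto
        then have "\<bar>F x t\<bar> \<le> M" using M[of "(x, t)"] by simp
        then show "norm y \<le> B * M" using B(2)[OF y(2)] B(1) by (simp add: y(1) abs_mult mult_mono)
      qed
    qed
    show "\<exists>L. L-lipschitz_on {S..T} (\<lambda>t. e t * F x t)" if ST: "0 < S" "S \<le> T" for x S T
    proof -
      obtain K where K: "K-lipschitz_on {S..T} e" using e_lip[OF ST(1)] by blast
      obtain L' where L': "L'-lipschitz_on {S..T} (F x)" using Flip ST by blast
      obtain B where B: "0 \<le> B" "\<And>t. t \<in> {S..T} \<Longrightarrow> \<bar>e t\<bar> \<le> B"
        using continuous_on_Icc_bounded[OF lipschitz_on_continuous_on[OF K]] by blast
      obtain D where D: "0 \<le> D" "\<And>t. t \<in> {S..T} \<Longrightarrow> \<bar>F x t\<bar> \<le> D"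
        using continuous_on_Icc_bounded[OF lipschitz_on_continuous_on[OF L']] by blast
      show ?thesis using lipschitz_on_times_bounded[OF K L' B(2) D(2) B(1) D(1)] by blast
    qed
    show "continuous_on (UNIV \<times> {0<..}) (\<lambda>(x, t). e t * Fxx x t)"
      using continuous_on_mult[OF e_cont'[of "{0<..}"] Fxx_cont] by (simp add: case_prod_unfold subset_iff)
    show "((\<lambda>y. e t * F y t) has_real_derivative e t * Fx x t) (at x)"
      "((\<lambda>y. e t * Fx y t) has_real_derivative e t * Fxx x t) (at x)" if "0 < t" for x t
      using d that by (auto intro!: DERIV_cmult)
    show "AE t in lborel. 0 < t \<and> 0 < e t * F x t \<longrightarrow>
        ((\<lambda>t. e t * F x t) has_real_derivative k * (e t * Fxx x t)) (at t)" for x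
      using eq[rule_format, of x, unfolded AE_completion_iff] lipschitz_half_line_AE_derivative[OF lip]
    proof eventually_elim
      case (elim t)
      show ?case
      proof
        assume t: "0 < t \<and> 0 < e t * F x t"
        then have pos: "0 < F x t" by (simp add: e_def zero_less_mult_iff)
        have 1: "(F x has_real_derivative k * Fxx x t + deriv bl t * F x t) (at t)"
          using elim(1) t pos by (simp add: pos_part_def neg_part_def)
        have "(bl has_real_derivative deriv bl t) (at t)" using elim(2) t by blast
        then have 2: "(e has_real_derivative e t * (- deriv bl t)) (at t)"
          unfolding e_def[abs_def] by (auto intro!: derivative_eq_intros)
        show "((\<lambda>t. e t * F x t) has_real_derivative k * (e t * Fxx x t)) (at t)"
          using DERIV_mult[OF 2 1] by (simp add: algebra_simps)
      qed
    qed
    show "e t * F (p t) t = 0" if "0 < t" for t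
      using fb that by (simp add: free_boundary_def)
    show "0 < e t * F x t" if "0 < t" "x < p t" for x t
      using fb that by (simp add: free_boundary_def e_def)
    show "e t * F x t < 0" if "0 < t" "p t < x" for x t
      using fb that by (simp add: free_boundary_def e_def mult_less_0_iff)
  qed
  show ?thesis
  proof (rule that[OF hp[unfolded e_def]])
    fix t :: real assume "0 < t"
    then have "deriv (\<lambda>x. F x t) (p t) = Fx (p t) t" using d by (intro DERIV_imp_deriv) blast
    then show "- k * (exp (- bl t) * Fx (p t) t) = exp (- bl t) * transaction_rate k F p t"
      by (simp add: transaction_rate_def)
  qed
qed

text \<open>\<open>P\<close> may fail to be measurable, so the substitution is applied to a Borel
  null set containing the exceptional points.\<close>

lemma AE_lborel_affine:
  fixes P :: "real \<Rightarrow> bool"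
  assumes "AE x in lborel. P x" "c \<noteq> 0" shows "AE x in lborel. P (t + c * x)"
proof -
  obtain N where N: "{x. \<not> P x} \<subseteq> N" "N \<in> null_sets lborel"
    using assms by (auto simp: eventually_ae_filter)
  have Ns: "N \<in> sets borel" using N(2) by auto
  have "AE x in lborel. x \<notin> N" using N(2) by (rule AE_not_in)
  then have "AE x in lborel. t + c * x \<notin> N"
    by (intro AE_borel_affine) (use Ns assms in auto)
  then show ?thesis by eventually_elim (use N(1) in auto)
qed

text \<open>Reflection with a change of sign exchanges buyers and vendors: the positive part becomes
  the reflected negative part, and \<open>bl\<close> changes places with \<open>br\<close>. The
  right half thereby falls under the results for the left one.\<close>

lemma price_solution_reflect:
  assumes "price_solution k bl br FI F"
  shows "price_solution k br bl (\<lambda>x. - FI (- x)) (\<lambda>x t. - F (- x) t)"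
proof -
  obtain Fx Fxx where Fxx_cont: "continuous_on (UNIV \<times> {0<..}) (\<lambda>(x, t). Fxx x t)"
    and d: "\<forall>x. \<forall>t>0. ((\<lambda>y. F y t) has_real_derivative Fx x t) (at x) \<and>
                  ((\<lambda>y. Fx y t) has_real_derivative Fxx x t) (at x)"
    and eq: "\<forall>x. AE t in lebesgue. t > 0 \<longrightarrow>
           (F x has_real_derivative
              k * Fxx x t + deriv bl t * pos_part (F x t) - deriv br t * neg_part (F x t)) (at t)"
    using assms unfolding price_solution_def by blast
  have cont: "continuous_on (UNIV \<times> {0..}) (\<lambda>(x, t). F x t)"
    and bdd: "\<forall>T. bounded ((\<lambda>(x, t). F x t) ` (UNIV \<times> {0..T}))"
    and Flip: "\<forall>x S T. 0 < S \<longrightarrow> S \<le> T \<longrightarrow> (\<exists>L. L-lipschitz_on {S..T} (F x))"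
    and init: "AE x in lebesgue. F x 0 = FI x"
    using assms unfolding price_solution_def by blast+
  have refl_cont: "continuous_on (UNIV \<times> A) (\<lambda>(x, t). - f (- x) t)"
    if "continuous_on (UNIV \<times> A) (\<lambda>(x, t). f x t)" for f :: "real \<Rightarrow> real \<Rightarrow> real" and A
  proof -
    have "continuous_on (UNIV \<times> A) ((\<lambda>(x, t). f x t) \<circ> (\<lambda>z. (- fst z, snd z)))"
      by (rule continuous_on_compose[OF _ continuous_on_subset[OF that]]) (auto intro!: continuous_intros)
    then have "continuous_on (UNIV \<times> A) (\<lambda>z. f (- fst z) (snd z))" by (simp add: comp_def)
    from continuous_on_minus[OF this] show ?thesis by (simp add: case_prod_unfold)
  qed
  show ?thesis unfolding price_solution_def
  proof (intro conjI allI impI)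
    show "continuous_on (UNIV \<times> {0..}) (\<lambda>(x, t). - F (- x) t)" by (rule refl_cont[OF cont])
    show "bounded ((\<lambda>(x, t). - F (- x) t) ` (UNIV \<times> {0..T}))" for T
    proof -
      have "(\<lambda>(x, t). - F (- x) t) ` (UNIV \<times> {0..T}) \<subseteq> uminus ` ((\<lambda>(x, t). F x t) ` (UNIV \<times> {0..T}))"
        by force
      then show ?thesis using bdd bounded_uminus bounded_subset by blast
    qed
    show "AE x in lebesgue. - F (- x) 0 = - FI (- x)"
      using AE_lborel_affine[OF init[unfolded AE_completion_iff], of "- 1" 0] unfolding AE_completion_iff by simp
    show "\<exists>L. L-lipschitz_on {S..T} (\<lambda>t. - F (- x) t)" if "0 < S" "S \<le> T" for x S T
      using Flip[rule_format, OF that, of "- x"] by (simp add: lipschitz_on_minus_iff)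
    show "\<exists>Fx Fxx. continuous_on (UNIV \<times> {0<..}) (\<lambda>(x, t). Fxx x t) \<and>
       (\<forall>x. \<forall>t>0. ((\<lambda>y. - F (- y) t) has_real_derivative Fx x t) (at x) \<and>
                 ((\<lambda>y. Fx y t) has_real_derivative Fxx x t) (at x)) \<and>
       (\<forall>x. AE t in lebesgue. 0 < t \<longrightarrow> ((\<lambda>t. - F (- x) t) has_real_derivative
             k * Fxx x t + deriv br t * pos_part (- F (- x) t) - deriv bl t * neg_part (- F (- x) t)) (at t))"
    proof (intro exI conjI allI impI)
      show "continuous_on (UNIV \<times> {0<..}) (\<lambda>(x, t). - Fxx (- x) t)" by (rule refl_cont[OF Fxx_cont])
      fix x t :: real assume t: "0 < t"
      have m: "((\<lambda>y::real. - y) has_real_derivative - 1) (at x)" by (auto intro!: derivative_eq_intros)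
      have "((\<lambda>y. F y t) has_real_derivative Fx (- x) t) (at (- x))"
        "((\<lambda>y. Fx y t) has_real_derivative Fxx (- x) t) (at (- x))" using d t by auto
      from DERIV_chain2[OF this(1) m] DERIV_chain2[OF this(2) m]
      show "((\<lambda>y. - F (- y) t) has_real_derivative Fx (- x) t) (at x)"
        "((\<lambda>y. Fx (- y) t) has_real_derivative - Fxx (- x) t) (at x)"
        by (auto dest: DERIV_minus)
    next
      fix x
      from eq[rule_format, of "- x"]
      show "AE t in lebesgue. 0 < t \<longrightarrow> ((\<lambda>t. - F (- x) t) has_real_derivative
             k * - Fxx (- x) t + deriv br t * pos_part (- F (- x) t) - deriv bl t * neg_part (- F (- x) t)) (at t)"
      proof eventually_elim
        case (elim t)
        have pn: "pos_part (- F (- x) t) = neg_part (F (- x) t)" "neg_part (- F (- x) t) = pos_part (F (- x) t)"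
          by (auto simp: pos_part_def neg_part_def)
        show ?case
        proof
          assume "0 < t"
          from DERIV_minus[OF elim[rule_format, OF this]]
          show "((\<lambda>t. - F (- x) t) has_real_derivative
             k * - Fxx (- x) t + deriv br t * pos_part (- F (- x) t) - deriv bl t * neg_part (- F (- x) t)) (at t)"
            unfolding pn by (simp add: algebra_simps)
        qed
      qed
    qed
  qed
qed

lemma free_boundary_reflect:
  assumes "free_boundary F p" shows "free_boundary (\<lambda>x t. - F (- x) t) (\<lambda>t. - p t)"
  using assms unfolding free_boundary_def by auto

text \<open>The minus signs from the value and from the argument cancel, so both halves lose mass
  through the boundary at the same rate.\<close>

lemma transaction_rate_reflect:
  assumes sol: "price_solution k bl br FI F" and t: "0 < t"
  shows "transaction_rate k (\<lambda>x t. - F (- x) t) (\<lambda>t. - p t) t = transaction_rate k F p t"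
proof -
  obtain Fx where d: "\<forall>x. \<forall>t>0. ((\<lambda>y. F y t) has_real_derivative Fx x t) (at x)"
    using sol unfolding price_solution_def by blast
  have m: "((\<lambda>y::real. - y) has_real_derivative - 1) (at (- p t))" by (auto intro!: derivative_eq_intros)
  have 1: "((\<lambda>y. F y t) has_real_derivative Fx (p t) t) (at (p t))" using d t by blast
  then have "((\<lambda>y. F y t) has_real_derivative Fx (p t) t) (at (- (- p t)))" by simp
  from DERIV_minus[OF DERIV_chain2[OF this m]]
  have 2: "((\<lambda>y. - F (- y) t) has_real_derivative Fx (p t) t) (at (- p t))" by simp
  show ?thesis unfolding transaction_rate_def DERIV_imp_deriv[OF 1] DERIV_imp_deriv[OF 2] ..
qed

section \<open>Long-time asymptotics of the evolved initial value\<close>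

lemma gauss_int_increment:
  assumes c: "0 < c"
  obtains \<xi> where "\<bar>\<xi>\<bar> \<le> \<bar>u\<bar> + \<bar>v - u\<bar>" "gauss_int c v - gauss_int c u = (v - u) * gauss c \<xi>"
proof (cases u v rule: linorder_cases)
  case less
  then obtain \<xi> where "u < \<xi>" "\<xi> < v" "gauss_int c v - gauss_int c u = (v - u) * gauss c \<xi>"
    using MVT2[OF less, of "gauss_int c" "gauss c"] gauss_int_has_real_derivative c by (metis less_irrefl)
  then show ?thesis by (intro that[of \<xi>]) auto
next
  case equal then show ?thesis by (intro that[of u]) auto
next
  case greater
  then obtain \<xi> where "v < \<xi>" "\<xi> < u" "gauss_int c u - gauss_int c v = (u - v) * gauss c \<xi>"
    using MVT2[OF greater, of "gauss_int c" "gauss c"] gauss_int_has_real_derivative c by (metis less_irrefl)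
  then show ?thesis by (intro that[of \<xi>]) (auto simp: algebra_simps)
qed

lemma gauss_antimono: "0 < c \<Longrightarrow> \<bar>x\<bar> \<le> y \<Longrightarrow> gauss c y \<le> gauss c x"
proof -
  assume c: "0 < c" and xy: "\<bar>x\<bar> \<le> y"
  have "x\<^sup>2 \<le> y\<^sup>2" using xy by (intro abs_le_square_iff[THEN iffD1]) auto
  then show ?thesis using c by (simp add: gauss_def divide_right_mono)
qed

text \<open>Over the fixed distance \<open>d\<close> the Gaussian is close to 1, because
  \<open>X\<close> and \<open>d\<close> are both small against sqrt C; \<open>m\<close> is a lower
  bound for it there.\<close>

lemma gauss_int_increment_tendsto:
  assumes C1: "\<And>n. 1 \<le> C n" and C: "filterlim C at_top sequentially" and X: "(\<lambda>n. (X n)\<^sup>2 / C n) \<longlonglongrightarrow> 0"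
  shows "(\<lambda>n. gauss_int (C n) (X n + d) - gauss_int (C n) (X n)) \<longlonglongrightarrow> d"
proof -
  have Cp: "0 < C n" for n using C1[of n] by simp
  define m where "m n = gauss (C n) (\<bar>X n\<bar> + \<bar>d\<bar>)" for n
  have lm: "m \<longlonglongrightarrow> 1"
  proof -
    have "(\<lambda>n. d\<^sup>2 / C n) \<longlonglongrightarrow> 0" by (rule real_tendsto_divide_at_top[OF tendsto_const C])
    then have "(\<lambda>n. 2 * ((X n)\<^sup>2 / C n) + 2 * (d\<^sup>2 / C n)) \<longlonglongrightarrow> 2 * 0 + 2 * 0"
      by (intro tendsto_add tendsto_mult_left X)
    then have z: "(\<lambda>n. 2 * ((X n)\<^sup>2 / C n) + 2 * (d\<^sup>2 / C n)) \<longlonglongrightarrow> 0" by simp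
    have "(\<lambda>n. (\<bar>X n\<bar> + \<bar>d\<bar>)\<^sup>2 / C n) \<longlonglongrightarrow> 0"
    proof (rule tendsto_sandwich[OF _ _ tendsto_const z])
      show "\<forall>\<^sub>F n in sequentially. 0 \<le> (\<bar>X n\<bar> + \<bar>d\<bar>)\<^sup>2 / C n" using less_imp_le[OF Cp] by (auto intro!: always_eventually divide_nonneg_nonneg)
      show "\<forall>\<^sub>F n in sequentially. (\<bar>X n\<bar> + \<bar>d\<bar>)\<^sup>2 / C n \<le> 2 * ((X n)\<^sup>2 / C n) + 2 * (d\<^sup>2 / C n)"
      proof (rule always_eventually, rule allI)
        fix n
        have "0 \<le> (\<bar>X n\<bar> - \<bar>d\<bar>)\<^sup>2" by simp
        then have "(\<bar>X n\<bar> + \<bar>d\<bar>)\<^sup>2 \<le> 2 * (X n)\<^sup>2 + 2 * d\<^sup>2" by (simp add: power2_eq_square algebra_simps)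
        then have "(\<bar>X n\<bar> + \<bar>d\<bar>)\<^sup>2 / C n \<le> (2 * (X n)\<^sup>2 + 2 * d\<^sup>2) / C n" using Cp[of n] by (intro divide_right_mono) auto
        then show "(\<bar>X n\<bar> + \<bar>d\<bar>)\<^sup>2 / C n \<le> 2 * ((X n)\<^sup>2 / C n) + 2 * (d\<^sup>2 / C n)" by (simp add: add_divide_distrib)
      qed
    qed
    then have "(\<lambda>n. exp (- ((\<bar>X n\<bar> + \<bar>d\<bar>)\<^sup>2 / C n) / 4)) \<longlonglongrightarrow> exp (- 0 / 4)" by (intro tendsto_intros) auto
    then show ?thesis by (simp add: m_def[abs_def] gauss_def mult.commute)
  qed
  have "(\<lambda>n. \<bar>d\<bar> * (1 - m n)) \<longlonglongrightarrow> \<bar>d\<bar> * (1 - 1)" by (intro tendsto_intros lm)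
  then have z: "(\<lambda>n. \<bar>d\<bar> * (1 - m n)) \<longlonglongrightarrow> 0" by simp
  have "(\<lambda>n. gauss_int (C n) (X n + d) - gauss_int (C n) (X n) - d) \<longlonglongrightarrow> 0"
  proof (rule Lim_null_comparison[OF _ z], rule always_eventually, rule allI)
    fix n
    obtain \<xi> where \<xi>: "\<bar>\<xi>\<bar> \<le> \<bar>X n\<bar> + \<bar>d\<bar>" "gauss_int (C n) (X n + d) - gauss_int (C n) (X n) = d * gauss (C n) \<xi>"
      using gauss_int_increment[OF Cp[of n], of "X n" "X n + d"] by auto
    have "m n \<le> gauss (C n) \<xi>" "gauss (C n) \<xi> \<le> 1"
      unfolding m_def by (rule gauss_antimono[OF Cp \<xi>(1)], rule gauss_le_1[OF Cp])
    then have "\<bar>gauss (C n) \<xi> - 1\<bar> \<le> 1 - m n" by simp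
    then have "\<bar>d\<bar> * \<bar>gauss (C n) \<xi> - 1\<bar> \<le> \<bar>d\<bar> * (1 - m n)" by (rule mult_left_mono) simp
    moreover have "gauss_int (C n) (X n + d) - gauss_int (C n) (X n) - d = d * (gauss (C n) \<xi> - 1)"
      unfolding \<xi>(2) by (simp add: algebra_simps)
    ultimately show "norm (gauss_int (C n) (X n + d) - gauss_int (C n) (X n) - d) \<le> \<bar>d\<bar> * (1 - m n)"
      by (simp add: abs_mult)
  qed
  then show ?thesis by (simp add: LIM_zero_iff)
qed

text \<open>\<open>f\<close> models a Borel version of the positive part of the initial density, or
  of the reflected negative part. The first moment supplies the majorant for the remainder
  terms.\<close>

locale half_data =
  fixes a :: real and f :: "real \<Rightarrow> real"
  assumes a_pos: "0 < a" and f_meas [measurable]: "f \<in> borel_measurable borel"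
    and f_nonneg: "\<And>y. 0 \<le> f y" and f_zero: "\<And>y. 0 \<le> y \<Longrightarrow> f y = 0"
    and f_int: "integrable lborel f" and yf_int: "integrable lborel (\<lambda>y. y * f y)"
begin

text \<open>Almost everywhere the positive part of the initial value; see
  \<open>half_initial\<close>.\<close>

definition "per x = (\<Sum>n. f (x + real n * a))"

text \<open>Up to normalisation, the heat evolution of unit point masses at 0, \<open>- a\<close>,
  \<open>- 2 * a\<close> and so on. It arises when the translations in \<open>per\<close> are moved
  onto the kernel.\<close>

definition "theta c z = (\<Sum>n. gauss c (z + real n * a))"

lemma per_finite: "finite {n. f (x + real n * a) \<noteq> 0}"
proof -
  obtain N :: nat where N: "- x / a < real N" using reals_Archimedean2 by blast
  have "f (x + real n * a) = 0" if "N \<le> n" for n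
  proof (rule f_zero)
    have "- x / a < real n" using N that by (meson less_le_trans of_nat_le_iff)
    then have "- x < real n * a" using pos_divide_less_eq[OF a_pos, of "- x" "real n"] by blast
    then show "0 \<le> x + real n * a" by simp
  qed
  then have "{n. f (x + real n * a) \<noteq> 0} \<subseteq> {..<N}" by (auto simp: not_le[symmetric])
  then show ?thesis using finite_subset by blast
qed

lemma per_summable: "summable (\<lambda>n. f (x + real n * a))"
  by (rule summable_finite[OF per_finite]) auto

lemma per_nonneg: "0 \<le> per x"
  unfolding per_def by (rule suminf_nonneg[OF per_summable f_nonneg])

lemma f_le_per: "f x \<le> per x"
  using sum_le_suminf[OF per_summable, of "{0}" x] f_nonneg by (simp add: per_def)

lemma per_measurable [measurable]: "per \<in> borel_measurable borel"
  unfolding per_def[abs_def] by measurable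

lemma theta_measurable [measurable]: "theta c \<in> borel_measurable borel"
  unfolding theta_def[abs_def] by measurable

lemma theta_nonneg: "0 < c \<Longrightarrow> 0 \<le> theta c z"
  unfolding theta_def by (rule suminf_nonneg[OF gauss_midpoint_rule(1)]) (use a_pos in auto)

definition "K0 = 5 * a\<^sup>2 * sqrt (2 * pi) / 2"

lemma K0_nonneg: "0 \<le> K0" by (simp add: K0_def)

lemma theta_approx: "0 < c \<Longrightarrow> \<bar>a * theta c z - (sqrt (pi * c) - gauss_int c (z - a / 2))\<bar> \<le> K0 / sqrt c"
  using gauss_midpoint_rule(2)[OF _ a_pos, of c z] by (simp add: theta_def K0_def)

lemma theta_le: assumes "0 < c" shows "a * theta c z \<le> 2 * sqrt (pi * c) + K0 / sqrt c"
  using theta_approx[OF assms, of z] gauss_int_le[OF assms, of "z - a / 2"] by linarith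

lemma f_theta_integrable:
  assumes c: "0 < c" shows "integrable lborel (\<lambda>y. f y * theta c (x0 - y))"
proof (rule Bochner_Integration.integrable_bound)
  show "integrable lborel (\<lambda>y. (2 * sqrt (pi * c) + K0 / sqrt c) / a * f y)" by (intro integrable_mult_right f_int)
  show "AE y in lborel. norm (f y * theta c (x0 - y)) \<le> norm ((2 * sqrt (pi * c) + K0 / sqrt c) / a * f y)"
  proof (rule AE_I2)
    fix y
    have "theta c (x0 - y) \<le> (2 * sqrt (pi * c) + K0 / sqrt c) / a"
      using theta_le[OF c, of "x0 - y"] a_pos by (simp add: pos_le_divide_eq mult.commute)
    then have "theta c (x0 - y) * f y \<le> (2 * sqrt (pi * c) + K0 / sqrt c) / a * f y"
      using f_nonneg by (rule mult_right_mono)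
    moreover have "0 \<le> theta c (x0 - y) * f y" using theta_nonneg[OF c] f_nonneg by (intro mult_nonneg_nonneg)
    ultimately show "norm (f y * theta c (x0 - y)) \<le> norm ((2 * sqrt (pi * c) + K0 / sqrt c) / a * f y)"
      unfolding real_norm_def mult.commute[of "f y" "theta c (x0 - y)"] by linarith
  qed
qed measurable

text \<open>Tonelli: with nonnegative terms, sum and integral may be exchanged before integrability
  is known, and each translation by \<open>n * a\<close> moves from \<open>f\<close> onto the
  kernel.\<close>

lemma gauss_per_nn_integral:
  assumes c: "0 < c"
  shows "(\<integral>\<^sup>+x. ennreal (gauss c (x0 - x) * per x) \<partial>lborel) = (\<integral>\<^sup>+y. ennreal (f y * theta c (x0 - y)) \<partial>lborel)"
proof -
  have "(\<integral>\<^sup>+x. ennreal (gauss c (x0 - x) * per x) \<partial>lborel)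
      = (\<integral>\<^sup>+x. (\<Sum>n. ennreal (gauss c (x0 - x) * f (x + real n * a))) \<partial>lborel)"
  proof (rule nn_integral_cong)
    fix x
    show "ennreal (gauss c (x0 - x) * per x) = (\<Sum>n. ennreal (gauss c (x0 - x) * f (x + real n * a)))"
      unfolding per_def suminf_mult[OF per_summable, symmetric]
      by (rule suminf_ennreal2[symmetric]) (use f_nonneg in \<open>auto intro: summable_mult per_summable\<close>)
  qed
  also have "\<dots> = (\<Sum>n. \<integral>\<^sup>+x. ennreal (gauss c (x0 - x) * f (x + real n * a)) \<partial>lborel)"
    by (rule nn_integral_suminf) measurable
  also have "\<dots> = (\<Sum>n. \<integral>\<^sup>+y. ennreal (f y * gauss c (x0 - y + real n * a)) \<partial>lborel)"
  proof (rule suminf_cong)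
    fix n
    have "(\<integral>\<^sup>+x. ennreal (gauss c (x0 - x) * f (x + real n * a)) \<partial>lborel)
      = ennreal \<bar>1\<bar> * (\<integral>\<^sup>+y. ennreal (gauss c (x0 - (- (real n * a) + 1 * y)) * f (- (real n * a) + 1 * y + real n * a)) \<partial>lborel)"
      by (rule nn_integral_real_affine) auto
    then show "(\<integral>\<^sup>+x. ennreal (gauss c (x0 - x) * f (x + real n * a)) \<partial>lborel) =
        (\<integral>\<^sup>+y. ennreal (f y * gauss c (x0 - y + real n * a)) \<partial>lborel)"
      by (simp add: mult.commute algebra_simps)
  qed
  also have "\<dots> = (\<integral>\<^sup>+y. (\<Sum>n. ennreal (f y * gauss c (x0 - y + real n * a))) \<partial>lborel)"
    by (rule nn_integral_suminf[symmetric]) measurable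
  also have "\<dots> = (\<integral>\<^sup>+y. ennreal (f y * theta c (x0 - y)) \<partial>lborel)"
  proof (rule nn_integral_cong)
    fix y
    show "(\<Sum>n. ennreal (f y * gauss c (x0 - y + real n * a))) = ennreal (f y * theta c (x0 - y))"
      unfolding theta_def suminf_mult[OF gauss_midpoint_rule(1)[OF c a_pos], symmetric]
      by (rule suminf_ennreal2) (use f_nonneg in \<open>auto intro: summable_mult gauss_midpoint_rule(1)[OF c a_pos]\<close>)
  qed
  finally show ?thesis .
qed

lemma gauss_per_integral:
  assumes c: "0 < c"
  shows "(LBINT x. gauss c (x0 - x) * per x) = (LBINT y. f y * theta c (x0 - y))"
proof -
  have "(LBINT x. gauss c (x0 - x) * per x) = enn2real (\<integral>\<^sup>+x. ennreal (gauss c (x0 - x) * per x) \<partial>lborel)"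
    by (rule integral_eq_nn_integral) (use per_nonneg in auto)
  also have "\<dots> = (LBINT y. f y * theta c (x0 - y))"
    unfolding gauss_per_nn_integral[OF c]
    by (rule integral_eq_nn_integral[symmetric]) (use f_nonneg theta_nonneg[OF c] in auto)
  finally show ?thesis .
qed

definition "mass = integral\<^sup>L lborel f"

text \<open>What remains of the scaled evolution after removal of the two terms that can grow like
  sqrt c; see \<open>gauss_per_expansion\<close>.\<close>

definition "rem x0 c = (LBINT y. f y * (a * theta c (x0 - y) - sqrt (pi * c) + gauss_int c x0))"

lemma gauss_per_expansion:
  assumes c: "0 < c"
  shows "a * (LBINT x. gauss c (x0 - x) * per x) = sqrt (pi * c) * mass - mass * gauss_int c x0 + rem x0 c"
proof -
  have "rem x0 c = (LBINT y. a * (f y * theta c (x0 - y)) + (gauss_int c x0 - sqrt (pi * c)) * f y)"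
    unfolding rem_def by (simp add: algebra_simps)
  also have "\<dots> = a * (LBINT y. f y * theta c (x0 - y)) + (gauss_int c x0 - sqrt (pi * c)) * mass"
    unfolding mass_def
    by (subst Bochner_Integration.integral_add) (auto intro!: integrable_mult_right f_theta_integrable c f_int)
  finally show ?thesis unfolding gauss_per_integral[OF c] by (simp add: algebra_simps)
qed

text \<open>The midpoint rule produces \<open>gauss_int\<close> at \<open>x0 - y - a / 2\<close>; as
  its slope is at most 1, replacing this point by \<open>x0\<close> costs at most
  \<open>|y| + a / 2\<close>. The bound is uniform in \<open>x0\<close>, so it can be used before
  the growth of \<open>p\<close> is known.\<close>

lemma rem_integrand_bound:
  assumes c: "1 \<le> c"
  shows "\<bar>a * theta c (x0 - y) - sqrt (pi * c) + gauss_int c x0\<bar> \<le> \<bar>y\<bar> + (a / 2 + K0)"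
proof -
  have c0: "0 < c" using c by simp
  have "\<bar>gauss_int c x0 - gauss_int c (x0 - y - a / 2)\<bar> \<le> \<bar>x0 - (x0 - y - a / 2)\<bar>"
    by (rule gauss_int_diff_le[OF c0])
  also have "\<dots> \<le> \<bar>y\<bar> + a / 2" using a_pos by linarith
  finally have 1: "\<bar>gauss_int c x0 - gauss_int c (x0 - y - a / 2)\<bar> \<le> \<bar>y\<bar> + a / 2" .
  have "K0 / sqrt c \<le> K0 / 1" using c K0_nonneg by (intro divide_left_mono) auto
  then show ?thesis using 1 theta_approx[OF c0, of "x0 - y"] by linarith
qed

lemma abs_yf_integrable: "integrable lborel (\<lambda>y. (\<bar>y\<bar> + b) * f y)"
proof -
  have "integrable lborel (\<lambda>y. \<bar>y * f y\<bar> + b * f y)"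
    by (intro Bochner_Integration.integrable_add integrable_abs yf_int integrable_mult_right f_int)
  moreover have "(\<lambda>y. \<bar>y * f y\<bar> + b * f y) = (\<lambda>y. (\<bar>y\<bar> + b) * f y)"
    using f_nonneg by (simp add: fun_eq_iff abs_mult distrib_right)
  ultimately show ?thesis by simp
qed

lemma rem_bound:
  assumes c: "1 \<le> c" shows "\<bar>rem x0 c\<bar> \<le> (LBINT y. (\<bar>y\<bar> + (a / 2 + K0)) * f y)"
proof -
  have "\<bar>rem x0 c\<bar> \<le> (LBINT y. norm (f y * (a * theta c (x0 - y) - sqrt (pi * c) + gauss_int c x0)))"
    unfolding rem_def real_norm_def[symmetric] by (rule integral_norm_bound)
  also have "\<dots> \<le> (LBINT y. (\<bar>y\<bar> + (a / 2 + K0)) * f y)"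
  proof (rule integral_mono'[OF abs_yf_integrable])
    fix y
    show "norm (f y * (a * theta c (x0 - y) - sqrt (pi * c) + gauss_int c x0)) \<le> (\<bar>y\<bar> + (a / 2 + K0)) * f y"
      using mult_left_mono[OF rem_integrand_bound[OF c, of x0 y] f_nonneg[of y]] f_nonneg[of y]
      by (simp add: abs_mult mult.commute)
    show "0 \<le> (\<bar>y\<bar> + (a / 2 + K0)) * f y" using a_pos K0_nonneg f_nonneg by (intro mult_nonneg_nonneg) auto
  qed
  finally show ?thesis .
qed

text \<open>The midpoint error vanishes, and the shift by \<open>- y - a / 2\<close> contributes
  \<open>y + a / 2\<close> in the limit; the first moment supplies the majorant. The half cell
  leaves \<open>a / 2 * mass\<close>, which later cancels between the two sides.\<close>

lemma rem_tendsto: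
  assumes C1: "\<And>n. 1 \<le> C n" and C: "filterlim C at_top sequentially" and X: "(\<lambda>n. (X n)\<^sup>2 / C n) \<longlonglongrightarrow> 0"
  shows "(\<lambda>n. rem (X n) (C n)) \<longlonglongrightarrow> (LBINT y. y * f y) + a / 2 * mass"
proof -
  have Cp: "0 < C n" for n using C1[of n] by simp
  have "(\<lambda>n. rem (X n) (C n)) \<longlonglongrightarrow> (LBINT y. f y * (y + a / 2))"
    unfolding rem_def
  proof (rule integral_dominated_convergence[where w="\<lambda>y. (\<bar>y\<bar> + (a / 2 + K0)) * f y"])
    show "integrable lborel (\<lambda>y. (\<bar>y\<bar> + (a / 2 + K0)) * f y)" by (rule abs_yf_integrable)
    show "AE y in lborel. norm (f y * (a * theta (C n) (X n - y) - sqrt (pi * C n) + gauss_int (C n) (X n)))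
        \<le> (\<bar>y\<bar> + (a / 2 + K0)) * f y" for n
    proof (rule AE_I2)
      fix y
      show "norm (f y * (a * theta (C n) (X n - y) - sqrt (pi * C n) + gauss_int (C n) (X n))) \<le> (\<bar>y\<bar> + (a / 2 + K0)) * f y"
        using mult_left_mono[OF rem_integrand_bound[OF C1[of n], of "X n" y] f_nonneg[of y]] f_nonneg[of y]
        by (simp add: abs_mult mult.commute)
    qed
    show "AE y in lborel. (\<lambda>n. f y * (a * theta (C n) (X n - y) - sqrt (pi * C n) + gauss_int (C n) (X n)))
        \<longlonglongrightarrow> f y * (y + a / 2)"
    proof (rule AE_I2)
      fix y
      have 1: "(\<lambda>n. gauss_int (C n) (X n + (- y - a / 2)) - gauss_int (C n) (X n)) \<longlonglongrightarrow> - y - a / 2"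
        by (rule gauss_int_increment_tendsto[OF C1 C X])
      have "filterlim (\<lambda>n. sqrt (C n)) at_top sequentially" by (rule filterlim_compose[OF sqrt_at_top C])
      then have z: "(\<lambda>n. K0 / sqrt (C n)) \<longlonglongrightarrow> 0" by (rule real_tendsto_divide_at_top[OF tendsto_const])
      have 2: "(\<lambda>n. a * theta (C n) (X n - y) - (sqrt (pi * C n) - gauss_int (C n) (X n - y - a / 2))) \<longlonglongrightarrow> 0"
        by (rule Lim_null_comparison[OF _ z]) (use theta_approx[OF Cp] in auto)
      have "(\<lambda>n. f y * ((a * theta (C n) (X n - y) - (sqrt (pi * C n) - gauss_int (C n) (X n - y - a / 2)))
          - (gauss_int (C n) (X n + (- y - a / 2)) - gauss_int (C n) (X n)))) \<longlonglongrightarrow> f y * (0 - (- y - a / 2))"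
        by (intro tendsto_mult_left tendsto_diff 1 2)
      moreover have "X n + (- y - a / 2) = X n - y - a / 2" for n by simp
      ultimately show "(\<lambda>n. f y * (a * theta (C n) (X n - y) - sqrt (pi * C n) + gauss_int (C n) (X n)))
        \<longlonglongrightarrow> f y * (y + a / 2)" by (simp add: algebra_simps)
    qed
  qed measurable
  moreover have "(LBINT y. f y * (y + a / 2)) = (LBINT y. y * f y) + a / 2 * mass"
  proof -
    have "(LBINT y. f y * (y + a / 2)) = (LBINT y. y * f y + a / 2 * f y)"
      by (simp add: algebra_simps)
    also have "\<dots> = (LBINT y. y * f y) + a / 2 * mass"
      unfolding mass_def by (subst Bochner_Integration.integral_add[OF yf_int integrable_mult_right[OF f_int]]) simp
    finally show ?thesis .
  qed
  ultimately show ?thesis by simp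
qed

end

text \<open>The density is only Lebesgue measurable, while the calculations run over Borel
  functions. Almost everywhere equality survives the sum over translates, since only countably many
  null sets are involved.\<close>

lemma half_initial:
  assumes a: "0 < a" and L1: "L1_on UNIV fI" and L1x: "L1_on UNIV (\<lambda>x. x * fI x)"
    and neg: "\<forall>x<0. fI x \<ge> 0" and z: "fI 0 = 0" and pos: "\<forall>x>0. fI x \<le> 0"
  obtains f where "half_data a f"
    and "AE x in lborel. pos_part (initial_F a fI x) = half_data.per a f x"
    and "(LINT x|lebesgue. pos_part (fI x)) = half_data.mass f"
    and "(LINT x:{..<0}|lebesgue. x * pos_part (fI x)) = (LBINT y. y * f y)"
proof -
  have i1: "integrable lebesgue fI" and i2: "integrable lebesgue (\<lambda>x. x * fI x)"
    using L1 L1x by (simp_all add: L1_on_def set_integrable_def)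
  obtain f0 where f0: "f0 \<in> borel_measurable lborel" "AE x in lborel. fI x = f0 x"
    using completion_ex_borel_measurable_real[OF borel_measurable_integrable[OF i1]] by blast
  have [measurable]: "f0 \<in> borel_measurable borel" using f0(1) by simp
  define f where "f y = (if y < 0 then max (f0 y) 0 else 0)" for y
  have fm [measurable]: "f \<in> borel_measurable borel" unfolding f_def[abs_def] by measurable
  have eq: "AE x in lborel. pos_part (fI x) = f x"
    using f0(2)
  proof eventually_elim
    case (elim x)
    show ?case using elim neg z pos by (cases x "0::real" rule: linorder_cases) (auto simp: f_def pos_part_def max_def)
  qed
  have eqc: "AE x in lebesgue. pos_part (fI x) = f x" using eq by (rule AE_completion)
  have f_int: "integrable lborel f"
  proof -
    have "integrable lebesgue (\<lambda>x. pos_part (fI x))"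
      unfolding pos_part_def by (intro integrable_max i1) simp
    then have "integrable lebesgue f"
      by (rule integrable_cong_AE_imp) (use eqc in \<open>auto intro: measurable_completion\<close>)
    then show ?thesis by (subst (asm) integrable_completion) auto
  qed
  have yf_int: "integrable lborel (\<lambda>y. y * f y)"
  proof -
    have "integrable lebesgue (\<lambda>y. y * f y)"
    proof (rule Bochner_Integration.integrable_bound[OF i2])
      show "(\<lambda>y. y * f y) \<in> borel_measurable lebesgue" by (intro measurable_completion) simp
      show "AE x in lebesgue. norm (x * f x) \<le> norm (x * fI x)"
        using eqc by eventually_elim (auto simp: abs_mult pos_part_def intro!: mult_left_mono)
    qed
    then show ?thesis by (subst (asm) integrable_completion) auto
  qed
  have hd: "half_data a f"
    by unfold_locales (use a f_int yf_int in \<open>auto simp: f_def\<close>)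
  interpret half_data a f by (rule hd)
  show ?thesis
  proof (rule that[OF hd])
    have "AE x in lborel. \<forall>n::nat. pos_part (fI (real n * a + 1 * x)) = f (real n * a + 1 * x)"
      unfolding AE_all_countable by (intro allI AE_lborel_affine[OF eq]) simp
    then show "AE x in lborel. pos_part (initial_F a fI x) = per x"
    proof eventually_elim
      case (elim x)
      then have e: "pos_part (fI (x + real n * a)) = f (x + real n * a)" for n by (simp add: add.commute)
      show ?case
      proof (cases "x < 0")
        case True
        then have "initial_F a fI x = per x" by (simp add: initial_F_def e per_def)
        then show ?thesis using per_nonneg by (simp add: pos_part_def)
      next
        case False
        have "f (x + real n * a) = 0" for n using False a by (intro f_zero) simp
        then have "per x = 0" by (simp add: per_def)
        moreover have "initial_F a fI x \<le> 0"
        proof (cases "x = 0")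
          case False
          have "summable (\<lambda>n. neg_part (fI (x - real n * a)))"
          proof -
            obtain N :: nat where N: "x / a < real N" using reals_Archimedean2 by blast
            have "neg_part (fI (x - real n * a)) = 0" if "n \<notin> {..<N}" for n
            proof -
              have "x / a < real n" using N that by (meson lessThan_iff not_less less_le_trans of_nat_le_iff)
              then have "x - real n * a < 0" using a by (simp add: pos_divide_less_eq)
              then have "0 \<le> fI (x - real n * a)" using neg by blast
              then show ?thesis by (simp add: neg_part_def)
            qed
            then show ?thesis by (rule summable_finite[OF finite_lessThan])
          qed
          then have "0 \<le> (\<Sum>n. neg_part (fI (x - real n * a)))"
            by (rule suminf_nonneg) (simp add: neg_part_def)
          then show ?thesis using \<open>\<not> x < 0\<close> False by (simp add: initial_F_def)
        qed (simp add: initial_F_def)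
        ultimately show ?thesis by (simp add: pos_part_def)
      qed
    qed
    have "(LINT x|lebesgue. pos_part (fI x)) = (LINT x|lebesgue. f x)"
    proof (rule integral_cong_AE)
      show "(\<lambda>x. pos_part (fI x)) \<in> borel_measurable lebesgue" unfolding pos_part_def using i1 by measurable
      show "f \<in> borel_measurable lebesgue" by (intro measurable_completion) simp
    qed (rule eqc)
    then show "(LINT x|lebesgue. pos_part (fI x)) = mass"
      by (simp add: mass_def integral_completion)
    have "(LINT x:{..<0}|lebesgue. x * pos_part (fI x)) = (LINT x|lebesgue. x * f x)"
      unfolding set_lebesgue_integral_def
    proof (rule integral_cong_AE)
      show "(\<lambda>x. indicator {..<0} x *\<^sub>R (x * pos_part (fI x))) \<in> borel_measurable lebesgue"
        unfolding pos_part_def using borel_measurable_integrable[OF i1]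
        by (intro borel_measurable_scaleR borel_measurable_times borel_measurable_max) (auto intro: measurable_completion)
      show "(\<lambda>y. y * f y) \<in> borel_measurable lebesgue" by (intro measurable_completion) simp
      show "AE x in lebesgue. indicator {..<0} x *\<^sub>R (x * pos_part (fI x)) = x * f x"
        using eqc by eventually_elim (auto simp: indicator_def f_def)
    qed
    then show "(LINT x:{..<0}|lebesgue. x * pos_part (fI x)) = (LBINT y. y * f y)"
      by (simp add: integral_completion)
  qed
qed

section \<open>Long-time asymptotics of the free boundary\<close>

text \<open>\<open>gauss_int 1\<close> is odd, nondecreasing and positive at positive points, so
  small values force small arguments.\<close>

lemma gauss_int_tendsto_0D:
  assumes "((\<lambda>t. gauss_int 1 (z t)) \<longlongrightarrow> 0) F"
  shows "(z \<longlongrightarrow> 0) F"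
proof (rule tendstoI)
  fix e :: real assume e: "0 < e"
  obtain \<xi> where "gauss_int 1 e = e * gauss 1 \<xi>" using gauss_int_mvt[of 1 e] by auto
  then have pos: "0 < gauss_int 1 e" using e by simp
  have "\<forall>\<^sub>F t in F. \<bar>gauss_int 1 (z t)\<bar> < gauss_int 1 e"
    using tendstoD[OF assms pos] by (simp add: dist_real_def)
  then show "\<forall>\<^sub>F t in F. dist (z t) 0 < e"
  proof eventually_elim
    case (elim t)
    have "\<not> e \<le> z t" using gauss_int_mono[of 1 e "z t"] elim by auto
    moreover have "\<not> z t \<le> - e" using gauss_int_mono[of 1 "z t" "- e"] elim gauss_int_minus[of 1 e] by auto
    ultimately show ?case by (auto simp: dist_real_def)
  qed
qed

text \<open>Collects what the asymptotics require, detached from the equation.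
  \<open>v t T x0\<close> is V at time \<open>t\<close>, mollified by the kernel of parameter
  \<open>k * (T - t)\<close>; \<open>fr\<close> is the reflected right half, hence
  \<open>- x0\<close> in its term. Boundedness of \<open>p\<close> near 0 is listed separately,
  since continuity is given for positive times only.\<close>

locale rate_asymptotics = L: half_data a fl + R: half_data a fr
  for a :: real and fl fr :: "real \<Rightarrow> real" +
  fixes k linf rinf \<alpha> C Cz :: real and lam p \<zeta> :: "real \<Rightarrow> real" and v :: "real \<Rightarrow> real \<Rightarrow> real \<Rightarrow> real"
  assumes k: "0 < k" and \<alpha>: "0 < \<alpha>" and linf: "0 < linf" and rinf: "0 < rinf"
    and massl: "linf * L.mass = \<alpha> * a" and massr: "rinf * R.mass = \<alpha> * a"
    and lam_nonneg: "\<And>s. 0 < s \<Longrightarrow> 0 \<le> lam s"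
    and lam_meas: "set_borel_measurable lborel {0<..} lam"
    and \<zeta>_meas: "set_borel_measurable lborel {0<..} \<zeta>"
    and \<zeta>_bound: "\<And>s. 0 < s \<Longrightarrow> \<bar>\<zeta> s\<bar> \<le> Cz / (1 + s)"
    and lam_heat: "\<And>t T x0. 0 < t \<Longrightarrow> t < T \<Longrightarrow> set_integrable lborel {0<..t} (\<lambda>s. lam s * heat (k * (T - s)) (x0 - p s))"
    and lam_heat_le: "\<And>t T x0. 0 < t \<Longrightarrow> t < T \<Longrightarrow> (LBINT s:{0<..t}. lam s * heat (k * (T - s)) (x0 - p s)) \<le> C"
    and duhamel: "\<And>t T x0. 0 < t \<Longrightarrow> t < T \<Longrightarrow> v t T x0 =
        linf * (LBINT x. heat (k * T) (x0 - x) * L.per x)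
        - rinf * (LBINT x. heat (k * T) (- x0 - x) * R.per x)
        - (LBINT s:{0<..t}. \<zeta> s * lam s * heat (k * (T - s)) (x0 - p s))"
    and approx: "\<And>t \<eta>. 0 < t \<Longrightarrow> 0 < \<eta> \<Longrightarrow> \<exists>\<epsilon>>0. \<epsilon> \<le> 1 \<and> \<bar>v t (t + \<epsilon>) (p t)\<bar> \<le> \<eta>"
    and p_cont: "\<And>t. 0 < t \<Longrightarrow> isCont p t"
    and p_initial: "\<exists>\<delta>>0. \<exists>P. \<forall>t. 0 < t \<and> t < \<delta> \<longrightarrow> \<bar>p t\<bar> \<le> P"
begin

section \<open>Bounds for the source term\<close>

lemma Cz_nonneg: "0 \<le> Cz"
proof -
  have "0 \<le> \<bar>\<zeta> 1\<bar>" by (rule abs_ge_zero)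
  also have "\<dots> \<le> Cz / (1 + 1)" by (rule \<zeta>_bound) simp
  finally show ?thesis by simp
qed

lemma C_nonneg: "0 \<le> C"
proof -
  have "0 \<le> (LBINT s:{0<..1}. lam s * heat (k * (2 - s)) (0 - p s))"
    unfolding set_lebesgue_integral_def
  proof (rule integral_nonneg_AE, rule AE_I2)
    fix s :: real
    show "0 \<le> indicator {0<..1} s *\<^sub>R (lam s * heat (k * (2 - s)) (0 - p s))"
      using lam_nonneg[of s] heat_nonneg[of "k * (2 - s)" "0 - p s"] k by (auto simp: indicator_def)
  qed
  also have "\<dots> \<le> C" by (rule lam_heat_le) auto
  finally show ?thesis .
qed

lemma lam_heat_nonneg: "0 < s \<Longrightarrow> s < T \<Longrightarrow> 0 \<le> lam s * heat (k * (T - s)) y"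
  using lam_nonneg k by (intro mult_nonneg_nonneg heat_nonneg) auto

lemma source_meas:
  assumes "0 \<le> r" "0 < t" "t < T"
  shows "set_borel_measurable lborel {r<..t} (\<lambda>s. \<zeta> s * lam s * heat (k * (T - s)) (x0 - p s))"
proof -
  have "set_borel_measurable lborel {0<..t} (\<lambda>s. \<zeta> s * (lam s * heat (k * (T - s)) (x0 - p s)))"
    by (rule set_borel_measurable_times[OF \<zeta>_meas set_integrable_measurable[OF lam_heat[OF assms(2,3)]]]) auto
  then have "set_borel_measurable lborel {r<..t} (\<lambda>s. \<zeta> s * (lam s * heat (k * (T - s)) (x0 - p s)))"
    by (rule set_borel_measurable_mono) (use assms(1) in auto)
  then show ?thesis by (simp only: mult.assoc)
qed

text \<open>After time \<open>r\<close> the coefficient is at most \<open>Cz / (1 + r)\<close>, and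
  what remains is part of the Duhamel integral of \<lambda>, bounded by \<open>C\<close> for every
  position and horizon.\<close>

lemma source_piece:
  assumes r: "0 \<le> r" "r \<le> t" and t: "0 < t" "t < T"
  shows "set_integrable lborel {r<..t} (\<lambda>s. \<zeta> s * lam s * heat (k * (T - s)) (x0 - p s))"
    and "\<bar>LBINT s:{r<..t}. \<zeta> s * lam s * heat (k * (T - s)) (x0 - p s)\<bar>
       \<le> Cz / (1 + r) * C"
proof -
  let ?g = "\<lambda>s. lam s * heat (k * (T - s)) (x0 - p s)"
  let ?h = "\<lambda>s. \<zeta> s * lam s * heat (k * (T - s)) (x0 - p s)"
  have b: "\<bar>?h s\<bar> \<le> Cz / (1 + r) * ?g s" if "s \<in> {r<..t}" for s
  proof -
    have s: "0 < s" "s < T" "r < s" using that r t by auto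
    have "\<bar>\<zeta> s\<bar> \<le> Cz / (1 + s)" by (rule \<zeta>_bound[OF s(1)])
    also have "\<dots> \<le> Cz / (1 + r)" using s r Cz_nonneg by (intro divide_left_mono) auto
    finally have "\<bar>\<zeta> s\<bar> * ?g s \<le> Cz / (1 + r) * ?g s"
      using lam_heat_nonneg[OF s(1,2)] by (intro mult_right_mono) auto
    then show ?thesis
      using lam_heat_nonneg[OF s(1,2), of "x0 - p s"]
      unfolding mult.assoc abs_mult[of "\<zeta> s"] by (simp only: abs_of_nonneg)
  qed
  have nn: "0 \<le> ?g s" if "s \<in> {0<..t}" for s using that t by (intro lam_heat_nonneg) auto
  have sub: "{r<..t} \<subseteq> {0<..t}" and q: "0 \<le> Cz / (1 + r)" using r Cz_nonneg by auto
  note D = set_integral_dominated[OF source_meas[OF r(1) t] lam_heat[OF t] sub b q nn]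
  show "set_integrable lborel {r<..t} ?h" by (rule D(1))
  have "\<bar>LBINT s:{r<..t}. ?h s\<bar> \<le> Cz / (1 + r) * (LBINT s:{0<..t}. ?g s)" by (rule D(2))
  also have "\<dots> \<le> Cz / (1 + r) * C" by (intro mult_left_mono lam_heat_le[OF t] q)
  finally show "\<bar>LBINT s:{r<..t}. ?h s\<bar> \<le> Cz / (1 + r) * C" .
qed

lemma source_split:
  assumes r: "0 < r" "r \<le> t" and T: "t < T"
  shows "(LBINT s:{0<..t}. \<zeta> s * lam s * heat (k * (T - s)) (x0 - p s))
    = (LBINT s:{0<..r}. \<zeta> s * lam s * heat (k * (T - s)) (x0 - p s))
      + (LBINT s:{r<..t}. \<zeta> s * lam s * heat (k * (T - s)) (x0 - p s))"
proof -
  have "{0<..t} = {0<..r} \<union> {r<..t}" using r by auto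
  then show ?thesis using r T
    by (simp only:) (rule set_integral_Un, auto intro!: source_piece(1))
qed

lemma p_bounded: obtains P where "0 \<le> P" "\<And>s. 0 < s \<Longrightarrow> s \<le> t \<Longrightarrow> \<bar>p s\<bar> \<le> P"
proof -
  obtain \<delta> P1 where \<delta>: "0 < \<delta>" and P1: "\<And>s. 0 < s \<Longrightarrow> s < \<delta> \<Longrightarrow> \<bar>p s\<bar> \<le> P1" using p_initial by blast
  have "continuous_on {\<delta>..t} p" using \<delta> by (intro continuous_at_imp_continuous_on ballI p_cont) auto
  then obtain P2 where P2: "0 \<le> P2" "\<And>s. s \<in> {\<delta>..t} \<Longrightarrow> \<bar>p s\<bar> \<le> P2" using continuous_on_Icc_bounded by blast
  show ?thesis
  proof (rule that[of "max P2 P1"])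
    show "0 \<le> max P2 P1" using P2 by simp
    show "\<bar>p s\<bar> \<le> max P2 P1" if "0 < s" "s \<le> t" for s
      using P1[of s] P2(2)[of s] that by (cases "s < \<delta>") auto
  qed
qed

text \<open>Take test point 0 and horizon \<open>2 * t\<close>: up to time \<open>t\<close> the
  kernel parameter lies between \<open>k * t\<close> and \<open>2 * k * t\<close>, so along the
  boundary the kernel is at least \<open>h\<close>, and the Duhamel bound controls the mass.\<close>

lemma lam_mass:
  assumes t: "0 < t" and P: "\<And>s. 0 < s \<Longrightarrow> s \<le> t \<Longrightarrow> \<bar>p s\<bar> \<le> P"
  shows "set_integrable lborel {0<..t} lam"
    and "(LBINT s:{0<..t}. lam s) \<le> C * (sqrt (8 * pi * k * t) / gauss (k * t) P)"
proof -
  define h where "h = gauss (k * t) P / sqrt (8 * pi * k * t)"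
  have h: "0 < h" using t k by (simp add: h_def)
  let ?g = "\<lambda>s. lam s * heat (k * (2 * t - s)) (0 - p s)"
  have t2: "t < 2 * t" using t by simp
  have b: "\<bar>lam s\<bar> \<le> 1 / h * ?g s" if "s \<in> {0<..t}" for s
  proof -
    have s: "0 < s" "s \<le> t" using that by auto
    have "gauss (k * t) P \<le> gauss (k * t) (0 - p s)" using P[OF s] t k by (intro gauss_antimono) auto
    also have "\<dots> \<le> gauss (k * (2 * t - s)) (0 - p s)" using s t k by (intro gauss_mono) auto
    finally have "h \<le> heat (k * (2 * t - s)) (0 - p s)"
      unfolding h_def heat_def using s t k by (intro frac_le) auto
    from mult_left_mono[OF this lam_nonneg[OF s(1)]]
    have "h * lam s \<le> ?g s" by (simp only: mult.commute)
    then have "lam s \<le> ?g s / h" using h by (simp add: pos_le_divide_eq mult.commute)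
    then show ?thesis using lam_nonneg[OF s(1)] by simp
  qed
  have m: "set_borel_measurable lborel {0<..t} lam"
    by (rule set_borel_measurable_mono[OF lam_meas]) auto
  have nn: "0 \<le> ?g s" if "s \<in> {0<..t}" for s using that t by (intro lam_heat_nonneg) auto
  have q: "0 \<le> 1 / h" using h by simp
  note D = set_integral_dominated[OF m lam_heat[OF t t2] subset_refl b q nn]
  show "set_integrable lborel {0<..t} lam" by (rule D(1))
  have "(LBINT s:{0<..t}. lam s) \<le> \<bar>LBINT s:{0<..t}. lam s\<bar>" by (rule abs_ge_self)
  also have "\<dots> \<le> 1 / h * (LBINT s:{0<..t}. ?g s)" by (rule D(2))
  also have "\<dots> \<le> 1 / h * C" by (intro mult_left_mono lam_heat_le[OF t t2] q)
  also have "\<dots> = C * (sqrt (8 * pi * k * t) / gauss (k * t) P)" by (simp add: h_def)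
  finally show "(LBINT s:{0<..t}. lam s) \<le> C * (sqrt (8 * pi * k * t) / gauss (k * t) P)" .
qed

lemma lam_integrable: "0 < t \<Longrightarrow> set_integrable lborel {0<..t} lam"
  using p_bounded[of t] lam_mass(1)[of t] by metis

text \<open>Up to time \<open>r\<close> the kernel never exceeds its peak for the parameter
  \<open>k * (T - r)\<close>, which tends to 0 for fixed \<open>r\<close> as the horizon
  grows.\<close>

lemma source_early:
  assumes r: "0 < r" "r < T"
  shows "\<bar>LBINT s:{0<..r}. \<zeta> s * lam s * heat (k * (T - s)) (x0 - p s)\<bar>
     \<le> Cz * (LBINT s:{0<..r}. lam s) / sqrt (4 * pi * (k * (T - r)))"
proof -
  let ?h = "\<lambda>s. \<zeta> s * lam s * heat (k * (T - s)) (x0 - p s)"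
  define q where "q = Cz / sqrt (4 * pi * (k * (T - r)))"
  have q: "0 \<le> q" using Cz_nonneg r k by (simp add: q_def)
  have b: "\<bar>?h s\<bar> \<le> q * lam s" if "s \<in> {0<..r}" for s
  proof -
    have s: "0 < s" "s \<le> r" using that by auto
    have c: "0 < k * (T - s)" using s r k by simp
    have "\<bar>\<zeta> s\<bar> \<le> Cz / (1 + s)" by (rule \<zeta>_bound[OF s(1)])
    also have "\<dots> \<le> Cz / 1" using s Cz_nonneg by (intro divide_left_mono) auto
    finally have z: "\<bar>\<zeta> s\<bar> \<le> Cz" by simp
    have "heat (k * (T - s)) (x0 - p s) \<le> 1 / sqrt (4 * pi * (k * (T - s)))" by (rule heat_le[OF c])
    also have "\<dots> \<le> 1 / sqrt (4 * pi * (k * (T - r)))" using s r k by (intro divide_left_mono) auto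
    finally have "\<bar>\<zeta> s\<bar> * heat (k * (T - s)) (x0 - p s) \<le> Cz * (1 / sqrt (4 * pi * (k * (T - r))))"
      using z Cz_nonneg heat_nonneg[OF c] by (intro mult_mono) auto
    then have "\<bar>\<zeta> s\<bar> * heat (k * (T - s)) (x0 - p s) * lam s \<le> q * lam s"
      using lam_nonneg[OF s(1)] unfolding q_def by (intro mult_right_mono) auto
    then show ?thesis using lam_nonneg[OF s(1)] heat_nonneg[OF c] by (simp add: abs_mult mult_ac)
  qed
  have "\<bar>LBINT s:{0<..r}. ?h s\<bar> \<le> q * (LBINT s:{0<..r}. lam s)"
    by (rule set_integral_dominated(2)[OF source_meas[OF order_refl r] lam_integrable[OF r(1)] subset_refl b q])
       (use lam_nonneg in auto)
  then show ?thesis by (simp add: q_def)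
qed

definition "source t T x0 = (LBINT s:{0<..t}. \<zeta> s * lam s * heat (k * (T - s)) (x0 - p s))"

text \<open>Splitting at a fixed time \<open>r\<close>: the late part is uniformly small by the
  decay of \<zeta>, the early part is a fixed mass under a kernel whose peak tends to 0. The
  evaluation point is arbitrary, so no growth bound on \<open>p\<close> is presupposed.\<close>

lemma source_tendsto_0:
  assumes T: "\<And>t. t < T t"
  shows "((\<lambda>t. source t (T t) (x t)) \<longlongrightarrow> 0) at_top"
proof (rule tendstoI)
  fix e :: real assume e: "0 < e"
  \<comment> \<open>This choice makes \<open>Cz / (1 + r) * C\<close> less than
    \<open>e / 2\<close>; the added 1 keeps \<open>r\<close> positive when \<open>Cz * C\<close> is
    0.\<close>
  define r where "r = 2 * (Cz * C + 1) / e"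
  have ne: "0 < Cz * C + 1" using Cz_nonneg C_nonneg by (simp add: add_nonneg_pos)
  then have r: "0 < r" using e by (simp add: r_def)
  have "Cz / (1 + r) * C < e / 2"
  proof -
    have "Cz * C < e / 2 * r" using e by (simp add: r_def)
    also have "\<dots> < e / 2 * (1 + r)" using e by simp
    finally show ?thesis using r by (simp add: pos_divide_less_eq)
  qed
  note late = this
  define m where "m = Cz * (LBINT s:{0<..r}. lam s)"
  have "((\<lambda>t. m / sqrt (4 * pi * (k * (t - r)))) \<longlongrightarrow> 0) at_top"
    using k by real_asymp
  from tendstoD[OF this half_gt_zero[OF e]]
  have "\<forall>\<^sub>F t in at_top. \<bar>m / sqrt (4 * pi * (k * (t - r)))\<bar> < e / 2"
    by (simp only: dist_real_def diff_0_right)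
  with eventually_gt_at_top[of r]
  show "\<forall>\<^sub>F t in at_top. dist (source t (T t) (x t)) 0 < e"
  proof eventually_elim
    case (elim t)
    have t: "0 < t" "r \<le> t" "r < T t" using elim r T[of t] by auto
    have m0: "0 \<le> m" unfolding m_def set_lebesgue_integral_def using Cz_nonneg
      by (intro mult_nonneg_nonneg integral_nonneg_AE AE_I2) (auto simp: indicator_def lam_nonneg)
    have "\<bar>LBINT s:{0<..r}. \<zeta> s * lam s * heat (k * (T t - s)) (x t - p s)\<bar> \<le> m / sqrt (4 * pi * (k * (T t - r)))"
      unfolding m_def by (rule source_early[OF r t(3)])
    also have "\<dots> \<le> m / sqrt (4 * pi * (k * (t - r)))"
      using m0 elim(1) T[of t] k by (intro divide_left_mono) auto
    also have "\<dots> < e / 2" using elim(2) by linarith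
    finally have 1: "\<bar>LBINT s:{0<..r}. \<zeta> s * lam s * heat (k * (T t - s)) (x t - p s)\<bar> < e / 2" .
    have 2: "\<bar>LBINT s:{r<..t}. \<zeta> s * lam s * heat (k * (T t - s)) (x t - p s)\<bar> < e / 2"
      using source_piece(2)[OF _ t(2) t(1) T, of "x t"] r late by linarith
    show ?case using 1 2 unfolding source_def source_split[OF r t(2) T] dist_real_def by linarith
  qed
qed

text \<open>The heat kernel is evaluated at the slightly later time \<open>hor t\<close>, so that Duhamel's formula has no
  singularity at \<open>s = t\<close>; the delay is small enough for the mollified value at the zero \<open>p t\<close> to be
  at most \<open>1 / (1 + t)\<close>.\<close>

definition "hor t = t + (if 0 < t then SOME \<epsilon>. 0 < \<epsilon> \<and> \<epsilon> \<le> 1 \<and> \<bar>v t (t + \<epsilon>) (p t)\<bar> \<le> 1 / (1 + t) else 1)"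

lemma hor: "t < hor t" "hor t \<le> t + 1" "0 < t \<Longrightarrow> \<bar>v t (hor t) (p t)\<bar> \<le> 1 / (1 + t)"
proof -
  have *: "0 < (SOME \<epsilon>. 0 < \<epsilon> \<and> \<epsilon> \<le> 1 \<and> \<bar>v t (t + \<epsilon>) (p t)\<bar> \<le> 1 / (1 + t)) \<and>
      (SOME \<epsilon>. 0 < \<epsilon> \<and> \<epsilon> \<le> 1 \<and> \<bar>v t (t + \<epsilon>) (p t)\<bar> \<le> 1 / (1 + t)) \<le> 1 \<and>
      \<bar>v t (t + (SOME \<epsilon>. 0 < \<epsilon> \<and> \<epsilon> \<le> 1 \<and> \<bar>v t (t + \<epsilon>) (p t)\<bar> \<le> 1 / (1 + t))) (p t)\<bar> \<le> 1 / (1 + t)" if t: "0 < t"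
    by (rule someI_ex) (use approx[OF t, of "1 / (1 + t)"] t in auto)
  show "t < hor t" "hor t \<le> t + 1" "0 < t \<Longrightarrow> \<bar>v t (hor t) (p t)\<bar> \<le> 1 / (1 + t)"
    using * by (auto simp: hor_def)
qed

text \<open>The kernel parameter for the evolution from time 0 to the horizon; not a
  difference.\<close>

definition "diff t = k * hor t"

section \<open>Growth of the free boundary\<close>

lemma diff_pos: "0 < t \<Longrightarrow> 0 < diff t"
  using hor(1)[of t] k by (simp add: diff_def)

lemma hor_at_top: "filterlim hor at_top at_top"
  by (rule filterlim_at_top_mono[OF filterlim_ident]) (use hor(1) in \<open>auto intro!: always_eventually less_imp_le\<close>)

lemma diff_at_top: "filterlim diff at_top at_top"
  unfolding diff_def by (rule filterlim_tendsto_pos_mult_at_top[OF tendsto_const k hor_at_top])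

text \<open>Duhamel's formula at the boundary, multiplied by
  \<open>a * sqrt (4 * pi * diff t)\<close>. The terms with \<open>sqrt (pi * diff t)\<close> cancel
  because both weighted masses equal \<open>\<alpha> * a\<close>, while oddness of
  \<open>gauss_int\<close> makes the two position terms add up to the left side.\<close>

lemma balance:
  assumes t: "0 < t"
  shows "2 * \<alpha> * a * gauss_int (diff t) (p t)
    = linf * L.rem (p t) (diff t) - rinf * R.rem (- p t) (diff t)
      - a * sqrt (4 * pi * diff t) * (source t (hor t) (p t) + v t (hor t) (p t))"
proof -
  let ?c = "diff t" and ?s = "sqrt (4 * pi * diff t)"
  note c = diff_pos[OF t]
  have s: "0 < ?s" using c by simp
  have h: "(LBINT x. heat ?c (y - x) * q x) = (LBINT x. gauss ?c (y - x) * q x) / ?s" for y and q :: "real \<Rightarrow> real"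
    by (simp add: heat_def)
  define Hl where "Hl = (LBINT x. gauss ?c (p t - x) * L.per x)"
  define Hr where "Hr = (LBINT x. gauss ?c (- p t - x) * R.per x)"
  have Hl: "a * Hl = sqrt (pi * ?c) * L.mass - L.mass * gauss_int ?c (p t) + L.rem (p t) ?c"
    unfolding Hl_def by (rule L.gauss_per_expansion[OF c])
  have Hr: "a * Hr = sqrt (pi * ?c) * R.mass + R.mass * gauss_int ?c (p t) + R.rem (- p t) ?c"
    unfolding Hr_def using R.gauss_per_expansion[OF c, of "- p t"] gauss_int_minus[of ?c "p t"] c by simp
  have "v t (hor t) (p t) + source t (hor t) (p t) = (linf * Hl - rinf * Hr) / ?s"
    unfolding duhamel[OF t hor(1)] source_def diff_def[symmetric] h Hl_def[symmetric] Hr_def[symmetric]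
    by (simp add: diff_divide_distrib)
  then have e: "(v t (hor t) (p t) + source t (hor t) (p t)) * ?s = linf * Hl - rinf * Hr"
    using s by (simp only: nonzero_eq_divide_eq[OF less_imp_neq[OF s, symmetric]])
  have "a * ?s * (source t (hor t) (p t) + v t (hor t) (p t)) = a * ((v t (hor t) (p t) + source t (hor t) (p t)) * ?s)"
    by (simp only: mult_ac add_ac)
  also have "\<dots> = linf * (a * Hl) - rinf * (a * Hr)"
    unfolding e by (simp add: algebra_simps)
  also have "\<dots> = (linf * L.mass - rinf * R.mass) * sqrt (pi * ?c) - (linf * L.mass + rinf * R.mass) * gauss_int ?c (p t)
      + linf * L.rem (p t) ?c - rinf * R.rem (- p t) ?c"
    unfolding Hl Hr by (simp add: algebra_simps)
  finally show ?thesis unfolding massl massr by simp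
qed

lemma diff_ge_1: "\<forall>\<^sub>F t in at_top. 0 < t \<and> 1 \<le> diff t"
  using eventually_gt_at_top[of 0] filterlim_at_top[THEN iffD1, OF diff_at_top, rule_format, of 1]
  by eventually_elim simp

text \<open>Division of \<open>balance\<close> by \<open>2 * \<alpha> * a * sqrt (diff t)\<close>:
  the remainders are bounded uniformly in the position, the source tends to 0, and \<open>v\<close>
  is at most \<open>1 / (1 + t)\<close> in modulus.\<close>

lemma gauss_int_ratio: "((\<lambda>t. gauss_int (diff t) (p t) / sqrt (diff t)) \<longlongrightarrow> 0) at_top"
proof -
  define B where "B = linf * (LBINT y. (\<bar>y\<bar> + (a / 2 + L.K0)) * fl y) + rinf * (LBINT y. (\<bar>y\<bar> + (a / 2 + R.K0)) * fr y)"
  have aa: "0 < 2 * \<alpha> * a" using \<alpha> L.a_pos by simp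
  have sq: "filterlim (\<lambda>t. sqrt (diff t)) at_top at_top" by (rule filterlim_compose[OF sqrt_at_top diff_at_top])
  have l1: "((\<lambda>t. B / sqrt (diff t)) \<longlongrightarrow> 0) at_top" by (rule real_tendsto_divide_at_top[OF tendsto_const sq])
  have l2: "((\<lambda>t. \<bar>source t (hor t) (p t)\<bar>) \<longlongrightarrow> 0) at_top"
    using source_tendsto_0[OF hor(1)] by (rule tendsto_rabs_zero)
  have l3: "((\<lambda>t. 1 / (1 + t)) \<longlongrightarrow> (0::real)) at_top" by real_asymp
  have "((\<lambda>t. (B / sqrt (diff t) + a * sqrt (4 * pi) * (\<bar>source t (hor t) (p t)\<bar> + 1 / (1 + t))) / (2 * \<alpha> * a)) \<longlongrightarrow>
     (0 + a * sqrt (4 * pi) * (0 + 0)) / (2 * \<alpha> * a)) at_top"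
    by (intro tendsto_intros l1 l2 l3) (use \<alpha> L.a_pos in simp)
  then have l: "((\<lambda>t. (B / sqrt (diff t) + a * sqrt (4 * pi) * (\<bar>source t (hor t) (p t)\<bar> + 1 / (1 + t))) / (2 * \<alpha> * a)) \<longlongrightarrow> 0) at_top"
    by simp
  show ?thesis
  proof (rule Lim_null_comparison[OF _ l])
    show "\<forall>\<^sub>F t in at_top. norm (gauss_int (diff t) (p t) / sqrt (diff t))
        \<le> (B / sqrt (diff t) + a * sqrt (4 * pi) * (\<bar>source t (hor t) (p t)\<bar> + 1 / (1 + t))) / (2 * \<alpha> * a)"
      using diff_ge_1
    proof eventually_elim
      case (elim t)
      then have t: "0 < t" and c: "1 \<le> diff t" by auto
      let ?s = "sqrt (diff t)"
      have s: "0 < ?s" using c by simp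
      have "\<bar>linf * L.rem (p t) (diff t)\<bar> \<le> linf * (LBINT y. (\<bar>y\<bar> + (a / 2 + L.K0)) * fl y)"
        "\<bar>rinf * R.rem (- p t) (diff t)\<bar> \<le> rinf * (LBINT y. (\<bar>y\<bar> + (a / 2 + R.K0)) * fr y)"
        using L.rem_bound[OF c] R.rem_bound[OF c] linf rinf by (simp_all add: abs_mult)
      then have r: "\<bar>linf * L.rem (p t) (diff t) - rinf * R.rem (- p t) (diff t)\<bar> \<le> B" unfolding B_def by linarith
      define w where "w = source t (hor t) (p t) + v t (hor t) (p t)"
      have w: "\<bar>w\<bar> \<le> \<bar>source t (hor t) (p t)\<bar> + 1 / (1 + t)" unfolding w_def using hor(3)[OF t] by linarith
      have "2 * \<alpha> * a * gauss_int (diff t) (p t)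
         = (linf * L.rem (p t) (diff t) - rinf * R.rem (- p t) (diff t)) - a * sqrt (4 * pi) * ?s * w"
        unfolding balance[OF t] w_def by (simp add: real_sqrt_mult)
      then have "\<bar>2 * \<alpha> * a * gauss_int (diff t) (p t)\<bar> \<le> B + \<bar>a * sqrt (4 * pi) * ?s * w\<bar>" using r by linarith
      also have "\<bar>a * sqrt (4 * pi) * ?s * w\<bar> = a * sqrt (4 * pi) * ?s * \<bar>w\<bar>"
        using L.a_pos s by (simp add: abs_mult)
      also have "\<dots> \<le> a * sqrt (4 * pi) * ?s * (\<bar>source t (hor t) (p t)\<bar> + 1 / (1 + t))"
        using w L.a_pos s by (intro mult_left_mono) auto
      finally have main: "\<bar>2 * \<alpha> * a * gauss_int (diff t) (p t)\<bar>
          \<le> B + a * sqrt (4 * pi) * ?s * (\<bar>source t (hor t) (p t)\<bar> + 1 / (1 + t))" by simp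
      have e1: "\<bar>2 * \<alpha> * a * gauss_int (diff t) (p t)\<bar> = (2 * \<alpha> * a * ?s) * norm (gauss_int (diff t) (p t) / ?s)"
        using aa s \<alpha> L.a_pos by (simp add: abs_mult)
      have e2: "B + a * sqrt (4 * pi) * ?s * (\<bar>source t (hor t) (p t)\<bar> + 1 / (1 + t))
         = ?s * (B / ?s + a * sqrt (4 * pi) * (\<bar>source t (hor t) (p t)\<bar> + 1 / (1 + t)))"
        using s by (simp add: distrib_left)
      have "?s * (norm (gauss_int (diff t) (p t) / ?s) * (2 * \<alpha> * a))
          \<le> ?s * (B / ?s + a * sqrt (4 * pi) * (\<bar>source t (hor t) (p t)\<bar> + 1 / (1 + t)))"
        using main unfolding e1 e2 by (simp only: mult_ac)
      then have "norm (gauss_int (diff t) (p t) / ?s) * (2 * \<alpha> * a)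
          \<le> B / ?s + a * sqrt (4 * pi) * (\<bar>source t (hor t) (p t)\<bar> + 1 / (1 + t))"
        using s by (rule mult_left_le_imp_le)
      then show ?case using aa by (simp only: pos_le_divide_eq)
    qed
  qed
qed

text \<open>Scaling turns the ratio into \<open>gauss_int 1 (p t / sqrt (diff t))\<close>, whose
  smallness forces that of its argument.\<close>

lemma p_square_ratio: "((\<lambda>t. (p t)\<^sup>2 / diff t) \<longlongrightarrow> 0) at_top"
proof -
  have "\<forall>\<^sub>F t in at_top. gauss_int (diff t) (p t) / sqrt (diff t) = gauss_int 1 (p t / sqrt (diff t))"
    using eventually_gt_at_top[of 0]
  proof eventually_elim
    case (elim t)
    show ?case using gauss_int_scale[OF diff_pos[OF elim], of "p t"] diff_pos[OF elim] by simp
  qed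
  then have "((\<lambda>t. gauss_int 1 (p t / sqrt (diff t))) \<longlongrightarrow> 0) at_top"
    by (rule Lim_transform_eventually[OF gauss_int_ratio])
  then have "((\<lambda>t. p t / sqrt (diff t)) \<longlongrightarrow> 0) at_top" by (rule gauss_int_tendsto_0D)
  from tendsto_power[OF this, of 2] have lim: "((\<lambda>t. (p t / sqrt (diff t))\<^sup>2) \<longlongrightarrow> 0) at_top" by simp
  have "\<forall>\<^sub>F t in at_top. (p t / sqrt (diff t))\<^sup>2 = (p t)\<^sup>2 / diff t"
    using eventually_gt_at_top[of 0]
    by eventually_elim (use diff_pos in \<open>simp add: power_divide less_imp_le\<close>)
  then show ?thesis by (rule Lim_transform_eventually[OF lim])
qed

text \<open>The bound must hold for all times up to \<open>t\<close>, because
  \<open>lam_mass\<close> looks at the whole path.\<close>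

lemma p_sqrt_bound: obtains D where "0 \<le> D" "\<And>s t. 1 \<le> t \<Longrightarrow> 0 < s \<Longrightarrow> s \<le> t \<Longrightarrow> \<bar>p s\<bar> \<le> D * sqrt t"
proof -
  have "\<forall>\<^sub>F t in at_top. (p t)\<^sup>2 / diff t < 1 \<and> 1 \<le> t"
    using order_tendstoD(2)[OF p_square_ratio zero_less_one] eventually_ge_at_top[of 1] by eventually_elim simp
  then obtain t2 where t2: "\<And>t. t2 \<le> t \<Longrightarrow> (p t)\<^sup>2 / diff t < 1 \<and> 1 \<le> t" unfolding eventually_at_top_linorder by blast
  obtain P where P: "0 \<le> P" "\<And>s. 0 < s \<Longrightarrow> s \<le> t2 \<Longrightarrow> \<bar>p s\<bar> \<le> P" using p_bounded[of t2] by blast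
  \<comment> \<open>\<open>P\<close> covers times up to \<open>t2\<close>; afterwards
    \<open>diff s\<close> is at most \<open>2 * k * s\<close>, as the delay is at most 1 and
    \<open>s\<close> at least 1.\<close>
  define D where "D = P + sqrt (2 * k)"
  show ?thesis
  proof (rule that[of D])
    show "0 \<le> D" using P k by (simp add: D_def)
    fix s t :: real assume t: "1 \<le> t" and s: "0 < s" "s \<le> t"
    have "1 \<le> sqrt t" using t by simp
    show "\<bar>p s\<bar> \<le> D * sqrt t"
    proof (cases "s \<le> t2")
      case True
      then have "\<bar>p s\<bar> \<le> P * 1" using P(2)[OF s(1)] by simp
      also have "\<dots> \<le> P * sqrt t" using P \<open>1 \<le> sqrt t\<close> by (intro mult_left_mono) auto
      also have "\<dots> \<le> D * sqrt t" using t k by (intro mult_right_mono) (auto simp: D_def)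
      finally show ?thesis .
    next
      case False
      then have "(p s)\<^sup>2 / diff s < 1" "1 \<le> s" using t2[of s] by auto
      then have "(p s)\<^sup>2 < diff s" using diff_pos[OF s(1)] by (simp add: pos_divide_less_eq)
      also have "\<dots> \<le> k * (2 * s)" unfolding diff_def using hor(2)[of s] \<open>1 \<le> s\<close> k by (intro mult_left_mono) auto
      also have "\<dots> \<le> 2 * k * t" using s k by simp
      finally have "\<bar>p s\<bar> \<le> sqrt (2 * k * t)" by (intro real_le_rsqrt) simp
      also have "\<dots> = sqrt (2 * k) * sqrt t" by (rule real_sqrt_mult)
      also have "\<dots> \<le> D * sqrt t" using t P by (intro mult_right_mono) (auto simp: D_def)
      finally show ?thesis .
    qed
  qed
qed

text \<open>On the parabolic scale \<open>D * sqrt t\<close> the Gaussian factor in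
  \<open>lam_mass\<close> no longer depends on \<open>t\<close>, which leaves the growth sqrt
  t.\<close>

lemma lam_sqrt_bound: obtains B where "0 \<le> B" "\<And>t. 1 \<le> t \<Longrightarrow> (LBINT s:{0<..t}. lam s) \<le> B * sqrt t"
proof -
  obtain D where D: "0 \<le> D" "\<And>s t. 1 \<le> t \<Longrightarrow> 0 < s \<Longrightarrow> s \<le> t \<Longrightarrow> \<bar>p s\<bar> \<le> D * sqrt t" using p_sqrt_bound by blast
  define B where "B = C * (sqrt (8 * pi * k) / exp (- D\<^sup>2 / (4 * k)))"
  show ?thesis
  proof (rule that[of B])
    show "0 \<le> B" unfolding B_def using C_nonneg k by (intro mult_nonneg_nonneg) auto
    fix t :: real assume t: "1 \<le> t"
    have "(LBINT s:{0<..t}. lam s) \<le> C * (sqrt (8 * pi * k * t) / gauss (k * t) (D * sqrt t))"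
      by (rule lam_mass(2)) (use t D(2)[OF t] in auto)
    also have "gauss (k * t) (D * sqrt t) = exp (- D\<^sup>2 / (4 * k))"
      using t k by (simp add: gauss_def power_mult_distrib)
    also have "sqrt (8 * pi * k * t) = sqrt (8 * pi * k) * sqrt t" by (rule real_sqrt_mult)
    finally show "(LBINT s:{0<..t}. lam s) \<le> B * sqrt t" by (simp add: B_def)
  qed
qed

section \<open>Integrability of the net source density\<close>

lemma source_density_meas: "set_borel_measurable lborel {0<..} (\<lambda>s. \<zeta> s * lam s)"
  by (rule set_borel_measurable_times[OF \<zeta>_meas lam_meas subset_refl])

text \<open>Dyadic decomposition: \<open>1 / (1 + s) \<le> 2 / 2 ^ j\<close> on \<open>(2 ^ (j - 1), 2 ^ j]\<close>, where
  the integral of \<^term>\<open>lam\<close> is of order \<open>sqrt (2 ^ j)\<close>.\<close>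

lemma source_density_integrable: "set_integrable lborel {0<..} (\<lambda>s. \<zeta> s * lam s)"
proof -
  obtain B where B: "0 \<le> B" "\<And>t. 1 \<le> t \<Longrightarrow> (LBINT s:{0<..t}. lam s) \<le> B * sqrt t" using lam_sqrt_bound by blast
  have nn: "0 \<le> indicator {0<..2 ^ j} s *\<^sub>R lam s" for j :: nat and s by (auto simp: indicator_def lam_nonneg)
  have i: "integrable lborel (\<lambda>s. indicator {0<..2 ^ j} s *\<^sub>R lam s)" for j :: nat
    using lam_integrable[of "2 ^ j"] by (simp add: set_integrable_def)
  have ptw: "ennreal (norm (indicator {0<..} s *\<^sub>R (\<zeta> s * lam s)))
      \<le> (\<Sum>j. ennreal (Cz * 2 * (1 / 2) ^ j * (indicator {0<..2 ^ j} s *\<^sub>R lam s)))" for s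
  proof (cases "0 < s")
    case True
    obtain n :: nat where "s < 2 ^ n" using real_arch_pow[of 2 s] by auto
    then have ex: "\<exists>j::nat. s \<le> 2 ^ j" by (intro exI[of _ n]) simp
    \<comment> \<open>Minimality gives \<open>s > 2 ^ (j - 1)\<close> unless \<open>j\<close> is 0;
      in that case the claimed bound is 2 and holds trivially.\<close>
    define j where "j = (LEAST j::nat. s \<le> 2 ^ j)"
    have j: "s \<le> 2 ^ j" unfolding j_def using ex by (rule LeastI_ex)
    have "1 / (1 + s) \<le> 2 * (1 / 2) ^ j"
    proof (cases j)
      case 0 then show ?thesis using True by (simp add: divide_le_eq)
    next
      case (Suc i)
      then have "2 ^ i < s" using not_less_Least[of i "\<lambda>j. s \<le> 2 ^ j"] unfolding j_def[symmetric] by auto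
      then have "1 / (1 + s) \<le> 1 / 2 ^ i" using True by (intro divide_left_mono mult_pos_pos add_pos_pos) auto
      then show ?thesis using Suc by (simp add: power_divide)
    qed
    then have "Cz * (1 / (1 + s)) \<le> Cz * (2 * (1 / 2) ^ j)" by (rule mult_left_mono[OF _ Cz_nonneg])
    then have "\<bar>\<zeta> s\<bar> \<le> Cz * 2 * (1 / 2) ^ j" using \<zeta>_bound[OF True] by simp
    then have "\<bar>\<zeta> s\<bar> * lam s \<le> Cz * 2 * (1 / 2) ^ j * lam s" by (rule mult_right_mono[OF _ lam_nonneg[OF True]])
    then have "norm (indicator {0<..} s *\<^sub>R (\<zeta> s * lam s)) \<le> Cz * 2 * (1 / 2) ^ j * (indicator {0<..2 ^ j} s *\<^sub>R lam s)"
      using True j lam_nonneg[OF True] by (simp add: abs_mult)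
    then have "ennreal (norm (indicator {0<..} s *\<^sub>R (\<zeta> s * lam s))) \<le> ennreal (Cz * 2 * (1 / 2) ^ j * (indicator {0<..2 ^ j} s *\<^sub>R lam s))"
      by (rule ennreal_leI)
    also have "\<dots> = (\<Sum>j\<in>{j}. ennreal (Cz * 2 * (1 / 2) ^ j * (indicator {0<..2 ^ j} s *\<^sub>R lam s)))" by simp
    also have "\<dots> \<le> (\<Sum>j. ennreal (Cz * 2 * (1 / 2) ^ j * (indicator {0<..2 ^ j} s *\<^sub>R lam s)))"
      by (rule sum_le_suminf) auto
    finally show ?thesis .
  qed simp
  \<comment> \<open>Ratio of the dyadic series: a factor 1 / 2 from the decay of \<zeta> against
    sqrt 2 from the growth of the integral of \<lambda>.\<close>
  have q: "0 < sqrt 2 / 2" "sqrt 2 / 2 < (1::real)" using sqrt2_less_2 by auto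
  have "(\<integral>\<^sup>+s. ennreal (norm (indicator {0<..} s *\<^sub>R (\<zeta> s * lam s))) \<partial>lborel)
     \<le> (\<integral>\<^sup>+s. (\<Sum>j. ennreal (Cz * 2 * (1 / 2) ^ j * (indicator {0<..2 ^ j} s *\<^sub>R lam s))) \<partial>lborel)"
    by (rule nn_integral_mono) (rule ptw)
  also have "\<dots> = (\<Sum>j. \<integral>\<^sup>+s. ennreal (Cz * 2 * (1 / 2) ^ j * (indicator {0<..2 ^ j} s *\<^sub>R lam s)) \<partial>lborel)"
    by (rule nn_integral_suminf)
       (intro measurable_compose[OF _ measurable_ennreal] borel_measurable_times borel_measurable_const borel_measurable_integrable[OF i])
  also have "\<dots> \<le> (\<Sum>j. ennreal (Cz * 2 * B * (sqrt 2 / 2) ^ j))"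
  proof (rule suminf_le)
    fix j :: nat
    have "(\<integral>\<^sup>+s. ennreal (Cz * 2 * (1 / 2) ^ j * (indicator {0<..2 ^ j} s *\<^sub>R lam s)) \<partial>lborel)
       = ennreal (LBINT s. Cz * 2 * (1 / 2) ^ j * (indicator {0<..2 ^ j} s *\<^sub>R lam s))"
      using Cz_nonneg nn by (intro nn_integral_eq_integral integrable_mult_right i AE_I2 mult_nonneg_nonneg) auto
    also have "(LBINT s. Cz * 2 * (1 / 2) ^ j * (indicator {0<..2 ^ j} s *\<^sub>R lam s))
        = Cz * 2 * (1 / 2) ^ j * (LBINT s:{0<..2 ^ j}. lam s)" by (simp add: set_lebesgue_integral_def)
    also have "\<dots> \<le> Cz * 2 * (1 / 2) ^ j * (B * sqrt (2 ^ j))"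
      using Cz_nonneg by (intro mult_left_mono B) auto
    also have "\<dots> = Cz * 2 * B * (sqrt 2 / 2) ^ j" by (simp add: real_sqrt_power power_divide)
    finally show "(\<integral>\<^sup>+s. ennreal (Cz * 2 * (1 / 2) ^ j * (indicator {0<..2 ^ j} s *\<^sub>R lam s)) \<partial>lborel)
        \<le> ennreal (Cz * 2 * B * (sqrt 2 / 2) ^ j)" by (simp add: ennreal_leI)
  qed auto
  also have "\<dots> = ennreal (\<Sum>j. Cz * 2 * B * (sqrt 2 / 2) ^ j)"
    using q B Cz_nonneg by (intro suminf_ennreal2 summable_mult summable_geometric) auto
  also have "\<dots> < \<infinity>" by simp
  finally show ?thesis
    using source_density_meas unfolding set_integrable_def set_borel_measurable_def
    by (intro integrableI_bounded) auto
qed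

text \<open>For emission times up to \<open>t / 2\<close> the two normalisations differ by a factor
  of at most sqrt 2, which gives the majorant in \<open>source_limit\<close>.\<close>

lemma heat_weight:
  assumes "0 < t" "s \<le> t / 2"
  shows "sqrt (4 * pi * diff t) * heat (k * (hor t - s)) y = sqrt (hor t / (hor t - s)) * gauss (k * (hor t - s)) y"
    and "0 < hor t - s" and "hor t / (hor t - s) \<le> 2"
proof -
  have h: "0 < hor t - s" "hor t \<le> 2 * (hor t - s)" using hor(1)[of t] assms by auto
  show "0 < hor t - s" by fact
  show "hor t / (hor t - s) \<le> 2" using h by (simp add: pos_divide_le_eq)
  have "sqrt (4 * pi * diff t) / sqrt (4 * pi * (k * (hor t - s))) = sqrt ((4 * pi * diff t) / (4 * pi * (k * (hor t - s))))"
    by (rule real_sqrt_divide[symmetric])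
  also have "(4 * pi * diff t) / (4 * pi * (k * (hor t - s))) = hor t / (hor t - s)"
    using k by (simp add: diff_def)
  finally have "sqrt (4 * pi * diff t) / sqrt (4 * pi * (k * (hor t - s))) = sqrt (hor t / (hor t - s))" .
  then show "sqrt (4 * pi * diff t) * heat (k * (hor t - s)) y = sqrt (hor t / (hor t - s)) * gauss (k * (hor t - s)) y"
    unfolding heat_def by (metis times_divide_eq_left times_divide_eq_right)
qed

text \<open>Both positions are small against the diffusion length: \<open>p t\<close> by
  \<open>p_square_ratio\<close>, and \<open>p s\<close> because it does not depend on
  \<open>t\<close>.\<close>

lemma heat_weight_tendsto:
  assumes s: "0 < s"
  shows "((\<lambda>t. sqrt (4 * pi * diff t) * heat (k * (hor t - s)) (p t - p s)) \<longlongrightarrow> 1) at_top"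
proof -
  have ev: "\<forall>\<^sub>F t in at_top. 0 < t \<and> s \<le> t / 2"
    using eventually_ge_at_top[of "2 * s"] by eventually_elim (use s in auto)
  have "((\<lambda>t. s / hor t) \<longlongrightarrow> 0) at_top" by (rule real_tendsto_divide_at_top[OF tendsto_const hor_at_top])
  then have "((\<lambda>t. sqrt (1 / (1 - s / hor t))) \<longlongrightarrow> sqrt (1 / (1 - 0))) at_top"
    by (intro tendsto_intros) auto
  then have 1: "((\<lambda>t. sqrt (1 / (1 - s / hor t))) \<longlongrightarrow> 1) at_top" by simp
  \<comment> \<open>The factors 4 combine (x - y)^2 \<le> 2 x^2 + 2 y^2 with the fact that
    \<open>k * (hor t - s)\<close> is at least half of \<open>diff t\<close>.\<close>
  have "((\<lambda>t. 4 * ((p t)\<^sup>2 / diff t) + 4 * ((p s)\<^sup>2 / diff t)) \<longlongrightarrow> 4 * 0 + 4 * 0) at_top"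
    by (intro tendsto_add tendsto_mult_left p_square_ratio real_tendsto_divide_at_top[OF tendsto_const diff_at_top])
  then have z: "((\<lambda>t. 4 * ((p t)\<^sup>2 / diff t) + 4 * ((p s)\<^sup>2 / diff t)) \<longlongrightarrow> 0) at_top" by simp
  have "((\<lambda>t. (p t - p s)\<^sup>2 / (k * (hor t - s))) \<longlongrightarrow> 0) at_top"
  proof (rule Lim_null_comparison[OF _ z])
    show "\<forall>\<^sub>F t in at_top. norm ((p t - p s)\<^sup>2 / (k * (hor t - s))) \<le> 4 * ((p t)\<^sup>2 / diff t) + 4 * ((p s)\<^sup>2 / diff t)"
      using ev
    proof eventually_elim
      case (elim t)
      have h: "0 < hor t - s" using heat_weight(2) elim by blast
      have d: "diff t / 2 \<le> k * (hor t - s)" "0 < diff t" using hor(1)[of t] elim k by (auto simp: diff_def field_simps)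
      have "0 \<le> (p t + p s)\<^sup>2" by simp
      then have "(p t - p s)\<^sup>2 \<le> 2 * (p t)\<^sup>2 + 2 * (p s)\<^sup>2" by (simp add: power2_eq_square algebra_simps)
      then have "(p t - p s)\<^sup>2 / (k * (hor t - s)) \<le> (2 * (p t)\<^sup>2 + 2 * (p s)\<^sup>2) / (diff t / 2)"
        using d h k by (intro frac_le) auto
      also have "\<dots> = 4 * ((p t)\<^sup>2 / diff t) + 4 * ((p s)\<^sup>2 / diff t)"
        using d by (simp add: field_simps)
      finally show ?case using h k by simp
    qed
  qed
  then have "((\<lambda>t. exp (- ((p t - p s)\<^sup>2 / (k * (hor t - s))) / 4)) \<longlongrightarrow> exp (- 0 / 4)) at_top"
    by (intro tendsto_intros) auto
  then have 2: "((\<lambda>t. gauss (k * (hor t - s)) (p t - p s)) \<longlongrightarrow> 1) at_top"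
    by (simp add: gauss_def mult.commute)
  have l: "((\<lambda>t. sqrt (1 / (1 - s / hor t)) * gauss (k * (hor t - s)) (p t - p s)) \<longlongrightarrow> 1) at_top"
    using tendsto_mult[OF 1 2] by simp
  show ?thesis
  proof (rule Lim_transform_eventually[OF l])
    show "\<forall>\<^sub>F t in at_top. sqrt (1 / (1 - s / hor t)) * gauss (k * (hor t - s)) (p t - p s)
       = sqrt (4 * pi * diff t) * heat (k * (hor t - s)) (p t - p s)"
      using ev
    proof eventually_elim
      case (elim t)
      then have t: "0 < t" "s \<le> t / 2" by auto
      have h: "0 < hor t" using hor(1)[of t] t by simp
      have "1 / (1 - s / hor t) = hor t / (hor t - s)" using h by (simp add: field_simps)
      then show ?case unfolding heat_weight(1)[OF t] by simp
    qed
  qed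
qed

section \<open>Limits of the scaled source and of the free boundary\<close>

definition "net_source = (LBINT s:{0<..}. \<zeta> s * lam s)"

text \<open>Splitting at the moving time \<open>t / 2\<close>: the early half converges by dominated
  convergence, with sqrt 2 times the modulus of \<zeta> \<lambda> as majorant; in the late half
  \<zeta> is of order 1 / t, against the weight sqrt t and the uniform bound
  \<open>C\<close>.\<close>

lemma source_limit: "((\<lambda>t. sqrt (4 * pi * diff t) * source t (hor t) (p t)) \<longlongrightarrow> net_source) at_top"
proof -
  define g where "g t s = indicator {0<..t / 2} s *\<^sub>R (\<zeta> s * lam s * (sqrt (4 * pi * diff t) * heat (k * (hor t - s)) (p t - p s)))" for t s
  have early: "((\<lambda>t. LBINT s. g t s) \<longlongrightarrow> net_source) at_top"
    unfolding net_source_def set_lebesgue_integral_def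
  proof (rule integral_dominated_convergence_at_top[where w="\<lambda>s. sqrt 2 * norm (indicator {0<..} s *\<^sub>R (\<zeta> s * lam s))"])
    show "(\<lambda>s. indicator {0<..} s *\<^sub>R (\<zeta> s * lam s)) \<in> borel_measurable lborel"
      using source_density_meas by (simp add: set_borel_measurable_def)
    show "g t \<in> borel_measurable lborel" for t
    proof (cases "0 < t")
      case True
      then have "0 < t / 2" "t / 2 < hor t" using hor(1)[of t] by auto
      from source_meas[OF order_refl this, of "p t"]
      have "(\<lambda>s. sqrt (4 * pi * diff t) * (indicator {0<..t / 2} s *\<^sub>R (\<zeta> s * lam s * heat (k * (hor t - s)) (p t - p s)))) \<in> borel_measurable lborel"
        unfolding set_borel_measurable_def by (intro borel_measurable_times borel_measurable_const)
      then show ?thesis unfolding g_def by (simp add: mult_ac)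
    next
      case False
      then have "g t = (\<lambda>s. 0)" by (auto simp: g_def fun_eq_iff indicator_def)
      then show ?thesis by simp
    qed
    show "integrable lborel (\<lambda>s. sqrt 2 * norm (indicator {0<..} s *\<^sub>R (\<zeta> s * lam s)))"
      using source_density_integrable unfolding set_integrable_def by (intro integrable_mult_right integrable_norm)
    show "\<forall>\<^sub>F t in at_top. AE s in lborel. norm (g t s) \<le> sqrt 2 * norm (indicator {0<..} s *\<^sub>R (\<zeta> s * lam s))"
    proof (rule always_eventually, rule allI, rule AE_I2)
      fix t s
      show "norm (g t s) \<le> sqrt 2 * norm (indicator {0<..} s *\<^sub>R (\<zeta> s * lam s))"
      proof (cases "s \<in> {0<..t / 2}")
        case True
        then have t: "0 < t" "s \<le> t / 2" by auto
        note w = heat_weight[OF t]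
        have "sqrt (hor t / (hor t - s)) * gauss (k * (hor t - s)) (p t - p s) \<le> sqrt 2 * 1"
          using w(2,3) k by (intro mult_mono gauss_le_1) auto
        moreover have "0 \<le> sqrt (hor t / (hor t - s)) * gauss (k * (hor t - s)) (p t - p s)"
          using w(2) hor(1)[of t] t by (intro mult_nonneg_nonneg) auto
        ultimately have "\<bar>sqrt (4 * pi * diff t) * heat (k * (hor t - s)) (p t - p s)\<bar> \<le> sqrt 2"
          unfolding w(1) by linarith
        then have "\<bar>\<zeta> s * lam s\<bar> * \<bar>sqrt (4 * pi * diff t) * heat (k * (hor t - s)) (p t - p s)\<bar> \<le> \<bar>\<zeta> s * lam s\<bar> * sqrt 2"
          by (rule mult_left_mono) simp
        moreover have "norm (g t s) = \<bar>\<zeta> s * lam s\<bar> * \<bar>sqrt (4 * pi * diff t) * heat (k * (hor t - s)) (p t - p s)\<bar>"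
          using True by (simp only: g_def indicator_simps scaleR_one real_norm_def abs_mult)
        moreover have "norm (indicator {0<..} s *\<^sub>R (\<zeta> s * lam s)) = \<bar>\<zeta> s * lam s\<bar>" using True by simp
        ultimately show ?thesis by (simp only: mult.commute)
      qed (simp add: g_def)
    qed
    show "AE s in lborel. ((\<lambda>t. g t s) \<longlongrightarrow> indicator {0<..} s *\<^sub>R (\<zeta> s * lam s)) at_top"
    proof (rule AE_I2)
      fix s
      show "((\<lambda>t. g t s) \<longlongrightarrow> indicator {0<..} s *\<^sub>R (\<zeta> s * lam s)) at_top"
      proof (cases "0 < s")
        case True
        have l: "((\<lambda>t. \<zeta> s * lam s * (sqrt (4 * pi * diff t) * heat (k * (hor t - s)) (p t - p s))) \<longlongrightarrow> \<zeta> s * lam s * 1) at_top"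
          by (intro tendsto_mult_left heat_weight_tendsto True)
        have "\<forall>\<^sub>F t in at_top. \<zeta> s * lam s * (sqrt (4 * pi * diff t) * heat (k * (hor t - s)) (p t - p s)) = g t s"
          using eventually_ge_at_top[of "2 * s"] by eventually_elim (use True in \<open>simp add: g_def\<close>)
        from Lim_transform_eventually[OF l this] show ?thesis using True by simp
      qed (simp add: g_def)
    qed
  qed
  define J where "J t = sqrt (4 * pi * diff t) * (LBINT s:{t / 2<..t}. \<zeta> s * lam s * heat (k * (hor t - s)) (p t - p s))" for t
  have z: "((\<lambda>t. sqrt (4 * pi * (k * (t + 1))) * (Cz / (1 + t / 2) * C)) \<longlongrightarrow> 0) at_top"
    using k by real_asymp
  have late: "(J \<longlongrightarrow> 0) at_top"
  proof (rule Lim_null_comparison[OF _ z])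
    show "\<forall>\<^sub>F t in at_top. norm (J t) \<le> sqrt (4 * pi * (k * (t + 1))) * (Cz / (1 + t / 2) * C)"
      using eventually_gt_at_top[of 0]
    proof eventually_elim
      case (elim t)
      have "norm (J t) = sqrt (4 * pi * diff t) * \<bar>LBINT s:{t / 2<..t}. \<zeta> s * lam s * heat (k * (hor t - s)) (p t - p s)\<bar>"
        using diff_pos[OF elim] by (simp add: J_def abs_mult)
      also have "\<dots> \<le> sqrt (4 * pi * (k * (t + 1))) * (Cz / (1 + t / 2) * C)"
      proof (rule mult_mono)
        show "sqrt (4 * pi * diff t) \<le> sqrt (4 * pi * (k * (t + 1)))"
          using hor(2)[of t] k by (simp add: diff_def)
        show "\<bar>LBINT s:{t / 2<..t}. \<zeta> s * lam s * heat (k * (hor t - s)) (p t - p s)\<bar> \<le> Cz / (1 + t / 2) * C"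
          by (rule source_piece(2)) (use elim hor(1) in auto)
      qed (use elim k in auto)
      finally show ?case .
    qed
  qed
  have l: "((\<lambda>t. (LBINT s. g t s) + J t) \<longlongrightarrow> net_source) at_top" using tendsto_add[OF early late] by simp
  show ?thesis
  proof (rule Lim_transform_eventually[OF l])
    show "\<forall>\<^sub>F t in at_top. (LBINT s. g t s) + J t = sqrt (4 * pi * diff t) * source t (hor t) (p t)"
      using eventually_gt_at_top[of 0]
    proof eventually_elim
      case (elim t)
      have "(LBINT s. g t s) = (LBINT s. sqrt (4 * pi * diff t) * (indicator {0<..t / 2} s *\<^sub>R (\<zeta> s * lam s * heat (k * (hor t - s)) (p t - p s))))"
        unfolding g_def by (simp add: mult_ac)
      also have "\<dots> = sqrt (4 * pi * diff t) * (LBINT s:{0<..t / 2}. \<zeta> s * lam s * heat (k * (hor t - s)) (p t - p s))"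
        by (simp add: set_lebesgue_integral_def)
      finally have g: "(LBINT s. g t s) = sqrt (4 * pi * diff t) * (LBINT s:{0<..t / 2}. \<zeta> s * lam s * heat (k * (hor t - s)) (p t - p s))" .
      have "source t (hor t) (p t) = (LBINT s:{0<..t / 2}. \<zeta> s * lam s * heat (k * (hor t - s)) (p t - p s))
         + (LBINT s:{t / 2<..t}. \<zeta> s * lam s * heat (k * (hor t - s)) (p t - p s))"
        unfolding source_def by (rule source_split) (use elim hor(1) in auto)
      then show ?case unfolding g J_def by (simp add: distrib_left)
    qed
  qed
qed

text \<open>The tolerance \<open>1 / (1 + t)\<close> built into \<open>hor\<close> outweighs the
  weight of order sqrt t.\<close>

lemma residual_limit: "((\<lambda>t. sqrt (4 * pi * diff t) * v t (hor t) (p t)) \<longlongrightarrow> 0) at_top"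
proof (rule Lim_null_comparison)
  show "((\<lambda>t. sqrt (4 * pi * (k * (t + 1))) * (1 / (1 + t))) \<longlongrightarrow> 0) at_top" using k by real_asymp
  show "\<forall>\<^sub>F t in at_top. norm (sqrt (4 * pi * diff t) * v t (hor t) (p t)) \<le> sqrt (4 * pi * (k * (t + 1))) * (1 / (1 + t))"
    using eventually_gt_at_top[of 0]
  proof eventually_elim
    case (elim t)
    have "norm (sqrt (4 * pi * diff t) * v t (hor t) (p t)) = sqrt (4 * pi * diff t) * \<bar>v t (hor t) (p t)\<bar>"
      using diff_pos[OF elim] by (simp add: abs_mult)
    also have "\<dots> \<le> sqrt (4 * pi * (k * (t + 1))) * (1 / (1 + t))"
    proof (rule mult_mono)
      show "sqrt (4 * pi * diff t) \<le> sqrt (4 * pi * (k * (t + 1)))"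
        using hor(2)[of t] k by (simp add: diff_def)
    qed (use hor(3)[OF elim] elim k in auto)
    finally show ?case .
  qed
qed

lemma rem_limits:
  "((\<lambda>t. L.rem (p t) (diff t)) \<longlongrightarrow> (LBINT y. y * fl y) + a / 2 * L.mass) at_top"
  "((\<lambda>t. R.rem (- p t) (diff t)) \<longlongrightarrow> (LBINT y. y * fr y) + a / 2 * R.mass) at_top"
proof -
  \<comment> \<open>\<open>rem_tendsto\<close> asks for parameters that are at least 1 throughout,
    whereas \<open>diff t\<close> is so only for large \<open>t\<close>; hence the maximum with
    1.\<close>
  have ev: "\<forall>\<^sub>F t in at_top. max 1 (diff t) = diff t" using diff_ge_1 by eventually_elim simp
  have m: "filterlim (\<lambda>t. max 1 (diff t)) at_top at_top"
    by (rule filterlim_at_top_mono[OF diff_at_top]) simp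
  have r: "((\<lambda>t. (p t)\<^sup>2 / max 1 (diff t)) \<longlongrightarrow> 0) at_top"
    by (rule Lim_transform_eventually[OF p_square_ratio]) (use ev in \<open>auto elim: eventually_mono\<close>)
  have "((\<lambda>t. L.rem (p t) (max 1 (diff t))) \<longlongrightarrow> (LBINT y. y * fl y) + a / 2 * L.mass) at_top"
    by (rule tendsto_at_topI_sequentially, rule L.rem_tendsto)
       (use filterlim_compose[OF m] filterlim_compose[OF r] in auto)
  then show "((\<lambda>t. L.rem (p t) (diff t)) \<longlongrightarrow> (LBINT y. y * fl y) + a / 2 * L.mass) at_top"
    by (rule Lim_transform_eventually) (use ev in \<open>auto elim: eventually_mono\<close>)
  have "((\<lambda>t. R.rem (- p t) (max 1 (diff t))) \<longlongrightarrow> (LBINT y. y * fr y) + a / 2 * R.mass) at_top"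
    by (rule tendsto_at_topI_sequentially, rule R.rem_tendsto)
       (use filterlim_compose[OF m] filterlim_compose[OF r] in auto)
  then show "((\<lambda>t. R.rem (- p t) (diff t)) \<longlongrightarrow> (LBINT y. y * fr y) + a / 2 * R.mass) at_top"
    by (rule Lim_transform_eventually) (use ev in \<open>auto elim: eventually_mono\<close>)
qed

text \<open>The half-cell terms \<open>a / 2 * mass\<close> cancel by equality of the weighted
  masses, so \<open>balance\<close> gives the limit of \<open>gauss_int (diff t) (p t)\<close>. By
  the mean value theorem this is \<open>p t\<close> times a Gaussian value, which tends to 1 as
  \<open>p t\<close> is small against the diffusion length.\<close>

lemma p_limit:
  "(p \<longlongrightarrow> 1 / (2 * \<alpha> * a) * (linf * (LBINT y. y * fl y) - rinf * (LBINT y. y * fr y) - a * net_source)) at_top"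
proof -
  let ?\<beta> = "1 / (2 * \<alpha> * a) * (linf * (LBINT y. y * fl y) - rinf * (LBINT y. y * fr y) - a * net_source)"
  have aa: "2 * \<alpha> * a \<noteq> 0" using \<alpha> L.a_pos by simp
  have "((\<lambda>t. 1 / (2 * \<alpha> * a) * (linf * L.rem (p t) (diff t) - rinf * R.rem (- p t) (diff t)
      - a * (sqrt (4 * pi * diff t) * source t (hor t) (p t) + sqrt (4 * pi * diff t) * v t (hor t) (p t)))) \<longlongrightarrow>
     1 / (2 * \<alpha> * a) * (linf * ((LBINT y. y * fl y) + a / 2 * L.mass) - rinf * ((LBINT y. y * fr y) + a / 2 * R.mass)
      - a * (net_source + 0))) at_top"
    by (intro tendsto_intros rem_limits source_limit residual_limit)
  moreover have "linf * ((LBINT y. y * fl y) + a / 2 * L.mass) - rinf * ((LBINT y. y * fr y) + a / 2 * R.mass)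
      - a * (net_source + 0) = linf * (LBINT y. y * fl y) - rinf * (LBINT y. y * fr y) - a * net_source
        + a / 2 * (linf * L.mass - rinf * R.mass)"
    by (simp add: algebra_simps)
  ultimately have l: "((\<lambda>t. 1 / (2 * \<alpha> * a) * (linf * L.rem (p t) (diff t) - rinf * R.rem (- p t) (diff t)
      - a * (sqrt (4 * pi * diff t) * source t (hor t) (p t) + sqrt (4 * pi * diff t) * v t (hor t) (p t)))) \<longlongrightarrow> ?\<beta>) at_top"
    by (simp add: massl massr)
  have E: "((\<lambda>t. gauss_int (diff t) (p t)) \<longlongrightarrow> ?\<beta>) at_top"
  proof (rule Lim_transform_eventually[OF l])
    show "\<forall>\<^sub>F t in at_top. 1 / (2 * \<alpha> * a) * (linf * L.rem (p t) (diff t) - rinf * R.rem (- p t) (diff t)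
      - a * (sqrt (4 * pi * diff t) * source t (hor t) (p t) + sqrt (4 * pi * diff t) * v t (hor t) (p t))) = gauss_int (diff t) (p t)"
      using eventually_gt_at_top[of 0]
    proof eventually_elim
      case (elim t)
      have "linf * L.rem (p t) (diff t) - rinf * R.rem (- p t) (diff t)
        - a * (sqrt (4 * pi * diff t) * source t (hor t) (p t) + sqrt (4 * pi * diff t) * v t (hor t) (p t)) = 2 * \<alpha> * a * gauss_int (diff t) (p t)"
        unfolding balance[OF elim] by (simp add: algebra_simps)
      then show ?case using aa by simp
    qed
  qed
  have "((\<lambda>t. exp (- ((p t)\<^sup>2 / diff t) / 4)) \<longlongrightarrow> exp (- 0 / 4)) at_top" by (intro tendsto_intros p_square_ratio) simp
  then have "((\<lambda>t. gauss (diff t) (p t)) \<longlongrightarrow> 1) at_top" by (simp add: gauss_def mult.commute)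
  then have g1: "((\<lambda>t. gauss (diff t) \<bar>p t\<bar>) \<longlongrightarrow> 1) at_top" by (simp add: gauss_def)
  have "\<exists>\<xi>. 0 < t \<longrightarrow> \<bar>\<xi>\<bar> \<le> \<bar>p t\<bar> \<and> gauss_int (diff t) (p t) = p t * gauss (diff t) \<xi>" for t
  proof (cases "0 < t")
    case True
    then have "diff t \<noteq> 0" using diff_pos[of t] by simp
    from gauss_int_mvt[OF this, of "p t"] show ?thesis by metis
  qed simp
  then obtain \<xi> where \<xi>: "\<And>t. 0 < t \<Longrightarrow> \<bar>\<xi> t\<bar> \<le> \<bar>p t\<bar> \<and> gauss_int (diff t) (p t) = p t * gauss (diff t) (\<xi> t)" by metis
  have g2: "((\<lambda>t. gauss (diff t) (\<xi> t)) \<longlongrightarrow> 1) at_top"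
  proof (rule tendsto_sandwich[OF _ _ g1 tendsto_const])
    show "\<forall>\<^sub>F t in at_top. gauss (diff t) \<bar>p t\<bar> \<le> gauss (diff t) (\<xi> t)"
      using eventually_gt_at_top[of 0] by eventually_elim (use \<xi> diff_pos in \<open>auto intro!: gauss_antimono\<close>)
    show "\<forall>\<^sub>F t in at_top. gauss (diff t) (\<xi> t) \<le> 1"
      using eventually_gt_at_top[of 0] by eventually_elim (use diff_pos in \<open>auto intro!: gauss_le_1\<close>)
  qed
  have q: "((\<lambda>t. gauss_int (diff t) (p t) / gauss (diff t) (\<xi> t)) \<longlongrightarrow> ?\<beta> / 1) at_top"
    by (intro tendsto_divide E g2) simp
  have "((\<lambda>t. p t) \<longlongrightarrow> ?\<beta> / 1) at_top"
  proof (rule Lim_transform_eventually[OF q])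
    show "\<forall>\<^sub>F t in at_top. gauss_int (diff t) (p t) / gauss (diff t) (\<xi> t) = p t"
      using eventually_gt_at_top[of 0]
    proof eventually_elim
      case (elim t)
      have "gauss (diff t) (\<xi> t) \<noteq> 0" using gauss_pos[of "diff t" "\<xi> t"] by linarith
      then show ?case using \<xi>[OF elim] by simp
    qed
  qed
  then show ?thesis by simp
qed

end

section \<open>The price formation model\<close>

text \<open>The substitution \<open>x = x0 - sqrt (c n) * y\<close> makes the kernel independent of
  \<open>n\<close>; dominated convergence then uses boundedness and continuity of
  \<open>V\<close>.\<close>

lemma heat_approximate_identity:
  fixes V :: "real \<Rightarrow> real"
  assumes cont: "continuous_on UNIV V" and M: "\<And>x. \<bar>V x\<bar> \<le> M"
    and c: "\<And>n. 0 < c n" "c \<longlonglongrightarrow> 0"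
  shows "(\<lambda>n. LBINT x. V x * heat (c n) (x0 - x)) \<longlonglongrightarrow> V x0"
proof -
  have Vm [measurable]: "V \<in> borel_measurable borel" by (rule borel_measurable_continuous_onI[OF cont])
  have subst: "(LBINT x. V x * heat (c n) (x0 - x)) = (LBINT y. V (x0 - sqrt (c n) * y) * heat 1 y)" for n
  proof -
    have s: "0 < sqrt (c n)" using c(1) by simp
    have h: "sqrt (c n) * heat (c n) (sqrt (c n) * y) = heat 1 y" for y
      using s c(1)[of n] by (simp add: heat_def gauss_def power_mult_distrib real_sqrt_mult)
    have "(LBINT x. V x * heat (c n) (x0 - x))
       = \<bar>- sqrt (c n)\<bar> *\<^sub>R (LBINT y. V (x0 + - sqrt (c n) * y) * heat (c n) (x0 - (x0 + - sqrt (c n) * y)))"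
      by (rule lborel_integral_real_affine) (use s in simp)
    also have "\<dots> = (LBINT y. V (x0 - sqrt (c n) * y) * (sqrt (c n) * heat (c n) (sqrt (c n) * y)))"
      using s by (simp add: mult_ac flip: integral_mult_right_zero)
    finally show ?thesis by (simp only: h)
  qed
  have "(\<lambda>n. LBINT y. V (x0 - sqrt (c n) * y) * heat 1 y) \<longlonglongrightarrow> (LBINT y. V x0 * heat 1 y)"
  proof (rule integral_dominated_convergence[where w="\<lambda>y. M * heat 1 y"])
    show "integrable lborel (\<lambda>y. M * heat 1 y)" by (intro integrable_mult_right integrable_heat) simp
    show "AE y in lborel. (\<lambda>n. V (x0 - sqrt (c n) * y) * heat 1 y) \<longlonglongrightarrow> V x0 * heat 1 y"
    proof (rule AE_I2)
      fix y
      have "(\<lambda>n. x0 - sqrt (c n) * y) \<longlonglongrightarrow> x0 - sqrt 0 * y" by (intro tendsto_intros c(2))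
      then have "(\<lambda>n. V (x0 - sqrt (c n) * y)) \<longlonglongrightarrow> V x0"
        by (intro continuous_on_tendsto_compose[OF cont]) auto
      then show "(\<lambda>n. V (x0 - sqrt (c n) * y) * heat 1 y) \<longlonglongrightarrow> V x0 * heat 1 y" by (rule tendsto_mult_right)
    qed
    show "AE y in lborel. norm (V (x0 - sqrt (c n) * y) * heat 1 y) \<le> M * heat 1 y" for n
      using M heat_nonneg[of 1] by (intro AE_I2) (simp add: abs_mult mult_right_mono)
  qed measurable
  then show ?thesis unfolding subst using integral_heat[of 1] by simp
qed

text \<open>Stated for \<open>F\<close> and the transaction rate, so that it serves both for
  \<open>F\<close> and for its reflection. The bound \<open>M\<close> comes from boundedness at time
  0. In the last claim, positive mass forces \<open>F x0 0 > 0\<close> for some \<open>x0\<close>,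
  and continuity in time keeps \<open>x0\<close> to the left of \<open>p t\<close> for small
  \<open>t\<close>.\<close>

lemma half_price_summary:
  assumes k: "0 < k" and a: "0 < a" and L1: "L1_on UNIV fI" and L1x: "L1_on UNIV (\<lambda>x. x * fI x)"
    and neg: "\<forall>x<0. fI x \<ge> 0" and z: "fI 0 = 0" and pos: "\<forall>x>0. fI x \<le> 0"
    and sol: "price_solution k bl br (initial_F a fI) F" and fb: "free_boundary F p"
    and lip: "L-lipschitz_on {0..} bl" and bl0: "bl 0 = 0"
  obtains f M where "half_data a f"
    and "(LINT x|lebesgue. pos_part (fI x)) = half_data.mass f"
    and "(LINT x:{..<0}|lebesgue. x * pos_part (fI x)) = (LBINT y. y * f y)"
    and "\<And>x0 t T. 0 < t \<Longrightarrow> t < T \<Longrightarrow>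
        set_integrable lborel {0<..t} (\<lambda>s. exp (- bl s) * transaction_rate k F p s * heat (k * (T - s)) (x0 - p s))"
    and "\<And>x0 t T. 0 < t \<Longrightarrow> t < T \<Longrightarrow>
        (LBINT x. exp (- bl t) * pos_part (F x t) * heat (k * (T - t)) (x0 - x))
        = (LBINT x. heat (k * T) (x0 - x) * half_data.per a f x)
          - (LBINT s:{0<..t}. exp (- bl s) * transaction_rate k F p s * heat (k * (T - s)) (x0 - p s))"
    and "\<And>x0 t c. 0 < t \<Longrightarrow> 0 < c \<Longrightarrow> integrable lborel (\<lambda>x. exp (- bl t) * pos_part (F x t) * heat c (x0 - x))"
    and "\<And>s. 0 < s \<Longrightarrow> 0 \<le> transaction_rate k F p s"
    and "set_borel_measurable lborel {0<..} (\<lambda>s. exp (- bl s) * transaction_rate k F p s)"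
    and "\<And>t. 0 < t \<Longrightarrow> isCont p t"
    and "\<And>x0 c. 0 < c \<Longrightarrow> (LBINT x. heat c (x0 - x) * half_data.per a f x) \<le> M"
    and "0 < half_data.mass f \<Longrightarrow> \<exists>x0 \<delta>. 0 < \<delta> \<and> (\<forall>t. 0 < t \<and> t < \<delta> \<longrightarrow> x0 < p t)"
proof -
  obtain f where hd: "half_data a f"
    and per: "AE x in lborel. pos_part (initial_F a fI x) = half_data.per a f x"
    and mass: "(LINT x|lebesgue. pos_part (fI x)) = half_data.mass f"
    and first: "(LINT x:{..<0}|lebesgue. x * pos_part (fI x)) = (LBINT y. y * f y)"
    by (rule half_initial[OF a L1 L1x neg z pos])
  interpret D: half_data a f by (rule hd)
  obtain Ux Uxx where hp: "half_problem k (\<lambda>x t. exp (- bl t) * F x t) Ux Uxx p"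
    and Ux: "\<And>t. 0 < t \<Longrightarrow> - k * Ux (p t) t = exp (- bl t) * transaction_rate k F p t"
    using half_problem_price[OF k sol fb lip] by blast
  interpret P: half_problem k "\<lambda>x t. exp (- bl t) * F x t" Ux Uxx p by (rule hp)
  have rate: "P.rate s = exp (- bl s) * transaction_rate k F p s" if "0 < s" for s
    unfolding P.rate_def using Ux[OF that] by simp
  have u: "P.u x t = exp (- bl t) * pos_part (F x t)" for x t
    by (simp add: P.u_def pos_part_def max_mult_distrib_left)
  have init: "AE x in lborel. F x 0 = initial_F a fI x"
    using sol unfolding price_solution_def by (simp add: AE_completion_iff)
  have u0: "AE x in lborel. P.u x 0 = D.per x"
    using init per by eventually_elim (simp add: u bl0)
  obtain M where M: "0 \<le> M" "\<And>x t. 0 \<le> t \<Longrightarrow> t \<le> 0 \<Longrightarrow> P.u x t \<le> M" using P.u_bounded[of 0] by blast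
  have um: "(\<lambda>x. P.u x 0) \<in> borel_measurable borel"
    by (intro borel_measurable_continuous_onI P.u_cont_space) simp
  have u0_heat: "(LBINT x. P.u x 0 * heat c (x0 - x)) = (LBINT x. heat c (x0 - x) * D.per x)" for c x0
  proof (rule integral_cong_AE)
    show "AE x in lborel. P.u x 0 * heat c (x0 - x) = heat c (x0 - x) * D.per x"
      using u0 by eventually_elim simp
  qed (use um in measurable)
  show ?thesis
  proof (rule that[OF hd mass first])
    fix x0 t T :: real assume t: "0 < t" "t < T"
    have eq: "set_integrable lborel {0<..t} (\<lambda>s. P.rate s * heat (k * (T - s)) (x0 - p s)) =
        set_integrable lborel {0<..t} (\<lambda>s. exp (- bl s) * transaction_rate k F p s * heat (k * (T - s)) (x0 - p s))"
      by (rule set_integrable_cong) (auto simp: rate)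
    show "set_integrable lborel {0<..t} (\<lambda>s. exp (- bl s) * transaction_rate k F p s * heat (k * (T - s)) (x0 - p s))"
      using P.heat_identity(1)[OF t, of x0] unfolding eq .
    have "(LBINT s:{0<..t}. P.rate s * heat (k * (T - s)) (x0 - p s))
      = (LBINT s:{0<..t}. exp (- bl s) * transaction_rate k F p s * heat (k * (T - s)) (x0 - p s))"
      by (rule set_lebesgue_integral_cong) (auto simp: rate)
    then show "(LBINT x. exp (- bl t) * pos_part (F x t) * heat (k * (T - t)) (x0 - x))
        = (LBINT x. heat (k * T) (x0 - x) * D.per x)
          - (LBINT s:{0<..t}. exp (- bl s) * transaction_rate k F p s * heat (k * (T - s)) (x0 - p s))"
      using P.heat_identity(2)[OF t, of x0, unfolded u0_heat] by (simp add: u)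
  next
    fix x0 t c :: real assume "0 < t" "0 < c"
    then show "integrable lborel (\<lambda>x. exp (- bl t) * pos_part (F x t) * heat c (x0 - x))"
      using P.u_heat_integrable[of t c x0] by (simp add: u)
  next
    fix s :: real assume s: "0 < s"
    have "0 \<le> exp (- bl s) * transaction_rate k F p s"
      using P.rate_nonneg[OF s] rate[OF s] by simp
    then show "0 \<le> transaction_rate k F p s" by (simp add: zero_le_mult_iff)
  next
    have "(\<lambda>s. indicator {0<..} s *\<^sub>R P.rate s) = (\<lambda>s. indicator {0<..} s *\<^sub>R (exp (- bl s) * transaction_rate k F p s))"
      by (auto simp: fun_eq_iff indicator_def rate)
    then show "set_borel_measurable lborel {0<..} (\<lambda>s. exp (- bl s) * transaction_rate k F p s)"
      using P.rate_measurable by (simp add: set_borel_measurable_def)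
  next
    show "isCont p t" if "0 < t" for t by (rule P.isCont_p[OF that])
  next
    fix x0 c :: real assume c: "0 < c"
    have "(LBINT x. P.u x 0 * heat c (x0 - x)) \<le> (LBINT x. M * heat c (x0 - x))"
    proof (rule integral_mono)
      show "integrable lborel (\<lambda>x. P.u x 0 * heat c (x0 - x))" by (rule P.u_heat_integrable) (use c in auto)
      show "integrable lborel (\<lambda>x. M * heat c (x0 - x))" by (intro integrable_mult_right integrable_heat_shift c)
      show "P.u x 0 * heat c (x0 - x) \<le> M * heat c (x0 - x)" for x
        using M(2)[of 0 x] heat_nonneg[OF c] by (intro mult_right_mono) auto
    qed
    then show "(LBINT x. heat c (x0 - x) * D.per x) \<le> M"
      unfolding u0_heat using integral_heat_shift[OF c, of x0] by simp
  next
    assume m: "0 < D.mass"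
    have "\<exists>x0. 0 < F x0 0"
    proof (rule ccontr)
      assume "\<not> (\<exists>x0. 0 < F x0 0)"
      then have uz: "P.u x 0 = 0" for x by (auto simp: u pos_part_def max_def not_less)
      have "AE x in lborel. f x = 0"
        using u0
      proof eventually_elim
        case (elim x)
        then show ?case using D.f_le_per[of x] D.f_nonneg[of x] uz[of x] by simp
      qed
      then have "D.mass = 0" unfolding D.mass_def by (rule integral_eq_zero_AE)
      then show False using m by simp
    qed
    then obtain x0 where x0: "0 < F x0 0" by blast
    have "((\<lambda>t. exp (- bl t) * F x0 t) \<longlongrightarrow> exp (- bl 0) * F x0 0) (at 0 within {0..})"
      using P.cont_time[of x0] by (simp add: continuous_on_def)
    from order_tendstoD(1)[OF this, of 0] x0 bl0
    have "\<forall>\<^sub>F t in at 0 within {0..}. 0 < exp (- bl t) * F x0 t" by simp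
    then obtain \<delta> where \<delta>: "0 < \<delta>" "\<And>t. t \<in> {0..} \<Longrightarrow> t \<noteq> 0 \<Longrightarrow> dist t 0 < \<delta> \<Longrightarrow> 0 < exp (- bl t) * F x0 t"
      unfolding eventually_at by blast
    have "x0 < p t" if "0 < t" "t < \<delta>" for t
      using \<delta>(2)[of t] that P.U_pos_iff[of t x0] by (simp add: dist_real_def)
    then show "\<exists>x0 \<delta>. 0 < \<delta> \<and> (\<forall>t. 0 < t \<and> t < \<delta> \<longrightarrow> x0 < p t)" using \<delta>(1) by blast
  qed
qed

section \<open>Combination of the two halves\<close>

lemma initial_F_reflect: "initial_F a (\<lambda>x. - fI (- x)) x = - initial_F a fI (- x)"
proof -
  have e: "neg_part (- y) = pos_part y" "pos_part (- y) = neg_part y" for y by (auto simp: neg_part_def pos_part_def)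
  have m: "- (x + y) = - x - y" "- (x - y) = - x + y" for x y :: real by simp_all
  show ?thesis by (simp add: initial_F_def e m)
qed

lemma
  fixes f :: "real \<Rightarrow> real"
  shows integrable_lebesgue_reflect: "integrable lebesgue (\<lambda>x. f (- x)) \<longleftrightarrow> integrable lebesgue f"
    and integral_lebesgue_reflect: "(LINT x|lebesgue. f (- x)) = (LINT x|lebesgue. f x)"
proof -
  have iff: "has_bochner_integral lebesgue (\<lambda>x. f (- x)) i \<longleftrightarrow> has_bochner_integral lebesgue f i" for i
    using has_bochner_integral_lebesgue_real_affine_iff[of "-1" f i 0] by simp
  show 1: "integrable lebesgue (\<lambda>x. f (- x)) \<longleftrightarrow> integrable lebesgue f"
    using iff by (auto simp: integrable.simps)
  show "(LINT x|lebesgue. f (- x)) = (LINT x|lebesgue. f x)"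
  proof (cases "integrable lebesgue f")
    case True
    then have "has_bochner_integral lebesgue f (LINT x|lebesgue. f x)" by (simp add: has_bochner_integral_iff)
    then show ?thesis using iff has_bochner_integral_integral_eq by blast
  next
    case False
    then show ?thesis using 1 by (simp add: not_integrable_integral_eq)
  qed
qed

text \<open>Turns the convergence rate of \<open>bl\<close> and \<open>br\<close> into decay of
  \<zeta>.\<close>

lemma abs_exp_minus_one_le: "\<bar>exp x - 1\<bar> \<le> \<bar>x\<bar> * exp \<bar>x\<bar>" for x :: real
proof (cases "0 \<le> x")
  case True
  have "1 - x \<le> exp (- x)" using exp_ge_add_one_self[of "- x"] by simp
  then have "(1 - x) * exp x \<le> exp (- x) * exp x" by (rule mult_right_mono) simp
  then have "exp x - x * exp x \<le> 1" by (simp add: algebra_simps flip: exp_add)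
  then show ?thesis using True by simp
next
  case False
  have "- x * 1 \<le> - x * exp (- x)" using False by (intro mult_left_mono) auto
  moreover have "1 + x \<le> exp x" "exp x \<le> 1" using False by (auto intro: exp_ge_add_one_self)
  moreover have "\<bar>x\<bar> = - x" "\<bar>exp x - 1\<bar> = 1 - exp x" using False by auto
  ultimately show ?thesis by (simp only:)
qed

text \<open>A function that is not integrable has integral 0 by convention; the first conjunct
  certifies that the integral in \<open>\<beta>2\<close> is genuine.\<close>

theorem theorem4p5:
  fixes k a w Ml Mr blinf brinf linf rinf \<alpha>l \<alpha>r \<alpha> \<beta>2 :: real
    and fI bl br b p lam \<zeta> :: "real \<Rightarrow> real"
    and F :: "real \<Rightarrow> real \<Rightarrow> real"
  assumes "k > 0" and "a > 0"
    and "Linf_on UNIV fI" and "L1_on UNIV fI" and "L1_on UNIV (\<lambda>x. x * fI x)"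
    and "\<forall>x<0. fI x \<ge> 0" and "fI 0 = 0" and "\<forall>x>0. fI x \<le> 0"
    and "Ml = (LINT x|lebesgue. pos_part (fI x))" and "Ml > 0"
    and "Mr = (LINT x|lebesgue. neg_part (fI x))" and "Mr > 0"
    and "W1inf_on UNIV (initial_F a fI)"
    and "\<exists>L. L-lipschitz_on {0..} bl" and "\<exists>L. L-lipschitz_on {0..} br"
    and "bl 0 = 0" and "br 0 = 0"
    and "b = (\<lambda>t. 1/2 * (bl t - br t))"
    and "W1inf_on {0<..} b" and "W11_on {0<..} b"
    and "(bl \<longlongrightarrow> blinf) at_top" and "(br \<longlongrightarrow> brinf) at_top"
    and "w > 3/2"
    and "\<exists>C. \<forall>t>0. \<bar>bl t - blinf\<bar> + \<bar>br t - brinf\<bar> \<le> C * (1 + t) powr (- w)"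
    and "linf = exp blinf" and "rinf = exp brinf"
    and "\<alpha>l = linf / a * Ml" and "\<alpha>r = rinf / a * Mr"
    and "\<alpha>l = \<alpha>" and "\<alpha>r = \<alpha>"
    and "price_solution k bl br (initial_F a fI) F"
    and "free_boundary F p"
    and "lam = transaction_rate k F p"
    and "\<zeta> = (\<lambda>s. exp (blinf - bl s) - exp (brinf - br s))"
    and "\<beta>2 = 1 / (2 * \<alpha> * a) *
           (linf * (LINT z:{..<0}|lebesgue. z * pos_part (fI z))
            + rinf * (LINT z:{0<..}|lebesgue. z * neg_part (fI z))
            - a * (LINT s:{0<..}|lebesgue. \<zeta> s * lam s))"
  shows "set_integrable lebesgue {0<..} (\<lambda>s. \<zeta> s * lam s) \<and>
         (\<lambda>t. p t - \<beta>2) \<in> o[at_top](\<lambda>_. 1)"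
proof -
  have k: "0 < k" and a: "0 < a" by fact+
  have L1: "L1_on UNIV fI" and L1x: "L1_on UNIV (\<lambda>x. x * fI x)" by fact+
  have neg: "\<forall>x<0. fI x \<ge> 0" and z0: "fI 0 = 0" and pos: "\<forall>x>0. fI x \<le> 0" by fact+
  have sol: "price_solution k bl br (initial_F a fI) F" and fb: "free_boundary F p" by fact+
  have lam: "lam = transaction_rate k F p" by fact
  have \<zeta>: "\<zeta> = (\<lambda>s. exp (blinf - bl s) - exp (brinf - br s))" by fact
  obtain Ll where Ll: "Ll-lipschitz_on {0..} bl" using assms by blast
  obtain Lr where Lr: "Lr-lipschitz_on {0..} br" using assms by blast
  obtain fl Ml' where L:
    "half_data a fl"
    "(LINT x|lebesgue. pos_part (fI x)) = half_data.mass fl"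
    "(LINT x:{..<0}|lebesgue. x * pos_part (fI x)) = (LBINT y. y * fl y)"
    "\<And>x0 t T. 0 < t \<Longrightarrow> t < T \<Longrightarrow>
        set_integrable lborel {0<..t} (\<lambda>s. exp (- bl s) * lam s * heat (k * (T - s)) (x0 - p s))"
    "\<And>x0 t T. 0 < t \<Longrightarrow> t < T \<Longrightarrow>
        (LBINT x. exp (- bl t) * pos_part (F x t) * heat (k * (T - t)) (x0 - x))
        = (LBINT x. heat (k * T) (x0 - x) * half_data.per a fl x)
          - (LBINT s:{0<..t}. exp (- bl s) * lam s * heat (k * (T - s)) (x0 - p s))"
    "\<And>x0 t c. 0 < t \<Longrightarrow> 0 < c \<Longrightarrow> integrable lborel (\<lambda>x. exp (- bl t) * pos_part (F x t) * heat c (x0 - x))"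
    "\<And>s. 0 < s \<Longrightarrow> 0 \<le> lam s"
    "set_borel_measurable lborel {0<..} (\<lambda>s. exp (- bl s) * lam s)"
    "\<And>t. 0 < t \<Longrightarrow> isCont p t"
    "\<And>x0 c. 0 < c \<Longrightarrow> (LBINT x. heat c (x0 - x) * half_data.per a fl x) \<le> Ml'"
    "0 < half_data.mass fl \<Longrightarrow> \<exists>x0 \<delta>. 0 < \<delta> \<and> (\<forall>t. 0 < t \<and> t < \<delta> \<longrightarrow> x0 < p t)"
    unfolding lam
    by (rule half_price_summary[OF k a L1 L1x neg z0 pos sol fb Ll \<open>bl 0 = 0\<close>]) blast
  \<comment> \<open>The right half, reflected to the left: \<open>gI\<close> and \<open>G\<close>
    satisfy the same assumptions, with \<open>bl\<close> and \<open>br\<close> exchanged and with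
    boundary \<open>- p\<close>.\<close>
  define gI where "gI x = - fI (- x)" for x
  define G where "G x t = - F (- x) t" for x t
  have gI_pos: "pos_part (gI x) = neg_part (fI (- x))" for x by (simp add: gI_def pos_part_def neg_part_def)
  have G_pos: "pos_part (G x t) = neg_part (F (- x) t)" for x t by (simp add: G_def pos_part_def neg_part_def)
  have gL1: "L1_on UNIV gI"
    using L1 integrable_lebesgue_reflect[of fI] by (simp add: L1_on_def set_integrable_def gI_def[abs_def])
  have gL1x: "L1_on UNIV (\<lambda>x. x * gI x)"
    using L1x integrable_lebesgue_reflect[of "\<lambda>x. x * fI x"] by (simp add: L1_on_def set_integrable_def gI_def[abs_def])
  have gsign: "\<forall>x<0. gI x \<ge> 0" "gI 0 = 0" "\<forall>x>0. gI x \<le> 0" using neg pos z0 by (auto simp: gI_def)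
  have gsol: "price_solution k br bl (initial_F a gI) G"
    using price_solution_reflect[OF sol] unfolding G_def[abs_def] gI_def[abs_def] initial_F_reflect[abs_def] .
  have gfb: "free_boundary G (\<lambda>t. - p t)"
    using free_boundary_reflect[OF fb] unfolding G_def[abs_def] .
  have grate: "transaction_rate k G (\<lambda>t. - p t) s = lam s" if "0 < s" for s
    using transaction_rate_reflect[OF sol that] unfolding G_def[abs_def] lam .
  obtain fr Mr' where R0:
    "half_data a fr"
    "(LINT x|lebesgue. pos_part (gI x)) = half_data.mass fr"
    "(LINT x:{..<0}|lebesgue. x * pos_part (gI x)) = (LBINT y. y * fr y)"
    "\<And>x0 t T. 0 < t \<Longrightarrow> t < T \<Longrightarrow>
        set_integrable lborel {0<..t} (\<lambda>s. exp (- br s) * transaction_rate k G (\<lambda>t. - p t) s * heat (k * (T - s)) (x0 - - p s))"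
    "\<And>x0 t T. 0 < t \<Longrightarrow> t < T \<Longrightarrow>
        (LBINT x. exp (- br t) * pos_part (G x t) * heat (k * (T - t)) (x0 - x))
        = (LBINT x. heat (k * T) (x0 - x) * half_data.per a fr x)
          - (LBINT s:{0<..t}. exp (- br s) * transaction_rate k G (\<lambda>t. - p t) s * heat (k * (T - s)) (x0 - - p s))"
    "\<And>x0 t c. 0 < t \<Longrightarrow> 0 < c \<Longrightarrow> integrable lborel (\<lambda>x. exp (- br t) * pos_part (G x t) * heat c (x0 - x))"
    "0 < half_data.mass fr \<Longrightarrow> \<exists>x0 \<delta>. 0 < \<delta> \<and> (\<forall>t. 0 < t \<and> t < \<delta> \<longrightarrow> x0 < - p t)"
    by (rule half_price_summary[OF k a gL1 gL1x gsign gsol gfb Lr \<open>br 0 = 0\<close>]) blast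
  interpret HL: half_data a fl by (rule L(1))
  interpret HR: half_data a fr by (rule R0(1))

  have flip: "heat c (- x0 - - p s) = heat c (x0 - p s)" for c x0 s
    using heat_minus[of c "x0 - p s"] by simp
  have R_int: "set_integrable lborel {0<..t} (\<lambda>s. exp (- br s) * lam s * heat (k * (T - s)) (x0 - p s))"
    if "0 < t" "t < T" for x0 t T
  proof -
    have "set_integrable lborel {0<..t} (\<lambda>s. exp (- br s) * transaction_rate k G (\<lambda>t. - p t) s * heat (k * (T - s)) (- x0 - - p s))
       = set_integrable lborel {0<..t} (\<lambda>s. exp (- br s) * lam s * heat (k * (T - s)) (x0 - p s))"
      unfolding flip by (rule set_integrable_cong) (auto simp: grate)
    with R0(4)[OF that, of "- x0"] show ?thesis by blast
  qed
  have reflect: "(LBINT x. q (- x)) = (LBINT x. q x)" "integrable lborel (\<lambda>x. q (- x)) \<longleftrightarrow> integrable lborel q"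
    for q :: "real \<Rightarrow> real"
    using lborel_integral_real_affine[of "-1" q 0] lborel_integrable_real_affine_iff[of "-1" q 0] by simp_all
  have R_eq: "(LBINT x. exp (- br t) * neg_part (F x t) * heat (k * (T - t)) (x0 - x))
        = (LBINT x. heat (k * T) (- x0 - x) * HR.per x)
          - (LBINT s:{0<..t}. exp (- br s) * lam s * heat (k * (T - s)) (x0 - p s))"
    if "0 < t" "t < T" for x0 t T
  proof -
    have h: "heat c (- x0 - - x) = heat c (x0 - x)" for c x using heat_minus[of c "x0 - x"] by simp
    have "(LBINT x. exp (- br t) * neg_part (F x t) * heat (k * (T - t)) (x0 - x))
       = (LBINT x. exp (- br t) * pos_part (G (- x) t) * heat (k * (T - t)) (- x0 - - x))"
      by (simp only: G_pos h minus_minus)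
    also have "\<dots> = (LBINT x. exp (- br t) * pos_part (G x t) * heat (k * (T - t)) (- x0 - x))"
      by (rule reflect(1))
    also have "\<dots> = (LBINT x. heat (k * T) (- x0 - x) * HR.per x)
          - (LBINT s:{0<..t}. exp (- br s) * transaction_rate k G (\<lambda>t. - p t) s * heat (k * (T - s)) (- x0 - - p s))"
      by (rule R0(5)[OF that])
    also have "(LBINT s:{0<..t}. exp (- br s) * transaction_rate k G (\<lambda>t. - p t) s * heat (k * (T - s)) (- x0 - - p s))
       = (LBINT s:{0<..t}. exp (- br s) * lam s * heat (k * (T - s)) (x0 - p s))"
      unfolding flip by (rule set_lebesgue_integral_cong) (auto simp: grate)
    finally show ?thesis .
  qed
  have R_heat_int: "integrable lborel (\<lambda>x. exp (- br t) * neg_part (F x t) * heat c (x0 - x))"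
    if "0 < t" "0 < c" for x0 t c
  proof -
    have "integrable lborel (\<lambda>x. exp (- br t) * pos_part (G (- x) t) * heat c (- x0 - - x))"
      using R0(6)[OF that, of "- x0"] reflect(2)[of "\<lambda>x. exp (- br t) * pos_part (G x t) * heat c (- x0 - x)"] by blast
    moreover have "heat c (- x0 - - x) = heat c (x0 - x)" for x using heat_minus[of c "x0 - x"] by simp
    ultimately show ?thesis by (simp only: G_pos minus_minus)
  qed

  obtain Cb where Cb: "\<And>t. 0 < t \<Longrightarrow> \<bar>bl t - blinf\<bar> + \<bar>br t - brinf\<bar> \<le> Cb * (1 + t) powr (- w)" using assms by blast
  have Cb0: "0 \<le> Cb"
  proof -
    have "0 \<le> Cb * (1 + 1) powr (- w)" using Cb[of 1] by linarith
    then show ?thesis by (simp add: zero_le_mult_iff)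
  qed
  \<comment> \<open>The exponent \<open>- w\<close> lies below -1, which gives the form of decay in
    which \<zeta> is bounded.\<close>
  have Cb1: "\<bar>bl t - blinf\<bar> + \<bar>br t - brinf\<bar> \<le> Cb / (1 + t)" if t: "0 < t" for t
  proof -
    have "(1 + t) powr (- w) \<le> (1 + t) powr (- 1)" using t \<open>w > 3/2\<close> by (intro powr_mono) auto
    also have "\<dots> = 1 / (1 + t)" using t by (simp add: powr_minus_divide)
    finally have "Cb * (1 + t) powr (- w) \<le> Cb * (1 / (1 + t))" using Cb0 by (rule mult_left_mono)
    then show ?thesis using Cb[OF t] by simp
  qed
  have Cb2: "\<bar>bl t - blinf\<bar> + \<bar>br t - brinf\<bar> \<le> Cb" if t: "0 < t" for t
  proof -
    have "Cb / (1 + t) \<le> Cb / 1" using t Cb0 by (intro divide_left_mono) auto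
    then show ?thesis using Cb1[OF t] by simp
  qed
  \<comment> \<open>\<open>Cb\<close> comes from the distances to the limits, \<open>exp Cb\<close>
    from exponentials whose arguments are at most \<open>Cb\<close> in modulus.\<close>
  define Cz where "Cz = Cb * exp Cb"
  have \<zeta>_bound: "\<bar>\<zeta> s\<bar> \<le> Cz / (1 + s)" if s: "0 < s" for s
  proof -
    define x y where "x = blinf - bl s" and "y = brinf - br s"
    have xy: "\<bar>x\<bar> + \<bar>y\<bar> \<le> Cb / (1 + s)" "\<bar>x\<bar> \<le> Cb" "\<bar>y\<bar> \<le> Cb"
      using Cb1[OF s] Cb2[OF s] unfolding x_def y_def by linarith+
    have "\<bar>exp x - 1\<bar> \<le> \<bar>x\<bar> * exp Cb" "\<bar>exp y - 1\<bar> \<le> \<bar>y\<bar> * exp Cb"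
      using order_trans[OF abs_exp_minus_one_le[of x] mult_left_mono[of "exp \<bar>x\<bar>" "exp Cb" "\<bar>x\<bar>"]]
        order_trans[OF abs_exp_minus_one_le[of y] mult_left_mono[of "exp \<bar>y\<bar>" "exp Cb" "\<bar>y\<bar>"]] xy by simp_all
    then have "\<bar>exp x - exp y\<bar> \<le> (\<bar>x\<bar> + \<bar>y\<bar>) * exp Cb" unfolding distrib_right by linarith
    also have "\<dots> \<le> Cb / (1 + s) * exp Cb" using xy by (intro mult_right_mono) auto
    finally show ?thesis by (simp add: \<zeta> x_def y_def Cz_def)
  qed
  have cont_l: "continuous_on {0<..} bl" and cont_r: "continuous_on {0<..} br"
    using lipschitz_on_continuous_on[OF Ll] lipschitz_on_continuous_on[OF Lr]
    by (auto elim: continuous_on_subset)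
  have \<zeta>_meas: "set_borel_measurable lborel {0<..} \<zeta>"
  proof -
    have "continuous_on {0<..} \<zeta>" unfolding \<zeta> by (intro continuous_intros cont_l cont_r)
    then show ?thesis by (rule continuous_on_set_borel_measurable[rotated]) simp
  qed
  have exp_meas: "set_borel_measurable lborel {0<..} (\<lambda>s. exp (bl s))"
    by (intro continuous_on_set_borel_measurable continuous_intros cont_l) simp
  have exp_cancel: "exp (bl s) * (exp (- bl s) * y) = y" for s y by (simp add: exp_minus field_simps)
  have lam_meas: "set_borel_measurable lborel {0<..} lam"
    using set_borel_measurable_times[OF exp_meas L(8) subset_refl] unfolding exp_cancel .
  \<comment> \<open>An upper bound for \<open>exp (bl s)\<close>, by which a bound on
    \<open>exp (- bl s) * lam s\<close> becomes one on \<open>lam s\<close>.\<close>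
  define E where "E = exp (\<bar>blinf\<bar> + Cb)"
  have bl_le: "exp (bl s) \<le> E" if "0 < s" for s
    using Cb2[OF that] unfolding E_def exp_le_cancel_iff by linarith

  have lam_heat: "set_integrable lborel {0<..t} (\<lambda>s. lam s * heat (k * (T - s)) (x0 - p s))"
    and lam_heat_le: "(LBINT s:{0<..t}. lam s * heat (k * (T - s)) (x0 - p s)) \<le> E * Ml'"
    if t: "0 < t" "t < T" for t T x0
  proof -
    let ?h = "\<lambda>s. exp (- bl s) * lam s * heat (k * (T - s)) (x0 - p s)"
    let ?g = "\<lambda>s. lam s * heat (k * (T - s)) (x0 - p s)"
    have h0: "0 \<le> ?h s" if "s \<in> {0<..t}" for s
      using that L(7)[of s] heat_nonneg[of "k * (T - s)" "x0 - p s"] t k by simp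
    have b: "\<bar>?g s\<bar> \<le> E * ?h s" if "s \<in> {0<..t}" for s
    proof -
      have e: "exp (bl s) * ?h s = ?g s" by (simp only: mult.assoc exp_cancel)
      have "\<bar>exp (bl s) * ?h s\<bar> = exp (bl s) * ?h s"
        by (rule abs_of_nonneg[OF mult_nonneg_nonneg[OF exp_ge_zero h0[OF that]]])
      also have "\<dots> \<le> E * ?h s" by (rule mult_right_mono[OF bl_le h0[OF that]]) (use that in simp)
      finally show ?thesis unfolding e .
    qed
    have m: "set_borel_measurable lborel {0<..t} ?g"
      using set_borel_measurable_times[OF exp_meas set_integrable_measurable[OF L(4)[OF t, of x0]]]
      unfolding mult.assoc exp_cancel by (simp add: subset_iff)
    have E0: "0 \<le> E" by (simp add: E_def)
    note D = set_integral_dominated[OF m L(4)[OF t] subset_refl b E0 h0]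
    show "set_integrable lborel {0<..t} ?g" by (rule D(1))
    have "(LBINT s:{0<..t}. ?g s) \<le> \<bar>LBINT s:{0<..t}. ?g s\<bar>" by (rule abs_ge_self)
    also have "\<dots> \<le> E * (LBINT s:{0<..t}. ?h s)" by (rule D(2))
    also have "\<dots> \<le> E * Ml'"
    proof (rule mult_left_mono)
      \<comment> \<open>The evolved positive part is nonnegative, so the Duhamel integral cannot
        exceed the evolved initial value. This is where the uniform constant originates.\<close>
      have "0 \<le> (LBINT x. exp (- bl t) * pos_part (F x t) * heat (k * (T - t)) (x0 - x))"
      proof (rule integral_nonneg_AE, rule AE_I2)
        show "0 \<le> exp (- bl t) * pos_part (F x t) * heat (k * (T - t)) (x0 - x)" for x
          using heat_nonneg[of "k * (T - t)" "x0 - x"] t k by (simp add: pos_part_def)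
      qed
      moreover have "(LBINT x. heat (k * T) (x0 - x) * HL.per x) \<le> Ml'"
        by (rule L(10)) (use t k in simp)
      ultimately show "(LBINT s:{0<..t}. ?h s) \<le> Ml'" using L(5)[OF t, of x0] by linarith
    qed (simp add: E_def)
    finally show "(LBINT s:{0<..t}. ?g s) \<le> E * Ml'" .
  qed

  define V where "V x t = linf * (exp (- bl t) * pos_part (F x t)) - rinf * (exp (- br t) * neg_part (F x t))" for x t
  define v where "v t T x0 = (LBINT x. V x t * heat (k * (T - t)) (x0 - x))" for t T x0
  \<comment> \<open>Both halves lose the same \<lambda>; with the weights \<open>linf\<close> and
    \<open>rinf\<close> the difference of the two losses has exactly this strength.\<close>
  have \<zeta>_eq: "\<zeta> s = linf * exp (- bl s) - rinf * exp (- br s)" for s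
    unfolding \<zeta> \<open>linf = exp blinf\<close> \<open>rinf = exp brinf\<close> by (simp add: exp_diff exp_minus field_simps)
  have duhamel: "v t T x0 = linf * (LBINT x. heat (k * T) (x0 - x) * HL.per x)
        - rinf * (LBINT x. heat (k * T) (- x0 - x) * HR.per x)
        - (LBINT s:{0<..t}. \<zeta> s * lam s * heat (k * (T - s)) (x0 - p s))"
    if t: "0 < t" "t < T" for t T x0
  proof -
    have c: "0 < k * (T - t)" using t k by simp
    have "v t T x0 = (LBINT x. linf * (exp (- bl t) * pos_part (F x t) * heat (k * (T - t)) (x0 - x))
        - rinf * (exp (- br t) * neg_part (F x t) * heat (k * (T - t)) (x0 - x)))"
      unfolding v_def V_def by (simp only: left_diff_distrib mult.assoc)
    also have "\<dots> = linf * (LBINT x. exp (- bl t) * pos_part (F x t) * heat (k * (T - t)) (x0 - x))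
        - rinf * (LBINT x. exp (- br t) * neg_part (F x t) * heat (k * (T - t)) (x0 - x))"
      by (subst Bochner_Integration.integral_diff[OF integrable_mult_right[OF L(6)[OF t(1) c]] integrable_mult_right[OF R_heat_int[OF t(1) c]]])
         (simp only: integral_mult_right_zero)
    finally have 1: "v t T x0 = \<dots>" .
    have "(LBINT s:{0<..t}. \<zeta> s * lam s * heat (k * (T - s)) (x0 - p s))
       = (LBINT s:{0<..t}. linf * (exp (- bl s) * lam s * heat (k * (T - s)) (x0 - p s))
           - rinf * (exp (- br s) * lam s * heat (k * (T - s)) (x0 - p s)))"
      unfolding \<zeta>_eq by (simp only: left_diff_distrib mult.assoc)
    also have "\<dots> = linf * (LBINT s:{0<..t}. exp (- bl s) * lam s * heat (k * (T - s)) (x0 - p s))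
        - rinf * (LBINT s:{0<..t}. exp (- br s) * lam s * heat (k * (T - s)) (x0 - p s))"
      using L(4)[OF t, of x0] R_int[OF t, of x0] by (subst set_integral_diff) auto
    finally show ?thesis unfolding 1 L(5)[OF t] R_eq[OF t] by (simp add: right_diff_distrib)
  qed
  have approx: "\<exists>\<epsilon>>0. \<epsilon> \<le> 1 \<and> \<bar>v t (t + \<epsilon>) (p t)\<bar> \<le> \<eta>" if t: "0 < t" and \<eta>: "0 < \<eta>" for t \<eta>
  proof -
    have Fc: "continuous_on UNIV (\<lambda>x. F x t)"
      using sol t unfolding price_solution_def by (intro continuous_on_slices(1)[of UNIV "{0..}" F]) auto
    have Vc: "continuous_on UNIV (\<lambda>x. V x t)"
      unfolding V_def pos_part_def neg_part_def by (intro continuous_intros Fc)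
    have "bounded ((\<lambda>(x, t). F x t) ` (UNIV \<times> {0..t}))" using sol unfolding price_solution_def by blast
    then obtain B where B: "\<forall>y\<in>(\<lambda>(x, t). F x t) ` (UNIV \<times> {0..t}). norm y \<le> B" unfolding bounded_iff by blast
    have FB: "\<bar>F x t\<bar> \<le> B" for x
    proof -
      have "F x t \<in> (\<lambda>(x, t). F x t) ` (UNIV \<times> {0..t})" using t by (intro image_eqI[of _ _ "(x, t)"]) auto
      then show ?thesis using B by auto
    qed
    have lr: "0 \<le> linf" "0 \<le> rinf" using \<open>linf = exp blinf\<close> \<open>rinf = exp brinf\<close> by auto
    have VB: "\<bar>V x t\<bar> \<le> linf * (exp (- bl t) * B) + rinf * (exp (- br t) * B)" for x
    proof -
      have "\<bar>pos_part (F x t)\<bar> \<le> B" "\<bar>neg_part (F x t)\<bar> \<le> B" using FB[of x] by (auto simp: pos_part_def neg_part_def)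
      then have "\<bar>linf * (exp (- bl t) * pos_part (F x t))\<bar> \<le> linf * (exp (- bl t) * B)"
        "\<bar>rinf * (exp (- br t) * neg_part (F x t))\<bar> \<le> rinf * (exp (- br t) * B)"
        using lr by (simp_all add: abs_mult mult_left_mono)
      then show ?thesis unfolding V_def by linarith
    qed
    \<comment> \<open>V vanishes at the boundary, so its mollification there tends to 0 as the delay
      shrinks.\<close>
    have Vp: "V (p t) t = 0" using fb t by (simp add: V_def free_boundary_def pos_part_def neg_part_def)
    have c0: "(\<lambda>n. k * (1 / real (Suc n))) \<longlonglongrightarrow> 0"
      using tendsto_mult_left[OF LIMSEQ_inverse_real_of_nat, of k] by (simp add: inverse_eq_divide)
    have "(\<lambda>n. LBINT x. V x t * heat (k * (1 / real (Suc n))) (p t - x)) \<longlonglongrightarrow> V (p t) t"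
      by (rule heat_approximate_identity[OF Vc VB _ c0]) (use k in simp)
    then have "(\<lambda>n. v t (t + 1 / real (Suc n)) (p t)) \<longlonglongrightarrow> 0" unfolding v_def Vp by simp
    from tendstoD[OF this \<eta>] obtain n where "dist (v t (t + 1 / real (Suc n)) (p t)) 0 < \<eta>"
      unfolding eventually_sequentially by blast
    then show ?thesis by (intro exI[of _ "1 / real (Suc n)"]) (auto simp: dist_real_def)
  qed

  have massl: "linf * HL.mass = \<alpha> * a"
  proof -
    have "\<alpha> = linf / a * HL.mass" using assms L(2) by simp
    then show ?thesis using a by simp
  qed
  have Mr_eq: "Mr = HR.mass"
    using assms R0(2) integral_lebesgue_reflect[of "\<lambda>x. neg_part (fI x)"] unfolding gI_pos by simp
  have massr: "rinf * HR.mass = \<alpha> * a"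
  proof -
    have "\<alpha> = rinf / a * HR.mass" using assms Mr_eq by simp
    then show ?thesis using a by simp
  qed
  have mass_pos: "0 < HL.mass" "0 < HR.mass" using assms L(2) Mr_eq by simp_all
  have lr: "0 < linf" "0 < rinf" using \<open>linf = exp blinf\<close> \<open>rinf = exp brinf\<close> by auto
  have \<alpha>: "0 < \<alpha>"
  proof -
    have "0 < \<alpha> * a" using mult_pos_pos[OF lr(1) mass_pos(1)] massl by simp
    then show ?thesis using a by (simp add: zero_less_mult_iff)
  qed
  have p_initial: "\<exists>\<delta>>0. \<exists>P. \<forall>t. 0 < t \<and> t < \<delta> \<longrightarrow> \<bar>p t\<bar> \<le> P"
  proof -
    obtain x1 \<delta>1 where 1: "0 < \<delta>1" "\<And>t. 0 < t \<Longrightarrow> t < \<delta>1 \<Longrightarrow> x1 < p t" using L(11)[OF mass_pos(1)] by blast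
    obtain x2 \<delta>2 where 2: "0 < \<delta>2" "\<And>t. 0 < t \<Longrightarrow> t < \<delta>2 \<Longrightarrow> x2 < - p t" using R0(7)[OF mass_pos(2)] by blast
    have "\<bar>p t\<bar> \<le> \<bar>x1\<bar> + \<bar>x2\<bar>" if "0 < t" "t < min \<delta>1 \<delta>2" for t
      using 1(2)[of t] 2(2)[of t] that by auto
    then show ?thesis using 1(1) 2(1) by (intro exI[of _ "min \<delta>1 \<delta>2"]) auto
  qed
  interpret A: rate_asymptotics a fl fr k linf rinf \<alpha> "E * Ml'" Cz lam p \<zeta> v
    by unfold_locales (fact k \<alpha> lr massl massr L(7) lam_meas \<zeta>_meas \<zeta>_bound lam_heat lam_heat_le duhamel approx L(9) p_initial)+

  have Z: "(LINT s:{0<..}|lebesgue. \<zeta> s * lam s) = A.net_source"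
    and Zi: "set_integrable lebesgue {0<..} (\<lambda>s. \<zeta> s * lam s)"
    using A.source_density_meas A.source_density_integrable
    unfolding A.net_source_def set_lebesgue_integral_def set_integrable_def set_borel_measurable_def
    by (simp_all add: integral_completion integrable_completion)
  \<comment> \<open>\<open>fr\<close> sits on the negative half line, so its first moment is minus
    that of the right part; this turns the minus in \<open>p_limit\<close> into the plus in
    \<open>\<beta>2\<close>.\<close>
  have Yr: "(LINT z:{0<..}|lebesgue. z * neg_part (fI z)) = - (LBINT y. y * fr y)"
  proof -
    have "(LINT z:{0<..}|lebesgue. z * neg_part (fI z)) = (LINT z|lebesgue. indicator {0<..} (- z) *\<^sub>R (- z * neg_part (fI (- z))))"
      unfolding set_lebesgue_integral_def by (rule integral_lebesgue_reflect[symmetric])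
    also have "\<dots> = (LINT z|lebesgue. - (indicator {..<0} z *\<^sub>R (z * pos_part (gI z))))"
      by (rule Bochner_Integration.integral_cong) (auto simp: gI_pos indicator_def)
    also have "\<dots> = - (LBINT y. y * fr y)"
      unfolding R0(3)[symmetric] set_lebesgue_integral_def by simp
    finally show ?thesis .
  qed
  have "(p \<longlongrightarrow> \<beta>2) at_top"
    using A.p_limit unfolding \<open>\<beta>2 = _\<close> Yr Z L(3) by simp
  then have "((\<lambda>t. p t - \<beta>2) \<longlongrightarrow> 0) at_top" by (simp add: LIM_zero_iff)
  then have "(\<lambda>t. p t - \<beta>2) \<in> o[at_top](\<lambda>_. 1)" by (intro smalloI_tendsto) auto
  with Zi show ?thesis by blast
qed

end
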